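(* Let $F$ be Thompson's group $F$. Every finitely generated normal subgroup of $F$ is $2$-generated (i.e. can be generated by two elements).
   Context: Thompson's group $F$ is the group (under composition) of all piecewise-linear homeomorphisms of the interval $[0,1]$ with finitely many breakpoints, where all breakpoints are dyadic fractions (numbers in $\mathbb{Z}[\frac12]\cap(0,1)$) and all slopes are integer powers of $2$. (In particular its elements fix $0$ and $1$.) *)

theory Defs
  imports "HOL-Analysis.Analysis" "HOL-Algebra.Algebra"
begin

(* The ring Z[1/2].  The library's dyadics only contains the nonnegative ones. *)
definition dyadic_rationals :: "real set" where
  "dyadic_rationals = {of_int m / 2 ^ n | (m :: int) (n :: nat). True}"

(* f is affine with slope an integer power of 2 on every open subinterval of [0,1] that
   avoids B; a point of B need not be a genuine breakpoint. *)
definition affine_pow2_off :: "real set \<Rightarrow> (real \<Rightarrow> real) \<Rightarrow> bool" where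
  "affine_pow2_off B f \<longleftrightarrow>
     (\<forall>a b. {a<..<b} \<subseteq> {0..1} - B \<longrightarrow>
        (\<exists>(k :: int) c. \<forall>x\<in>{a<..<b}. f x = 2 powi k * x + c))"

(* As in BijGroup, self-maps of [0,1] are represented by functions that are undefined
   outside [0,1], so that equality of maps is equality of functions. *)
definition thompson_F_maps :: "(real \<Rightarrow> real) set" where
  "thompson_F_maps =
     {f \<in> extensional {0..1}.
        (\<exists>g. homeomorphism {0..1} {0..1} f g) \<and>
        (\<exists>B. finite B \<and> B \<subseteq> dyadic_rationals \<inter> {0<..<1} \<and> affine_pow2_off B f)}"

definition thompson_F :: "(real \<Rightarrow> real) monoid" where
  "thompson_F = BijGroup {0..1} \<lparr>carrier := thompson_F_maps\<rparr>"

definition finitely_generated_subgroup :: "'a set \<Rightarrow> ('a, 'b) monoid_scheme \<Rightarrow> bool" where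
  "finitely_generated_subgroup H G \<longleftrightarrow>
     subgroup H G \<and> (\<exists>S. finite S \<and> S \<subseteq> carrier G \<and> generate G S = H)"

definition two_generated_subgroup :: "'a set \<Rightarrow> ('a, 'b) monoid_scheme \<Rightarrow> bool" where
  "two_generated_subgroup H G \<longleftrightarrow>
     subgroup H G \<and> (\<exists>a\<in>carrier G. \<exists>b\<in>carrier G. generate G {a, b} = H)"

lemma dyadic_int [simp]: "of_int m \<in> dyadic_rationals"
proof -
  have "(of_int m :: real) = of_int m / 2 ^ 0" by simp
  then show ?thesis unfolding dyadic_rationals_def by blast
qed

lemma dyadic_0_1 [simp]: "0 \<in> dyadic_rationals" "1 \<in> dyadic_rationals"
  using dyadic_int[of 0] dyadic_int[of 1] by simp_all

lemma dyadic_add: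
  assumes "x \<in> dyadic_rationals" "y \<in> dyadic_rationals"
  shows "x + y \<in> dyadic_rationals"
proof -
  obtain m n m' n' where xy: "x = of_int m / 2 ^ n" "y = of_int m' / 2 ^ n'"
    using assms unfolding dyadic_rationals_def by blast
  then have "x + y = of_int (m * 2 ^ n' + m' * 2 ^ n) / 2 ^ (n + n')"
    by (simp add: xy field_simps power_add)
  then show ?thesis unfolding dyadic_rationals_def by blast
qed

lemma dyadic_mult:
  assumes "x \<in> dyadic_rationals" "y \<in> dyadic_rationals"
  shows "x * y \<in> dyadic_rationals"
proof -
  obtain m n m' n' where xy: "x = of_int m / 2 ^ n" "y = of_int m' / 2 ^ n'"
    using assms unfolding dyadic_rationals_def by blast
  then have "x * y = of_int (m * m') / 2 ^ (n + n')"
    by (simp add: xy field_simps power_add)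
  then show ?thesis unfolding dyadic_rationals_def by blast
qed

lemma dyadic_diff:
  assumes "x \<in> dyadic_rationals" "y \<in> dyadic_rationals"
  shows "x - y \<in> dyadic_rationals"
  using dyadic_add[OF assms(1) dyadic_mult[OF dyadic_int[of "-1"] assms(2)]] by simp

lemma dyadic_powi: "2 powi k \<in> dyadic_rationals"
proof (cases "k \<ge> 0")
  case True
  then show ?thesis
    using dyadic_int[of "2 ^ nat k"] by (simp add: power_int_def)
next
  case False
  then have "(2::real) powi k = of_int 1 / 2 ^ nat (-k)"
    by (simp add: power_int_def field_simps)
  then show ?thesis unfolding dyadic_rationals_def by blast
qed

lemma thompson_F_strict_mono:
  assumes "f \<in> thompson_F_maps"
  shows "strict_mono_on {0..1} f"
proof -
  obtain g B where g: "homeomorphism {0..1} {0..1} f g" and B: "finite B" "B \<subseteq> {0<..<1}"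
    and aff: "affine_pow2_off B f"
    using assms unfolding thompson_F_maps_def by blast
  have "inj_on f {0..1}"
    using g unfolding homeomorphism_def by (metis inj_onI)
  moreover have "continuous_on {0..1} f" using g homeomorphism_def by blast
  ultimately have mono: "strict_mono_on {0..1} f \<or> strict_antimono_on {0..1} f"
    using injective_eq_monotone_map[of "{0..1::real}" f] by (simp add: is_interval_cc)
  define p where "p = Min (insert 1 B)"
  have p: "0 < p" "p \<le> 1" "\<And>b. b \<in> B \<Longrightarrow> p \<le> b"
    using B unfolding p_def by auto
  then have "{0<..<p} \<subseteq> {0..1} - B" by force
  then obtain k c where k: "\<forall>x\<in>{0<..<p}. f x = 2 powi (k::int) * x + c"
    using aff unfolding affine_pow2_off_def by blast
  have "f (p/3) < f (p/2)" using k p by simp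
  moreover have "p/3 \<in> {0..1}" "p/2 \<in> {0..1}" "p/3 < p/2" using p by auto
  ultimately show ?thesis
    using mono unfolding monotone_on_def by (metis order_less_asym)
qed

lemma thompson_F_endpoints:
  assumes "f \<in> thompson_F_maps"
  shows "f 0 = 0" "f 1 = 1"
proof -
  have im: "f ` {0..1} = {0..1}"
    using assms unfolding thompson_F_maps_def homeomorphism_def by blast
  note sm = thompson_F_strict_mono[OF assms]
  have mono: "f x \<le> f y" if "0 \<le> x" "x \<le> y" "y \<le> 1" for x y
    using sm that by (cases "x = y") (auto simp: monotone_on_def intro: less_imp_le)
  have "0 \<in> f ` {0..1}" "1 \<in> f ` {0..1}" unfolding im by simp_all
  then obtain u v where uv: "u \<in> {0..1}" "f u = 0" "v \<in> {0..1}" "f v = 1"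
    by (metis imageE)
  have "f 0 \<in> f ` {0..1}" "f 1 \<in> f ` {0..1}" by (rule imageI, simp)+
  then have "f 0 \<in> {0..1}" "f 1 \<in> {0..1}" unfolding im .
  then show "f 0 = 0" "f 1 = 1"
    using mono[of 0 u] mono[of v 1] uv by simp_all
qed

lemma thompson_F_dyadic_iff:
  assumes f: "f \<in> thompson_F_maps" and x: "x \<in> {0..1}"
  shows "f x \<in> dyadic_rationals \<longleftrightarrow> x \<in> dyadic_rationals"
proof -
  obtain g B where g: "homeomorphism {0..1} {0..1} f g" and B: "finite B"
      "B \<subseteq> dyadic_rationals \<inter> {0<..<1}" and aff: "affine_pow2_off B f"
    using f unfolding thompson_F_maps_def by blast
  have cont: "continuous_on {0..1} f" using g homeomorphism_def by blast
  show ?thesis using x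
  proof (induction "card {b \<in> B. b < x}" arbitrary: x rule: less_induct)
    case less
    show ?case
    proof (cases "x = 0")
      case True
      then show ?thesis using thompson_F_endpoints[OF f] by simp
    next
      case False
      define p where "p = Max (insert 0 {b \<in> B. b < x})"
      have fin: "finite {b \<in> B. b < x}" using B by simp
      have p_in: "p \<in> insert 0 {b \<in> B. b < x}"
        unfolding p_def using fin by (intro Max_in) auto
      have p_max: "b \<le> p" if "b \<in> B" "b < x" for b
        unfolding p_def using fin that by (intro Max_ge) auto
      have p: "0 \<le> p" "p < x" "p \<in> dyadic_rationals"
        using p_in B False less.prems by auto
      have fp: "f p \<in> dyadic_rationals"
      proof (cases "p = 0")
        case True
        then show ?thesis using thompson_F_endpoints[OF f] by simp
      next
        case False
        then have "p \<in> {b \<in> B. b < x}" using p_in by blast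
        then have "{b \<in> B. b < p} \<subset> {b \<in> B. b < x}" by force
        then have "card {b \<in> B. b < p} < card {b \<in> B. b < x}"
          using fin by (rule psubset_card_mono[rotated])
        then show ?thesis using less.hyps[of p] p less.prems by auto
      qed
      have "{p<..<x} \<subseteq> {0..1} - B" using p p_max less.prems by force
      then obtain k c where k: "\<forall>y\<in>{p<..<x}. f y = 2 powi (k::int) * y + c"
        using aff unfolding affine_pow2_off_def by blast
      have "closure {p<..<x} \<subseteq> {0..1}" using p less.prems by auto
      then have cont': "continuous_on (closure {p<..<x}) (\<lambda>y. f y - (2 powi k * y + c))"
        by (intro continuous_intros continuous_on_subset[OF cont])
      have eq: "f y - (2 powi k * y + c) = 0" if "y \<in> {p..x}" for y
        using continuous_constant_on_closure[OF cont', of 0 y] k p that by auto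
      have "f x = f p + 2 powi k * (x - p)"
        using eq[of p] eq[of x] p by (simp add: algebra_simps)
      moreover from this have "x = p + 2 powi (-k) * (f x - f p)"
        by (simp add: power_int_minus flip: mult.assoc)
      ultimately show ?thesis
        using p fp dyadic_add dyadic_diff dyadic_mult dyadic_powi by metis
    qed
  qed
qed

lemma homeomorphism_unit_interval_iff:
  "(\<exists>g. homeomorphism {0..1} {0..1::real} f g) \<longleftrightarrow>
     continuous_on {0..1} f \<and> bij_betw f {0..1::real} {0..1}"
proof
  assume "\<exists>g. homeomorphism {0..1} {0..1} f g"
  then show "continuous_on {0..1} f \<and> bij_betw f {0..1} {0..1}"
    unfolding homeomorphism_def bij_betw_def by (metis inj_onI)
next
  assume "continuous_on {0..1} f \<and> bij_betw f {0..1} {0..1}"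
  then show "\<exists>g. homeomorphism {0..1} {0..1} f g"
    using homeomorphism_compact[of "{0..1}" f "{0..1}"] unfolding bij_betw_def by auto
qed

lemma thompson_F_maps_subset_Bij: "thompson_F_maps \<subseteq> Bij {0..1}"
  unfolding thompson_F_maps_def Bij_def using homeomorphism_unit_interval_iff by blast

lemma thompson_F_compose:
  assumes f: "f \<in> thompson_F_maps" and g: "g \<in> thompson_F_maps"
  shows "compose {0..1} f g \<in> thompson_F_maps"
proof -
  obtain B where B: "finite B" "B \<subseteq> dyadic_rationals \<inter> {0<..<1}" "affine_pow2_off B f"
    using f unfolding thompson_F_maps_def by blast
  obtain C where C: "finite C" "C \<subseteq> dyadic_rationals \<inter> {0<..<1}" "affine_pow2_off C g"
    using g unfolding thompson_F_maps_def by blast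
  have bf: "continuous_on {0..1} f" "bij_betw f {0..1} {0..1}"
    and bg: "continuous_on {0..1} g" "bij_betw g {0..1} {0..1}"
    using f g homeomorphism_unit_interval_iff unfolding thompson_F_maps_def by blast+
  have sg: "strict_mono_on {0..1} g" using g by (rule thompson_F_strict_mono)
  have gin: "g x \<in> {0..1}" if "x \<in> {0..1}" for x
    using bij_betw_apply[OF bg(2) that] .
  define E where "E = C \<union> {x \<in> {0..1}. g x \<in> B}"
  have "finite {x \<in> {0..1}. g x \<in> B}"
    using finite_vimage_IntI[OF B(1), of g "{0..1}"] bg(2)
    by (simp add: bij_betw_def vimage_def Int_def conj_commute)
  then have "finite E" using C unfolding E_def by simp
  moreover have "E \<subseteq> dyadic_rationals \<inter> {0<..<1}"
  proof -
    have "x \<in> dyadic_rationals \<inter> {0<..<1}" if "x \<in> {0..1}" "g x \<in> B" for x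
    proof -
      have "x \<in> dyadic_rationals" using thompson_F_dyadic_iff[OF g that(1)] B that by blast
      moreover have "x \<noteq> 0" "x \<noteq> 1" using thompson_F_endpoints[OF g] B that by auto
      ultimately show ?thesis using that by auto
    qed
    then show ?thesis using C unfolding E_def by blast
  qed
  moreover have "affine_pow2_off E (compose {0..1} f g)"
    unfolding affine_pow2_off_def
  proof (intro allI impI)
    fix a b assume ab: "{a<..<b} \<subseteq> {0..1} - E"
    show "\<exists>(k::int) c. \<forall>x\<in>{a<..<b}. compose {0..1} f g x = 2 powi k * x + c"
    proof (cases "a < b")
      case True
      have "{a<..<b} \<subseteq> {0..1}" using ab by blast
      then have ab01: "0 \<le> a" "b \<le> 1"
        using True greaterThanLessThan_subseteq_atLeastAtMost_iff[of a b 0 1] by auto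
      have gi: "g x \<in> {g a<..<g b}" if "x \<in> {a<..<b}" for x
        using sg ab01 that by (auto simp: monotone_on_def)
      have "{g a<..<g b} \<subseteq> {0..1} - B"
      proof
        fix y assume y: "y \<in> {g a<..<g b}"
        then have y01: "y \<in> {0..1}" using gin[of a] gin[of b] ab01 True by auto
        then obtain x where x: "x \<in> {0..1}" "y = g x"
          using bg(2) unfolding bij_betw_def by blast
        have "x \<in> {a<..<b}"
          using y x sg ab01 True strict_mono_on_less[OF sg] by auto
        then show "y \<in> {0..1} - B" using ab x y01 unfolding E_def by blast
      qed
      then obtain k c where k: "\<forall>y\<in>{g a<..<g b}. f y = 2 powi (k::int) * y + c"
        using B unfolding affine_pow2_off_def by blast
      have "{a<..<b} \<subseteq> {0..1} - C" using ab unfolding E_def by blast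
      then obtain l d where l: "\<forall>x\<in>{a<..<b}. g x = 2 powi (l::int) * x + d"
        using C unfolding affine_pow2_off_def by blast
      have "compose {0..1} f g x = 2 powi (k + l) * x + (2 powi k * d + c)"
        if "x \<in> {a<..<b}" for x
      proof -
        have "x \<in> {0..1}" using that ab by blast
        then have "compose {0..1} f g x = f (g x)" by (simp add: compose_def)
        also have "\<dots> = 2 powi k * g x + c" using k gi[OF that] by blast
        also have "g x = 2 powi l * x + d" using l that by blast
        finally show ?thesis by (simp add: power_int_add algebra_simps)
      qed
      then show ?thesis by blast
    qed simp
  qed
  moreover have "\<exists>h. homeomorphism {0..1} {0..1} (compose {0..1} f g) h"
  proof -
    have "continuous_on {0..1} (f \<circ> g)"
      using bf bg by (intro continuous_on_compose) (auto simp: bij_betw_def)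
    then have "continuous_on {0..1} (compose {0..1} f g)"
      by (rule continuous_on_eq) (simp add: compose_def)
    then show ?thesis
      using bf bg homeomorphism_unit_interval_iff bij_betw_compose by blast
  qed
  ultimately show ?thesis unfolding thompson_F_maps_def by auto
qed

lemma thompson_F_inv:
  assumes f: "f \<in> thompson_F_maps"
  shows "(\<lambda>x\<in>{0..1}. inv_into {0..1} f x) \<in> thompson_F_maps" (is "?h \<in> _")
proof -
  obtain B where B: "finite B" "B \<subseteq> dyadic_rationals \<inter> {0<..<1}" "affine_pow2_off B f"
    using f unfolding thompson_F_maps_def by blast
  obtain g where hom: "homeomorphism {0..1} {0..1} f g"
    using f unfolding thompson_F_maps_def by blast
  have bf: "bij_betw f {0..1} {0..1}"
    using f thompson_F_maps_subset_Bij unfolding Bij_def by blast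
  have sf: "strict_mono_on {0..1} f" using f by (rule thompson_F_strict_mono)
  have gin: "g x \<in> {0..1}" "f (g x) = x" if "x \<in> {0..1}" for x
    using hom that unfolding homeomorphism_def by blast+
  have fin: "f x \<in> {0..1}" "g (f x) = x" if "x \<in> {0..1}" for x
    using hom that unfolding homeomorphism_def by blast+
  have hg: "?h x = g x" if "x \<in> {0..1}" for x
    using that gin[OF that] bf by (simp add: bij_betw_def inv_into_f_eq)
  have "homeomorphism {0..1} {0..1} ?h f"
    by (rule homeomorphism_cong[OF homeomorphism_symD[OF hom]]) (use hg in auto)
  moreover have "finite (f ` B)" using B by simp
  moreover have "f ` B \<subseteq> dyadic_rationals \<inter> {0<..<1}"
  proof
    fix y assume "y \<in> f ` B"
    then obtain x where x: "x \<in> B" "y = f x" by blast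
    then have x': "0 < x" "x < 1" "x \<in> {0..1}" "x \<in> dyadic_rationals" using B by auto
    then have "f 0 < f x" "f x < f 1" using sf by (auto simp: monotone_on_def)
    then show "y \<in> dyadic_rationals \<inter> {0<..<1}"
      using thompson_F_endpoints[OF f] thompson_F_dyadic_iff[OF f x'(3)] x x' by auto
  qed
  moreover have "affine_pow2_off (f ` B) ?h"
    unfolding affine_pow2_off_def
  proof (intro allI impI)
    fix a b assume ab: "{a<..<b} \<subseteq> {0..1} - f ` B"
    show "\<exists>(k::int) c. \<forall>x\<in>{a<..<b}. ?h x = 2 powi k * x + c"
    proof (cases "a < b")
      case True
      have "{a<..<b} \<subseteq> {0..1}" using ab by blast
      then have ab01: "a \<in> {0..1}" "b \<in> {0..1}"
        using True greaterThanLessThan_subseteq_atLeastAtMost_iff[of a b 0 1] by auto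
      note less = strict_mono_on_less[OF sf]
      have "{g a<..<g b} \<subseteq> {0..1} - B"
      proof
        fix x assume x: "x \<in> {g a<..<g b}"
        then have x01: "x \<in> {0..1}" using gin(1)[of a] gin(1)[of b] ab01 by auto
        have "f x \<in> {a<..<b}"
          using x x01 less[of "g a" x] less[of x "g b"] gin ab01 by auto
        then show "x \<in> {0..1} - B" using ab x01 by blast
      qed
      then obtain k c where k: "\<forall>x\<in>{g a<..<g b}. f x = 2 powi (k::int) * x + c"
        using B unfolding affine_pow2_off_def by blast
      have "?h y = 2 powi (-k) * y + (- (2 powi (-k) * c))" if y: "y \<in> {a<..<b}" for y
      proof -
        have y01: "y \<in> {0..1}" using y ab by blast
        have "g y \<in> {g a<..<g b}"
          using y y01 less[of "g a" "g y"] less[of "g y" "g b"] gin ab01 by auto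
        then have "y = 2 powi k * g y + c" using k gin(2)[OF y01] by metis
        then have "g y = 2 powi (-k) * (y - c)"
          by (simp add: power_int_minus field_simps)
        then show ?thesis using hg[OF y01] by (simp add: algebra_simps)
      qed
      then show ?thesis by blast
    qed simp
  qed
  ultimately show ?thesis unfolding thompson_F_maps_def by blast
qed

lemma thompson_F_one: "(\<lambda>x\<in>{0..1}. x) \<in> thompson_F_maps"
proof -
  have "homeomorphism {0..1} {0..1} (\<lambda>x\<in>{0..1::real}. x) (\<lambda>x. x)"
    by (rule homeomorphism_cong[OF homeomorphism_ident]) auto
  moreover have "affine_pow2_off {} (\<lambda>x\<in>{0..1}. x)"
    unfolding affine_pow2_off_def
    by (intro allI impI exI[of _ "0::int"] exI[of _ "0::real"]) auto
  ultimately show ?thesis unfolding thompson_F_maps_def by blast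
qed

lemma subgroup_thompson_F_maps: "subgroup thompson_F_maps (BijGroup {0..1})"
proof (rule group.subgroupI[OF group_BijGroup])
  show "thompson_F_maps \<subseteq> carrier (BijGroup {0..1})"
    using thompson_F_maps_subset_Bij by (simp add: BijGroup_def)
  show "thompson_F_maps \<noteq> {}" using thompson_F_one by blast
next
  fix f assume "f \<in> thompson_F_maps"
  then show "inv\<^bsub>BijGroup {0..1}\<^esub> f \<in> thompson_F_maps"
    using thompson_F_inv inv_BijGroup thompson_F_maps_subset_Bij by (metis subsetD)
next
  fix f g assume "f \<in> thompson_F_maps" "g \<in> thompson_F_maps"
  then show "f \<otimes>\<^bsub>BijGroup {0..1}\<^esub> g \<in> thompson_F_maps"
    using thompson_F_compose thompson_F_maps_subset_Bij by (simp add: BijGroup_def subset_iff)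
qed

theorem group_thompson_F: "group thompson_F"
  unfolding thompson_F_def
  using group.subgroup_imp_group[OF group_BijGroup subgroup_thompson_F_maps] .

end

theory Submission
  imports Defs
begin

text \<open>
  Let \<open>F\<close> be Thompson's group, let \<open>F\<^sub>c\<close> be the subgroup of the elements that are the identity near
  0 and near 1, and let \<open>\<chi>\<close> send an element of \<open>F\<close> to the pair of the binary logarithms of its
  slopes at 0 and at 1. Then \<open>\<chi>\<close> is a homomorphism to \<open>\<int>\<^sup>2\<close> with kernel \<open>F\<^sub>c\<close>.

  Every non-trivial subgroup of \<open>F\<close> normalized by \<open>F\<^sub>c\<close> contains \<open>F\<^sub>c\<close> (\<open>PLc_simple\<close>). Higman's commutator
  argument shows that it contains all commutators of \<open>F\<^sub>c\<close>, and \<open>F\<^sub>c\<close> is perfect (\<open>PLc_subset_K\<close>).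
  So a non-trivial normal subgroup \<open>N\<close> is the preimage of \<open>L = \<chi>(N)\<close>. If \<open>N\<close> is finitely generated,
  then \<open>L\<close> lies on neither coordinate axis: otherwise the finitely many generators, and with them all
  of \<open>N\<close>, would be the identity on a common neighbourhood of 0 or of 1 (\<open>rgerm_nontrivial\<close>,
  \<open>lgerm_nontrivial\<close>). Hence \<open>L\<close> is spanned by two vectors \<open>(a, b)\<close> and \<open>(0, d)\<close> with \<open>a > 0\<close> and
  \<open>d \<ge> 0\<close>. One can take \<open>b > 0\<close> unless \<open>d = 0\<close> and \<open>b < 0\<close>, because multiples of \<open>d\<close> may be added to
  \<open>b\<close> and \<open>b = d = 0\<close> would put \<open>L\<close> on an axis. It remains to find \<open>f\<close> and \<open>g\<close> with these values of
  \<open>\<chi>\<close> such that \<open>\<langle>f, g\<rangle>\<close> contains \<open>F\<^sub>c\<close>.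

  The element \<open>f\<close> moves every point of an interval \<open>(0, p)\<close> to the right, so that its powers act there
  like a translation. Take finitely many elements \<open>e\<^sub>i\<close> with compact support in \<open>(0, p)\<close>, conjugate
  them by powers of \<open>f\<close> to positions near 0 whose differences are pairwise distinct and far apart, and
  let \<open>s\<close> be the product. In a suitable commutator word in \<open>f\<close> and \<open>s\<close> only the factors \<open>i\<close> and \<open>j\<close>
  meet, and the value of the word is conjugate to the commutator of \<open>e\<^sub>j\<^sup>-\<^sup>1\<close> with its conjugate by
  \<open>e\<^sub>i\<close> (\<open>isolate\<close>). The same holds for \<open>g = r s\<close>, where \<open>r\<close> is supported to the right of a point
  \<open>u > 0\<close>, as soon as the words become trivial on \<open>r\<close>. This leaves room to prescribe \<open>\<chi>(g) = (0, d)\<close>.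
  Commutators of the kind obtained generate the compactly supported elements, so every finite set of
  them can be captured by a pair \<open>f, r s\<close> (\<open>capture_finite_set\<close>).

  The right finite set comes from the hypothesis itself. Shrinking \<open>[0, 1]\<close> to a small interval
  carries finite generators of \<open>N\<close> to finitely many elements that generate everything with compact
  support in that interval. If the interval overlaps its image under \<open>f\<close>, its translates by powers of
  \<open>f\<close> exhaust \<open>(0, p)\<close> (\<open>generate_interval\<close>). For \<open>b < 0\<close> one takes \<open>p = 1\<close> and \<open>r = 1\<close>. For \<open>b > 0\<close>
  the map \<open>f\<close> contracts \<open>(0, 1)\<close> to a fixed point \<open>p\<close>, and \<open>r\<close> pushes \<open>p\<close> to the right: this makes the
  words trivial on \<open>r\<close>, and \<open>r\<^sup>-\<^sup>1\<close> composed with a large power of \<open>f\<close> moves any compact subset of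
  \<open>(0, 1)\<close> into \<open>(0, p)\<close> (\<open>generating_pair_same\<close>).

  Elements of \<open>F\<close> are extended by the identity to homeomorphisms of the real line. There they can be
  conjugated by affine maps, and the group operations are total, which makes the homeomorphisms
  a type with its own multiplication.
\<close>

section \<open>Groups as a type class\<close>

class mult_group = monoid_mult + inverse +
  assumes inverse_mult_self [simp]: "inverse x * x = 1"
    and divide_eq_mult_inverse: "x / y = x * inverse y"
begin

lemma mult_left_imp_eq:
  assumes "a * b = a * c" shows "b = c"
  using assms by (metis inverse_mult_self mult_1_left mult_assoc)

lemma mult_inverse_self [simp]: "x * inverse x = 1"
  by (rule mult_left_imp_eq[of "inverse x"]) (simp flip: mult_assoc)

lemma inverse_mult_cancel [simp]: "inverse x * (x * y) = y"
  by (simp flip: mult_assoc)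

lemma mult_inverse_cancel [simp]: "x * (inverse x * y) = y"
  by (simp flip: mult_assoc)

lemma mult_right_imp_eq:
  assumes "b * a = c * a" shows "b = c"
  using assms by (metis mult_inverse_self mult_1_right mult_assoc)

lemma inverse_unique: "x * y = 1 \<Longrightarrow> inverse x = y"
  by (metis mult_1_right inverse_mult_cancel)

lemma inverse_inverse [simp]: "inverse (inverse x) = x"
  by (rule inverse_unique) simp

lemma inverse_mult [simp]: "inverse (x * y) = inverse y * inverse x"
  by (rule inverse_unique) (simp add: mult_assoc)

lemma inverse_one [simp]: "inverse 1 = 1"
  by (rule inverse_unique) simp

definition conj_by :: "'a \<Rightarrow> 'a \<Rightarrow> 'a" where
  "conj_by x y = x * y * inverse x"

definition commutator :: "'a \<Rightarrow> 'a \<Rightarrow> 'a" where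
  "commutator x y = x * y * inverse x * inverse y"

definition commute :: "'a \<Rightarrow> 'a \<Rightarrow> bool" where
  "commute x y \<longleftrightarrow> x * y = y * x"

lemma conj_by_one [simp]: "conj_by x 1 = 1" "conj_by 1 x = x"
  by (simp_all add: conj_by_def)

lemma conj_by_mult: "conj_by x (y * z) = conj_by x y * conj_by x z"
  by (simp add: conj_by_def mult_assoc)

lemma conj_by_inverse: "conj_by x (inverse y) = inverse (conj_by x y)"
  by (simp add: conj_by_def mult_assoc)

lemma conj_by_conj_by: "conj_by x (conj_by y z) = conj_by (x * y) z"
  by (simp add: conj_by_def mult_assoc)

lemma conj_by_cancel [simp]:
  "conj_by (inverse x) (conj_by x y) = y" "conj_by x (conj_by (inverse x) y) = y"
  by (simp_all add: conj_by_conj_by)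

lemma conj_by_commutator: "conj_by x (commutator y z) = commutator (conj_by x y) (conj_by x z)"
  by (simp add: conj_by_def commutator_def mult_assoc)

lemma conj_by_eq_iff [simp]: "conj_by x y = conj_by x z \<longleftrightarrow> y = z"
  by (metis conj_by_cancel(1))

lemma inverse_commutator: "inverse (commutator x y) = commutator y x"
  by (simp add: commutator_def mult_assoc)

lemma commute_sym: "commute x y \<Longrightarrow> commute y x"
  by (simp add: commute_def)

lemma commute_one [simp]: "commute x 1" "commute 1 x"
  by (simp_all add: commute_def)

lemma commute_mult_right: "commute x y \<Longrightarrow> commute x z \<Longrightarrow> commute x (y * z)"
  unfolding commute_def by (metis mult_assoc)

lemma commute_mult_left: "commute x z \<Longrightarrow> commute y z \<Longrightarrow> commute (x * y) z"
  unfolding commute_def by (metis mult_assoc)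

lemma commute_inverse_right: "commute x y \<Longrightarrow> commute x (inverse y)"
  unfolding commute_def by (metis mult_assoc inverse_mult_cancel mult_inverse_self mult_1_right)

lemma commute_inverse_left: "commute x y \<Longrightarrow> commute (inverse x) y"
  using commute_inverse_right commute_sym by blast

lemma commute_conj_by: "commute x y \<Longrightarrow> conj_by x y = y"
  by (simp add: commute_def conj_by_def mult_assoc)

lemma commute_conj_by_iff [simp]: "commute (conj_by z x) (conj_by z y) \<longleftrightarrow> commute x y"
  unfolding commute_def by (metis conj_by_eq_iff conj_by_mult)

lemma commutator_eq_one_iff: "commutator x y = 1 \<longleftrightarrow> commute x y"
  unfolding commutator_def commute_def
  by (metis mult_assoc inverse_mult_self mult_1_right mult_inverse_self mult_right_imp_eq inverse_mult)

end

lemma mult_group_power_int_add_one: "x powi (n + 1) = (x :: 'a :: mult_group) * x powi n"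
proof (cases "n \<ge> 0")
  case True
  then show ?thesis by (simp add: power_int_def nat_add_distrib)
next
  case False
  then have "n = - 1 - int (nat (- 1 - n))" by simp
  then obtain m where "n = - 1 - int m" by blast
  then show ?thesis by (simp add: power_int_def nat_add_distrib)
qed

lemma mult_group_power_int_add: "x powi (i + j) = (x :: 'a :: mult_group) powi i * x powi j"
proof (induction i rule: int_induct[where k = 0])
  case (step1 i)
  have "x powi (i + 1 + j) = x * x powi (i + j)"
    using mult_group_power_int_add_one[of x "i + j"] by (simp add: ac_simps)
  then show ?case
    by (simp only: step1 mult_group_power_int_add_one mult.assoc)
next
  case (step2 i)
  have "x * x powi (i - 1 + j) = x powi i * x powi j"
    using mult_group_power_int_add_one[of x "i - 1 + j"] step2 by (simp add: add.commute)
  also have "\<dots> = x * (x powi (i - 1) * x powi j)"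
    using mult_group_power_int_add_one[of x "i - 1"] by (simp add: mult.assoc)
  finally show ?case by (rule mult_left_imp_eq)
qed (simp add: power_int_def)

lemma mult_group_power_int_minus: "x powi (- i) = inverse ((x :: 'a :: mult_group) powi i)"
proof -
  have "x powi i * x powi (- i) = 1"
    unfolding mult_group_power_int_add[symmetric] by (simp add: power_int_def)
  then show ?thesis by (rule inverse_unique[symmetric])
qed

lemma mult_group_inverse_power: "inverse x ^ n = inverse ((x :: 'a :: mult_group) ^ n)"
proof (induction n)
  case (Suc n)
  have "inverse x ^ Suc n = inverse x ^ n * inverse x" by (rule power_Suc2)
  also have "\<dots> = inverse (x * x ^ n)" by (simp add: Suc)
  finally show ?case by (simp only: power_Suc[of x])
qed simp

lemma commute_self [simp]: "commute x (x :: 'a :: mult_group)"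
  by (simp add: commute_def)

definition is_subgroup :: "'a :: mult_group set \<Rightarrow> bool" where
  "is_subgroup H \<longleftrightarrow> 1 \<in> H \<and> (\<forall>x\<in>H. \<forall>y\<in>H. x * y \<in> H) \<and> (\<forall>x\<in>H. inverse x \<in> H)"

inductive_set gen :: "'a :: mult_group set \<Rightarrow> 'a set" for S where
  gen_one: "1 \<in> gen S"
| gen_base: "x \<in> S \<Longrightarrow> x \<in> gen S"
| gen_mult: "x \<in> gen S \<Longrightarrow> y \<in> gen S \<Longrightarrow> x * y \<in> gen S"
| gen_inverse: "x \<in> gen S \<Longrightarrow> inverse x \<in> gen S"

lemma is_subgroup_gen: "is_subgroup (gen S)"
  unfolding is_subgroup_def by (auto intro: gen.intros)

lemma gen_least: "S \<subseteq> H \<Longrightarrow> is_subgroup H \<Longrightarrow> gen S \<subseteq> H"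
proof
  fix x assume "S \<subseteq> H" "is_subgroup H" "x \<in> gen S"
  from this(3,1,2) show "x \<in> H"
    by induction (auto simp: is_subgroup_def)
qed

lemma subgroup_one: "is_subgroup H \<Longrightarrow> 1 \<in> H"
  and subgroup_mult: "is_subgroup H \<Longrightarrow> x \<in> H \<Longrightarrow> y \<in> H \<Longrightarrow> x * y \<in> H"
  and subgroup_inverse: "is_subgroup H \<Longrightarrow> x \<in> H \<Longrightarrow> inverse x \<in> H"
  by (auto simp: is_subgroup_def)

lemma subgroup_conj_by: "is_subgroup H \<Longrightarrow> x \<in> H \<Longrightarrow> y \<in> H \<Longrightarrow> conj_by x y \<in> H"
  by (simp add: is_subgroup_def conj_by_def)

lemma subgroup_commutator: "is_subgroup H \<Longrightarrow> x \<in> H \<Longrightarrow> y \<in> H \<Longrightarrow> commutator x y \<in> H"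
  by (simp add: is_subgroup_def commutator_def)

lemma subgroup_power: "is_subgroup H \<Longrightarrow> x \<in> H \<Longrightarrow> x ^ n \<in> H"
  by (induction n) (auto simp: is_subgroup_def)

lemma subgroup_power_int: "is_subgroup H \<Longrightarrow> x \<in> H \<Longrightarrow> x powi n \<in> H"
  unfolding power_int_def by (simp add: subgroup_power subgroup_inverse)

lemma subgroup_inverse_iff: "is_subgroup H \<Longrightarrow> inverse x \<in> H \<longleftrightarrow> x \<in> H"
  by (metis inverse_inverse subgroup_inverse)

lemma gen_conj_by: "gen (conj_by z ` S) = conj_by z ` gen S"
proof
  have "is_subgroup (conj_by z ` gen S)"
    unfolding is_subgroup_def
  proof (intro conjI ballI)
    show "1 \<in> conj_by z ` gen S" by (rule image_eqI[of _ _ 1]) (simp_all add: gen_one)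
    fix x assume "x \<in> conj_by z ` gen S"
    then obtain x' where x: "x' \<in> gen S" "x = conj_by z x'" by blast
    show "inverse x \<in> conj_by z ` gen S"
      by (rule image_eqI[of _ _ "inverse x'"]) (simp_all add: x conj_by_inverse gen_inverse)
    fix y assume "y \<in> conj_by z ` gen S"
    then obtain y' where y: "y' \<in> gen S" "y = conj_by z y'" by blast
    show "x * y \<in> conj_by z ` gen S"
      by (rule image_eqI[of _ _ "x' * y'"]) (simp_all add: x y conj_by_mult gen_mult)
  qed
  then show "gen (conj_by z ` S) \<subseteq> conj_by z ` gen S"
    by (intro gen_least) (auto intro: gen_base)
  show "conj_by z ` gen S \<subseteq> gen (conj_by z ` S)"
  proof
    fix y assume "y \<in> conj_by z ` gen S"
    then obtain x where "x \<in> gen S" "y = conj_by z x" by blast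
    then show "y \<in> gen (conj_by z ` S)"
      by (induction arbitrary: y) (auto simp: conj_by_mult conj_by_inverse intro: gen.intros)
  qed
qed

lemma gen_normalized:
  assumes "\<And>x. x \<in> S \<Longrightarrow> conj_by z x \<in> S" "y \<in> gen S"
  shows "conj_by z y \<in> gen S"
  using assms(2)
  by induction (auto simp: conj_by_mult conj_by_inverse intro: gen.intros assms(1))

text \<open>
  A word uses only finitely many of the generators. This is what turns the perfectness of a group that
  is not finitely generated into a statement about finite sets.
\<close>

lemma gen_finite_support:
  assumes "x \<in> gen S"
  shows "\<exists>Y. finite Y \<and> Y \<subseteq> S \<and> x \<in> gen Y"
proof -
  have mono: "y \<in> gen Y \<Longrightarrow> Y \<subseteq> Z \<Longrightarrow> y \<in> gen Z" for y and Y Z :: "'a set"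
    using gen_least[of Y "gen Z"] is_subgroup_gen[of Z] gen_base by blast
  show ?thesis using assms
  proof induction
    case gen_one
    then show ?case by (intro exI[of _ "{}"]) (auto intro: gen.intros)
  next
    case (gen_base x)
    then show ?case by (intro exI[of _ "{x}"]) (auto intro: gen.intros)
  next
    case (gen_mult x y)
    then obtain Y Z where "finite Y" "Y \<subseteq> S" "x \<in> gen Y" "finite Z" "Z \<subseteq> S" "y \<in> gen Z" by blast
    then show ?case
      by (intro exI[of _ "Y \<union> Z"]) (auto intro!: gen.gen_mult intro: mono)
  next
    case (gen_inverse x)
    then show ?case by (auto intro: gen.intros)
  qed
qed

section \<open>Dyadic piecewise linear homeomorphisms of the line\<close>

text \<open>
  The preservation of dyadic points is part of the definition because the affine pieces are allowed
  to have arbitrary constant terms. The set \<open>B\<close> only has to contain all breakpoints.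
\<close>

definition is_pl2 :: "(real \<Rightarrow> real) \<Rightarrow> bool" where
  "is_pl2 h \<longleftrightarrow> strict_mono h \<and> surj h \<and> (\<forall>x. h x \<in> dyadic_rationals \<longleftrightarrow> x \<in> dyadic_rationals) \<and>
     (\<exists>B. finite B \<and> B \<subseteq> dyadic_rationals \<and>
        (\<forall>a b. {a<..<b} \<inter> B = {} \<longrightarrow> (\<exists>(k::int) c. \<forall>x\<in>{a<..<b}. h x = 2 powi k * x + c)))"

lemma is_pl2I:
  assumes "strict_mono h" "surj h" "\<And>x. h x \<in> dyadic_rationals \<longleftrightarrow> x \<in> dyadic_rationals"
    "finite B" "B \<subseteq> dyadic_rationals"
    "\<And>a b. a < b \<Longrightarrow> {a<..<b} \<inter> B = {} \<Longrightarrow> \<exists>(k::int) c. \<forall>x\<in>{a<..<b}. h x = 2 powi k * x + c"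
  shows "is_pl2 h"
proof -
  have "\<exists>(k::int) c. \<forall>x\<in>{a<..<b}. h x = 2 powi k * x + c" if "{a<..<b} \<inter> B = {}" for a b
    using assms(6)[OF _ that] by (cases "a < b") auto
  then show ?thesis unfolding is_pl2_def using assms by blast
qed

lemma is_pl2_comp:
  assumes "is_pl2 g" "is_pl2 h"
  shows "is_pl2 (g \<circ> h)"
proof -
  obtain B where B: "finite B" "B \<subseteq> dyadic_rationals"
    "\<And>a b. {a<..<b} \<inter> B = {} \<Longrightarrow> \<exists>(k::int) c. \<forall>x\<in>{a<..<b}. g x = 2 powi k * x + c"
    using assms(1) unfolding is_pl2_def by blast
  obtain C where C: "finite C" "C \<subseteq> dyadic_rationals"
    "\<And>a b. {a<..<b} \<inter> C = {} \<Longrightarrow> \<exists>(k::int) c. \<forall>x\<in>{a<..<b}. h x = 2 powi k * x + c"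
    using assms(2) unfolding is_pl2_def by blast
  have sm: "strict_mono h" "surj h" "strict_mono g" "surj g" using assms unfolding is_pl2_def by auto
  have dy: "h x \<in> dyadic_rationals \<longleftrightarrow> x \<in> dyadic_rationals"
    "g x \<in> dyadic_rationals \<longleftrightarrow> x \<in> dyadic_rationals" for x using assms unfolding is_pl2_def by auto
  show ?thesis
  proof (rule is_pl2I[where B = "C \<union> h -` B"])
    show "strict_mono (g \<circ> h)" using sm by (auto simp: strict_mono_def)
    show "surj (g \<circ> h)" using sm(2,4) by (rule comp_surj)
    show "finite (C \<union> h -` B)"
      using B(1) C(1) sm(1) by (simp add: finite_vimageI strict_mono_imp_inj_on)
    show "C \<union> h -` B \<subseteq> dyadic_rationals" using B(2) C(2) dy by auto
    fix a b :: real assume ab: "{a<..<b} \<inter> (C \<union> h -` B) = {}"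
    have "{h a<..<h b} \<inter> B = {}"
    proof -
      have "x \<in> {a<..<b}" if "h x \<in> {h a<..<h b}" for x
        using that sm(1) by (auto simp: strict_mono_less)
      then show ?thesis using ab surj_f_inv_f[OF sm(2)] by (metis (no_types, lifting) disjoint_iff UnI2 vimageI2)
    qed
    then obtain k c where k: "\<forall>x\<in>{h a<..<h b}. g x = 2 powi (k::int) * x + c" using B(3) by blast
    obtain l d where l: "\<forall>x\<in>{a<..<b}. h x = 2 powi (l::int) * x + d" using C(3)[of a b] ab by blast
    have "(g \<circ> h) x = 2 powi (k + l) * x + (2 powi k * d + c)" if "x \<in> {a<..<b}" for x
    proof -
      have "h x \<in> {h a<..<h b}" using that sm(1) by (auto simp: strict_mono_less)
      then have "(g \<circ> h) x = 2 powi k * h x + c" using k by auto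
      also have "h x = 2 powi l * x + d" using l that by blast
      finally show ?thesis by (simp add: power_int_add algebra_simps)
    qed
    then show "\<exists>(k::int) c. \<forall>x\<in>{a<..<b}. (g \<circ> h) x = 2 powi k * x + c" by blast
  qed (auto simp: dy)
qed

lemma is_pl2_inv:
  assumes "is_pl2 h"
  shows "is_pl2 (inv_into UNIV h)"
proof -
  obtain C where C: "finite C" "C \<subseteq> dyadic_rationals"
    "\<And>a b. {a<..<b} \<inter> C = {} \<Longrightarrow> \<exists>(k::int) c. \<forall>x\<in>{a<..<b}. h x = 2 powi k * x + c"
    using assms unfolding is_pl2_def by blast
  have sm: "strict_mono h" "surj h" using assms unfolding is_pl2_def by auto
  have dy: "h x \<in> dyadic_rationals \<longleftrightarrow> x \<in> dyadic_rationals" for x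
    using assms unfolding is_pl2_def by auto
  have hi: "h (inv_into UNIV h x) = x" for x using sm(2) by (rule surj_f_inv_f)
  have ih: "inv_into UNIV h (h x) = x" for x using strict_mono_imp_inj_on[OF sm(1)] by (rule inv_f_f)
  have less: "inv_into UNIV h x < inv_into UNIV h y \<longleftrightarrow> x < y" for x y
    using strict_mono_less[OF sm(1), of "inv_into UNIV h x" "inv_into UNIV h y"] hi by simp
  show ?thesis
  proof (rule is_pl2I[where B = "h ` C"])
    show "strict_mono (inv_into UNIV h)" using less by (auto simp: strict_mono_def)
    show "surj (inv_into UNIV h)" using ih by (rule surjI)
    show "inv_into UNIV h x \<in> dyadic_rationals \<longleftrightarrow> x \<in> dyadic_rationals" for x
      using dy[of "inv_into UNIV h x"] hi by simp
    show "finite (h ` C)" "h ` C \<subseteq> dyadic_rationals" using C dy by auto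
    fix a b :: real assume ab: "{a<..<b} \<inter> h ` C = {}"
    have in_iff: "h x \<in> {a<..<b} \<longleftrightarrow> x \<in> {inv_into UNIV h a<..<inv_into UNIV h b}" for x
      using less[of a "h x"] less[of "h x" b] ih by simp
    then have "{inv_into UNIV h a<..<inv_into UNIV h b} \<inter> C = {}" using ab by blast
    then obtain k c where k: "\<forall>x\<in>{inv_into UNIV h a<..<inv_into UNIV h b}. h x = 2 powi (k::int) * x + c" using C(3) by blast
    have "inv_into UNIV h y = 2 powi (-k) * y + (- (2 powi (-k) * c))" if "y \<in> {a<..<b}" for y
    proof -
      have "y = 2 powi k * inv_into UNIV h y + c" using k in_iff[of "inv_into UNIV h y"] hi[of y] that by metis
      then have "inv_into UNIV h y = 2 powi (-k) * (y - c)" by (simp add: power_int_minus field_simps)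
      then show ?thesis by (simp add: algebra_simps)
    qed
    then show "\<exists>(k::int) c. \<forall>x\<in>{a<..<b}. inv_into UNIV h x = 2 powi k * x + c" by blast
  qed
qed

lemma dyadic_minus: "x \<in> dyadic_rationals \<Longrightarrow> - x \<in> dyadic_rationals"
  using dyadic_diff[of 0 x] by simp

lemma dyadic_scale_iff: "2 powi k * x \<in> dyadic_rationals \<longleftrightarrow> x \<in> dyadic_rationals"
proof
  assume "2 powi k * x \<in> dyadic_rationals"
  from dyadic_mult[OF dyadic_powi[of "-k"] this] show "x \<in> dyadic_rationals"
    by (simp add: power_int_minus flip: mult.assoc)
qed (intro dyadic_mult dyadic_powi)

lemma is_pl2_affine:
  assumes "c \<in> dyadic_rationals"
  shows "is_pl2 (\<lambda>x. 2 powi k * x + c)"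
proof (rule is_pl2I[where B = "{}"])
  show "strict_mono (\<lambda>x::real. 2 powi k * x + c)" by (auto simp: strict_mono_def)
  show "surj (\<lambda>x::real. 2 powi k * x + c)"
    by (rule surjI[of _ "\<lambda>x. (x - c) / 2 powi k"]) simp
  show "2 powi k * x + c \<in> dyadic_rationals \<longleftrightarrow> x \<in> dyadic_rationals" for x
    using dyadic_add[of "2 powi k * x" c] dyadic_diff[of "2 powi k * x + c" c] assms
      dyadic_scale_iff[of k x] by auto
qed auto

lemma is_pl2_glue:
  assumes g: "is_pl2 g" and h: "is_pl2 h" and p: "p \<in> dyadic_rationals" "g p = h p"
  shows "is_pl2 (\<lambda>x. if x \<le> p then g x else h x)" (is "is_pl2 ?f")
proof -
  obtain B where B: "finite B" "B \<subseteq> dyadic_rationals"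
    "\<And>a b. {a<..<b} \<inter> B = {} \<Longrightarrow> \<exists>(k::int) c. \<forall>x\<in>{a<..<b}. g x = 2 powi k * x + c"
    using g unfolding is_pl2_def by blast
  obtain C where C: "finite C" "C \<subseteq> dyadic_rationals"
    "\<And>a b. {a<..<b} \<inter> C = {} \<Longrightarrow> \<exists>(k::int) c. \<forall>x\<in>{a<..<b}. h x = 2 powi k * x + c"
    using h unfolding is_pl2_def by blast
  have sm: "strict_mono h" "surj h" "strict_mono g" "surj g"
    using g h unfolding is_pl2_def by auto
  have dy: "h x \<in> dyadic_rationals \<longleftrightarrow> x \<in> dyadic_rationals"
    "g x \<in> dyadic_rationals \<longleftrightarrow> x \<in> dyadic_rationals" for x
    using g h unfolding is_pl2_def by auto
  show ?thesis
  proof (rule is_pl2I[where B = "insert p (B \<union> C)"])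
    show "strict_mono ?f"
    proof (rule strict_monoI)
      fix x y :: real assume xy: "x < y"
      consider "y \<le> p" | "p < x" | "x \<le> p" "p < y" by linarith
      then show "?f x < ?f y"
      proof cases
        case 3
        then have "g x \<le> g p" "h p < h y" using sm(1,3) by (simp_all add: strict_mono_less strict_mono_less_eq)
        then show ?thesis using 3 p by simp
      qed (use xy sm(1,3) in \<open>simp_all add: strict_mono_less\<close>)
    qed
    show "surj ?f"
      unfolding surj_def
    proof
      fix y
      obtain u v where uv: "g u = y" "h v = y" using surjD[OF sm(4), of y] surjD[OF sm(2), of y] by auto
      show "\<exists>x. y = ?f x"
      proof (cases "y \<le> g p")
        case True
        then have "u \<le> p" using uv strict_mono_less_eq[OF sm(3), of u p] by simp
        then show ?thesis using uv by (intro exI[of _ u]) simp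
      next
        case False
        then have "\<not> v \<le> p" using uv p strict_mono_less_eq[OF sm(1), of v p] by simp
        then show ?thesis using uv by (intro exI[of _ v]) simp
      qed
    qed
    show "finite (insert p (B \<union> C))" "insert p (B \<union> C) \<subseteq> dyadic_rationals" using B C p by auto
    fix a b :: real assume "a < b" "{a<..<b} \<inter> insert p (B \<union> C) = {}"
    then have ab: "{a<..<b} \<inter> B = {}" "{a<..<b} \<inter> C = {}" "p \<notin> {a<..<b}" by auto
    then consider "b \<le> p" | "p \<le> a" by fastforce
    then show "\<exists>(k::int) c. \<forall>x\<in>{a<..<b}. ?f x = 2 powi k * x + c"
    proof cases
      case 1
      then show ?thesis using B(3)[OF ab(1)] by auto
    next
      case 2
      then show ?thesis using C(3)[OF ab(2)] by auto
    qed
  qed (auto simp: dy)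
qed

typedef pl2 = "{h. is_pl2 h}" morphisms app Abs_pl2
  using is_pl2_affine[of 0 0] by auto


lemma is_pl2_app: "is_pl2 (app h)"
  using app[of h] by simp

lemma app_Abs: "is_pl2 h \<Longrightarrow> app (Abs_pl2 h) = h"
  by (rule Abs_pl2_inverse) simp

lemma pl2_eqI: "(\<And>x. app g x = app h x) \<Longrightarrow> g = h"
  by (simp add: app_inject[symmetric] ext)

instantiation pl2 :: mult_group
begin
definition "1 = Abs_pl2 (\<lambda>x. 2 powi 0 * x + 0)"
definition "g * h = Abs_pl2 (app g \<circ> app h)" for g h :: pl2
definition "inverse h = Abs_pl2 (inv_into UNIV (app h))" for h :: pl2
definition divide_pl2 :: "pl2 \<Rightarrow> pl2 \<Rightarrow> pl2" where "divide_pl2 g h = g * inverse h"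
instance
proof
  fix x y z :: pl2
  have one: "app 1 = id"
    unfolding one_pl2_def by (subst app_Abs) (use is_pl2_affine[of 0 0] in auto)
  have times: "app (g * h) = app g \<circ> app h" for g h
    unfolding times_pl2_def by (simp add: app_Abs is_pl2_comp is_pl2_app)
  show "x * y * z = x * (y * z)" "1 * x = x" "x * 1 = x"
    by (auto intro!: pl2_eqI simp: times one)
  have "inj (app x)" using is_pl2_app[of x] by (auto simp: is_pl2_def strict_mono_imp_inj_on)
  then show "inverse x * x = 1"
    by (intro pl2_eqI) (simp add: times one inverse_pl2_def app_Abs is_pl2_inv is_pl2_app)
qed (simp add: divide_pl2_def)
end

lemma app_one [simp]: "app 1 x = x"
  unfolding one_pl2_def by (subst app_Abs) (use is_pl2_affine[of 0 0] in auto)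

lemma app_mult [simp]: "app (g * h) x = app g (app h x)"
  unfolding times_pl2_def by (simp add: app_Abs is_pl2_comp is_pl2_app)

lemma app_inverse_app [simp]: "app (inverse h) (app h x) = x" "app h (app (inverse h) x) = x"
  by (simp_all flip: app_mult)

lemma app_less_iff [simp]: "app h x < app h y \<longleftrightarrow> x < y"
  using is_pl2_app[of h] by (simp add: is_pl2_def strict_mono_less)

lemma app_le_iff [simp]: "app h x \<le> app h y \<longleftrightarrow> x \<le> y"
  using is_pl2_app[of h] by (simp add: is_pl2_def strict_mono_less_eq)

lemma app_eq_iff [simp]: "app h x = app h y \<longleftrightarrow> x = y"
  using is_pl2_app[of h] by (simp add: is_pl2_def strict_mono_eq)

lemma app_dyadic_iff [simp]: "app h x \<in> dyadic_rationals \<longleftrightarrow> x \<in> dyadic_rationals"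
  using is_pl2_app[of h] by (simp add: is_pl2_def)

lemma app_inverse_eq_iff: "app (inverse h) x = y \<longleftrightarrow> x = app h y"
  by auto

lemma app_inverse_less_iff: "app (inverse h) x < y \<longleftrightarrow> x < app h y"
  "y < app (inverse h) x \<longleftrightarrow> app h y < x"
  using app_less_iff[of h "app (inverse h) x" y] app_less_iff[of h y "app (inverse h) x"] by simp_all

lemma app_inverse_le_iff: "app (inverse h) x \<le> y \<longleftrightarrow> x \<le> app h y"
  "y \<le> app (inverse h) x \<longleftrightarrow> app h y \<le> x"
  using app_le_iff[of h "app (inverse h) x" y] app_le_iff[of h y "app (inverse h) x"] by simp_all

lemma app_continuous: "isCont (app h) x"
proof -
  have "continuous_on UNIV (app h)"
    by (rule continuous_onI_mono) (use is_pl2_app[of h] in \<open>auto simp: is_pl2_def\<close>)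
  then show ?thesis by (simp add: continuous_on_eq_continuous_at)
qed

definition affine_map :: "int \<Rightarrow> real \<Rightarrow> pl2" where
  "affine_map k c = Abs_pl2 (\<lambda>x. 2 powi k * x + c)"

lemma app_affine [simp]: "c \<in> dyadic_rationals \<Longrightarrow> app (affine_map k c) x = 2 powi k * x + c"
  by (simp add: affine_map_def app_Abs is_pl2_affine)

definition glue :: "real \<Rightarrow> pl2 \<Rightarrow> pl2 \<Rightarrow> pl2" where
  "glue p g h = Abs_pl2 (\<lambda>x. if x \<le> p then app g x else app h x)"

lemma app_glue:
  "p \<in> dyadic_rationals \<Longrightarrow> app g p = app h p \<Longrightarrow>
    app (glue p g h) x = (if x \<le> p then app g x else app h x)"
  by (simp add: glue_def app_Abs is_pl2_glue is_pl2_app)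

text \<open>
  The breakpoints are isolated, and continuity extends the affine formula to the end points of an
  interval without breakpoints.
\<close>

lemma germ:
  obtains e k l where "e > 0"
    "\<And>x. p - e \<le> x \<Longrightarrow> x \<le> p \<Longrightarrow> app h x = app h p + 2 powi (k::int) * (x - p)"
    "\<And>x. p \<le> x \<Longrightarrow> x \<le> p + e \<Longrightarrow> app h x = app h p + 2 powi (l::int) * (x - p)"
proof -
  obtain B where B: "finite B"
    "\<And>a b. {a<..<b} \<inter> B = {} \<Longrightarrow> \<exists>(k::int) c. \<forall>x\<in>{a<..<b}. app h x = 2 powi k * x + c"
    using is_pl2_app[of h] unfolding is_pl2_def by blast
  obtain e where e: "e > 0" "\<And>b. b \<in> B \<Longrightarrow> b \<noteq> p \<Longrightarrow> e \<le> dist p b"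
    using finite_set_avoid[OF B(1), of p] by blast
  have "{p-e<..<p} \<inter> B = {}" "{p<..<p+e} \<inter> B = {}" using e(2) by (force simp: dist_real_def)+
  from B(2)[OF this(1)] B(2)[OF this(2)] obtain k c l d where
    k: "\<forall>x\<in>{p-e<..<p}. app h x = 2 powi (k::int) * x + c" and
    l: "\<forall>x\<in>{p<..<p+e}. app h x = 2 powi (l::int) * x + d"
    by blast
  have cont: "continuous_on A (\<lambda>x. app h x - (2 powi j * x + s))" for A and j :: int and s :: real
    by (intro continuous_intros) (simp add: app_continuous continuous_at_imp_continuous_on)
  have k': "app h x = 2 powi k * x + c" if "p - e \<le> x" "x \<le> p" for x
    using continuous_constant_on_closure[OF cont[of "closure {p-e<..<p}"], of k c 0 x] k e that by auto
  have l': "app h x = 2 powi l * x + d" if "p \<le> x" "x \<le> p + e" for x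
    using continuous_constant_on_closure[OF cont[of "closure {p<..<p+e}"], of l d 0 x] l e that by auto
  show thesis
  proof (rule that[OF e(1), of k l])
    show "app h x = app h p + 2 powi k * (x - p)" if "p - e \<le> x" "x \<le> p" for x
      using k'[OF that] k'[of p] e by (simp add: algebra_simps)
    show "app h x = app h p + 2 powi l * (x - p)" if "p \<le> x" "x \<le> p + e" for x
      using l'[OF that] l'[of p] e by (simp add: algebra_simps)
  qed
qed

section \<open>Supports\<close>

text \<open>
  For dyadic \<open>a < b\<close> the set \<open>PL a b\<close> is the copy of Thompson's group that acts on \<open>[a, b]\<close>, and
  \<open>PLc a b\<close> consists of its elements with compact support in \<open>(a, b)\<close>.
\<close>

definition PL :: "real \<Rightarrow> real \<Rightarrow> pl2 set" where
  "PL a b = {h. \<forall>x. x \<le> a \<or> b \<le> x \<longrightarrow> app h x = x}"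

definition PLc :: "real \<Rightarrow> real \<Rightarrow> pl2 set" where
  "PLc a b = {h. \<exists>a' b'. a < a' \<and> b' < b \<and> h \<in> PL a' b'}"

lemma PL_D: "h \<in> PL a b \<Longrightarrow> x \<le> a \<Longrightarrow> app h x = x" "h \<in> PL a b \<Longrightarrow> b \<le> x \<Longrightarrow> app h x = x"
  by (auto simp: PL_def)

lemma PL_I: "(\<And>x. x \<le> a \<Longrightarrow> app h x = x) \<Longrightarrow> (\<And>x. b \<le> x \<Longrightarrow> app h x = x) \<Longrightarrow> h \<in> PL a b"
  by (auto simp: PL_def)

lemma PL_mono: "h \<in> PL a b \<Longrightarrow> a' \<le> a \<Longrightarrow> b \<le> b' \<Longrightarrow> h \<in> PL a' b'"
  by (auto simp: PL_def)

lemma is_subgroup_PL: "is_subgroup (PL a b)"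
  by (auto simp: is_subgroup_def PL_def app_inverse_eq_iff)

lemma PLc_I: "h \<in> PL a' b' \<Longrightarrow> a < a' \<Longrightarrow> b' < b \<Longrightarrow> h \<in> PLc a b"
  by (auto simp: PLc_def)

lemma PLc_subset_PL: "PLc a b \<subseteq> PL a b"
  by (auto simp: PLc_def intro: PL_mono)

lemma PLc_mono: "h \<in> PLc a b \<Longrightarrow> a' \<le> a \<Longrightarrow> b \<le> b' \<Longrightarrow> h \<in> PLc a' b'"
  unfolding PLc_def by force

lemma is_subgroup_PLc: "is_subgroup (PLc a b)"
  unfolding is_subgroup_def
proof (intro conjI ballI)
  have "1 \<in> PL (a + 1) (b - 1)" by (simp add: PL_def)
  then show "1 \<in> PLc a b" by (rule PLc_I) auto
next
  fix g h assume "g \<in> PLc a b" "h \<in> PLc a b"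
  then obtain c d c' d' where
    "a < c" "d < b" "g \<in> PL c d" "a < c'" "d' < b" "h \<in> PL c' d'"
    unfolding PLc_def by blast
  moreover from this have "g \<in> PL (min c c') (max d d')" "h \<in> PL (min c c') (max d d')"
    by (auto elim: PL_mono)
  ultimately show "g * h \<in> PLc a b"
    by (intro PLc_I[of _ "min c c'" "max d d'"] subgroup_mult[OF is_subgroup_PL]) auto
next
  fix g assume "g \<in> PLc a b"
  then show "inverse g \<in> PLc a b"
    unfolding PLc_def using subgroup_inverse[OF is_subgroup_PL] by blast
qed

lemma PL_conj_by: "h \<in> PL a b \<Longrightarrow> conj_by k h \<in> PL (app k a) (app k b)"
  by (auto simp: PL_def conj_by_def app_inverse_le_iff
      simp flip: app_inverse_eq_iff)

lemma PLc_conj_by: "h \<in> PLc a b \<Longrightarrow> conj_by k h \<in> PLc (app k a) (app k b)"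
  unfolding PLc_def by (auto dest: PL_conj_by[of _ _ _ k]) (metis PL_conj_by app_less_iff)

lemma PL_app_bounds:
  assumes "h \<in> PL a b" "a \<le> x" "x \<le> b"
  shows "a \<le> app h x" "app h x \<le> b"
  using assms PL_D[OF assms(1), of a] PL_D[OF assms(1), of b] app_le_iff[of h a x] app_le_iff[of h x b]
  by simp_all

lemma commute_disjoint:
  assumes "g \<in> PL a b" "h \<in> PL c d" "b \<le> c"
  shows "commute g h"
  unfolding commute_def
proof (rule pl2_eqI)
  fix x
  show "app (g * h) x = app (h * g) x"
  proof (cases "x \<le> b")
    case True
    have "app g x \<le> b"
      using True app_le_iff[of g x b] PL_D[OF assms(1), of b] by simp
    then show ?thesis using True PL_D[OF assms(2)] assms(3) by simp
  next
    case False
    have "b \<le> app h x"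
      using False app_le_iff[of h b x] PL_D[OF assms(2), of b] assms(3) by simp
    then show ?thesis using False PL_D[OF assms(1)] by simp
  qed
qed

text \<open>
  A conjugate only depends on what the conjugating map does on the support. This allows affine maps,
  which have no compact support, to be replaced by elements of \<open>PLc\<close>.
\<close>

lemma conj_by_agree:
  assumes "h \<in> PL a b" "\<And>x. a \<le> x \<Longrightarrow> x \<le> b \<Longrightarrow> app k x = app k' x"
  shows "conj_by k h = conj_by k' h"
proof -
  have "conj_by (inverse k * k') h = h"
  proof (cases "a \<le> b")
    case True
    have "commute (inverse k * k') h"
      unfolding commute_def
    proof (rule pl2_eqI)
      fix x
      have fix_k: "app (inverse k) (app k' y) = y" if "a \<le> y" "y \<le> b" for y
        using assms(2)[OF that] by (simp add: app_inverse_eq_iff)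
      have out: "app h (app (inverse k) (app k' y)) = app (inverse k) (app k' y)"
        if "y \<le> a \<or> b \<le> y" for y
      proof -
        have "app (inverse k) (app k' y) \<le> a \<or> b \<le> app (inverse k) (app k' y)"
          using that fix_k[of a] fix_k[of b] True
            app_le_iff[of "inverse k * k'" y a] app_le_iff[of "inverse k * k'" b y] by auto
        then show ?thesis using PL_D[OF assms(1)] by blast
      qed
      show "app (inverse k * k' * h) x = app (h * (inverse k * k')) x"
        using PL_app_bounds[OF assms(1), of x] fix_k[of x] fix_k[of "app h x"] out[of x]
          PL_D[OF assms(1), of x]
        by (cases "a \<le> x \<and> x \<le> b") auto
    qed
    then show ?thesis by (rule commute_conj_by)
  next
    case False
    then have "app h x = x" for x using PL_D[OF assms(1), of x] by force
    then have "h = 1" by (intro pl2_eqI) simp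
    then show ?thesis by simp
  qed
  then show ?thesis by (metis conj_by_conj_by conj_by_cancel(2))
qed

section \<open>Transitivity on dyadic intervals\<close>

lemma dyadic_dense:
  fixes x y :: real
  assumes "x < y"
  obtains d where "d \<in> dyadic_rationals" "x < d" "d < y"
proof -
  obtain n where n: "(1/2) ^ n < y - x"
    using real_arch_pow_inv[of "y - x" "1/2"] assms by auto
  define m where "m = \<lfloor>x * 2 ^ n\<rfloor> + 1"
  have m: "x * 2 ^ n < of_int m" "of_int m \<le> x * 2 ^ n + 1" unfolding m_def by linarith+
  show thesis
  proof (rule that[of "of_int m / 2 ^ n"])
    show "of_int m / 2 ^ n \<in> dyadic_rationals" unfolding dyadic_rationals_def by blast
    show "x < of_int m / 2 ^ n" using m by (simp add: field_simps)
    have "1 < (y - x) * 2 ^ n" using n by (simp add: field_simps)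
    then show "of_int m / 2 ^ n < y" using m by (simp add: field_simps)
  qed
qed

lemma PLc_dyadicE:
  assumes "h \<in> PLc c d" "c < a0" "b0 < d" "c < d"
  obtains a b where "a \<in> dyadic_rationals" "b \<in> dyadic_rationals" "c < a" "a < a0" "b0 < b" "b < d"
    "a < b" "h \<in> PL a b"
proof -
  obtain a1 b1 where ab: "c < a1" "b1 < d" "h \<in> PL a1 b1" using assms(1) unfolding PLc_def by blast
  obtain a where a: "a \<in> dyadic_rationals" "c < a" "a < Min {a0, a1, d}"
    using dyadic_dense[of c "Min {a0, a1, d}"] assms ab by auto
  obtain b where b: "b \<in> dyadic_rationals" "Max {b0, b1, a} < b" "b < d"
    using dyadic_dense[of "Max {b0, b1, a}" d] assms ab a by auto
  show thesis by (rule that[of a b]) (use a b ab in \<open>auto elim: PL_mono\<close>)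
qed

text \<open>
  An even length is halved by scaling, and an odd length \<open>2 j + 1\<close> becomes \<open>j + 1\<close> by halving the first
  \<open>2 j\<close> units only.
\<close>

lemma nat_interval_to_unit:
  assumes "n > 0"
  shows "\<exists>h. app h 0 = 0 \<and> app h (real n) = 1"
  using assms
proof (induction n rule: less_induct)
  case (less n)
  consider "n = 1" | j where "n = 2 * j" "j > 0" | j where "n = 2 * j + 1" "j > 0"
    using less.prems by (metis bot_nat_0.not_eq_extremum dvd_mult_div_cancel mult_0_right odd_two_times_div_two_succ plus_nat.add_0)
  then show ?case
  proof cases
    case 1
    then show ?thesis by (intro exI[of _ 1]) simp
  next
    case (2 j)
    then obtain h where "app h 0 = 0" "app h (real j) = 1" using less.IH[of j] by auto
    then show ?thesis using 2 by (intro exI[of _ "h * affine_map (-1) 0"]) simp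
  next
    case (3 j)
    then obtain h where h: "app h 0 = 0" "app h (real (j + 1)) = 1" using less.IH[of "j + 1"] by auto
    define g where "g = glue (2 * real j) (affine_map (-1) 0) (affine_map 0 (- real j))"
    have dy: "2 * real j \<in> dyadic_rationals" "- real j \<in> dyadic_rationals"
      using dyadic_int[of "2 * int j"] dyadic_int[of "- int j"] by simp_all
    have "app g x = (if x \<le> 2 * real j then app (affine_map (-1) 0) x else app (affine_map 0 (- real j)) x)" for x
      unfolding g_def using dy by (intro app_glue) auto
    then have "app g 0 = 0" "app g (real n) = real (j + 1)" using 3 dy by auto
    then show ?thesis using h by (intro exI[of _ "h * g"]) simp
  qed
qed

lemma interval_transitive:
  assumes "p \<in> dyadic_rationals" "p' \<in> dyadic_rationals" "q \<in> dyadic_rationals" "q' \<in> dyadic_rationals"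
    "p < p'" "q < q'"
  obtains h where "app h p = q" "app h p' = q'"
proof -
  have unit: "\<exists>h. app h p = 0 \<and> app h p' = 1"
    if pp: "p \<in> dyadic_rationals" "p' \<in> dyadic_rationals" "p < p'" for p p'
  proof -
    obtain m n where m: "p' - p = of_int m / 2 ^ n"
      using dyadic_diff[OF pp(2,1)] unfolding dyadic_rationals_def by blast
    with pp have "m > 0" by (metis diff_gt_0_iff_gt of_int_0_less_iff zero_less_divide_iff zero_less_numeral zero_less_power not_less_iff_gr_or_eq)
    then obtain h where h: "app h 0 = 0" "app h (real (nat m)) = 1"
      using nat_interval_to_unit[of "nat m"] by auto
    have "- (2 powi int n * p) \<in> dyadic_rationals"
      by (intro dyadic_minus dyadic_mult dyadic_powi pp)
    moreover have "2 powi int n * p' - 2 powi int n * p = real (nat m)"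
      using m \<open>m > 0\<close> by (simp flip: right_diff_distrib)
    ultimately show ?thesis using h by (intro exI[of _ "h * affine_map (int n) (- (2 powi int n * p))"]) simp
  qed
  obtain h where "app h p = 0" "app h p' = 1" using unit assms by blast
  moreover obtain g where "app g q = 0" "app g q' = 1" using unit assms by blast
  ultimately show thesis by (intro that[of "inverse g * h"]) (simp_all add: app_inverse_eq_iff)
qed

text \<open>
  The gaps on both sides of \<open>[a, b]\<close> are dyadic intervals, and any two of these are related by a
  dyadic piecewise linear map, so the gaps can be filled.
\<close>

lemma extend_to_PL:
  assumes dy: "a \<in> dyadic_rationals" "b \<in> dyadic_rationals" "c \<in> dyadic_rationals" "d \<in> dyadic_rationals"
    and le: "c < a" "a \<le> b" "b < d" "c < app h a" "app h b < d"
  obtains k where "k \<in> PL c d" "\<And>x. a \<le> x \<Longrightarrow> x \<le> b \<Longrightarrow> app k x = app h x"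
proof -
  obtain u where u: "app u c = c" "app u a = app h a"
    using interval_transitive[of c a c "app h a"] dy le by auto
  obtain v where v: "app v b = app h b" "app v d = d"
    using interval_transitive[of b d "app h b" d] dy le by auto
  define k1 where "k1 = glue c 1 u"
  have k1: "app k1 x = (if x \<le> c then x else app u x)" for x
    unfolding k1_def using dy u by (simp add: app_glue)
  define k2 where "k2 = glue a k1 h"
  have k2: "app k2 x = (if x \<le> a then app k1 x else app h x)" for x
    unfolding k2_def using dy u le by (simp add: app_glue k1)
  define k3 where "k3 = glue b k2 v"
  have k3: "app k3 x = (if x \<le> b then app k2 x else app v x)" for x
    unfolding k3_def using dy u v le by (subst app_glue) (auto simp: k1 k2)
  define k4 where "k4 = glue d k3 1"
  have k4: "app k4 x = (if x \<le> d then app k3 x else x)" for x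
    unfolding k4_def using dy u v le by (subst app_glue) (auto simp: k1 k2 k3)
  show thesis
  proof (rule that[of k4])
    show "k4 \<in> PL c d" using u v le by (auto simp: PL_def k1 k2 k3 k4)
    show "app k4 x = app h x" if "a \<le> x" "x \<le> b" for x
      using that u v le by (auto simp: k1 k2 k3 k4)
  qed
qed

lemma extend_to_PLc:
  assumes "a \<in> dyadic_rationals" "b \<in> dyadic_rationals"
    "c < a" "a \<le> b" "b < d" "c < app h a" "app h b < d"
  obtains k where "k \<in> PLc c d" "\<And>x. a \<le> x \<Longrightarrow> x \<le> b \<Longrightarrow> app k x = app h x"
proof -
  obtain c' where c': "c' \<in> dyadic_rationals" "c < c'" "c' < min a (app h a)"
    using dyadic_dense[of c "min a (app h a)"] assms by auto
  obtain d' where d': "d' \<in> dyadic_rationals" "max b (app h b) < d'" "d' < d"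
    using dyadic_dense[of "max b (app h b)" d] assms by auto
  obtain k where "k \<in> PL c' d'" "\<And>x. a \<le> x \<Longrightarrow> x \<le> b \<Longrightarrow> app k x = app h x"
    by (rule extend_to_PL[of a b c' d' h]) (use assms c' d' in auto)
  then show thesis using c' d' by (intro that[of k]) (auto intro: PLc_I)
qed

lemma PLc_transitive:
  assumes "a \<in> dyadic_rationals" "b \<in> dyadic_rationals" "a' \<in> dyadic_rationals" "b' \<in> dyadic_rationals"
    "c < a" "a < b" "b < d" "c < a'" "a' < b'" "b' < d"
  obtains k where "k \<in> PLc c d" "app k a = a'" "app k b = b'"
proof -
  obtain h where h: "app h a = a'" "app h b = b'"
    using interval_transitive[of a b a' b'] assms by auto
  obtain k where "k \<in> PLc c d" "\<And>x. a \<le> x \<Longrightarrow> x \<le> b \<Longrightarrow> app k x = app h x"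
    using extend_to_PLc[of a b c d h] assms h by auto
  then show thesis using that[of k] h assms by auto
qed

section \<open>Germs\<close>

text \<open>
  The slope is taken to the right of \<open>p\<close> for \<open>s = 1\<close> and to the left of \<open>p\<close> for \<open>s = -1\<close>; \<open>k\<close> is its
  binary logarithm. On maps that fix \<open>p\<close>, \<open>k\<close> is a homomorphism to the integers.
\<close>

definition slope_at :: "real \<Rightarrow> real \<Rightarrow> int \<Rightarrow> pl2 \<Rightarrow> bool" where
  "slope_at s p k h \<longleftrightarrow>
    (\<exists>e>0. \<forall>t. 0 \<le> t \<and> t \<le> e \<longrightarrow> app h (p + s * t) = app h p + s * (2 powi k * t))"

abbreviation "rgerm \<equiv> slope_at 1"

abbreviation "lgerm \<equiv> slope_at (- 1)"

lemma rgerm_iff: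
  "rgerm p k h \<longleftrightarrow> (\<exists>e>0. \<forall>x. p \<le> x \<and> x \<le> p + e \<longrightarrow> app h x = app h p + 2 powi k * (x - p))"
proof -
  have "(\<forall>t. 0 \<le> t \<and> t \<le> e \<longrightarrow> app h (p + t) = app h p + 2 powi k * t) \<longleftrightarrow>
      (\<forall>x. p \<le> x \<and> x \<le> p + e \<longrightarrow> app h x = app h p + 2 powi k * (x - p))"
    (is "?L \<longleftrightarrow> ?R") for e
  proof
    show ?R if ?L
    proof (intro allI impI)
      fix x assume "p \<le> x \<and> x \<le> p + e"
      then show "app h x = app h p + 2 powi k * (x - p)" using that[rule_format, of "x - p"] by simp
    qed
    show ?L if ?R
    proof (intro allI impI)
      fix t assume "0 \<le> t \<and> t \<le> e"
      then show "app h (p + t) = app h p + 2 powi k * t" using that[rule_format, of "p + t"] by simp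
    qed
  qed
  then show ?thesis by (simp add: slope_at_def)
qed

lemma lgerm_iff:
  "lgerm p k h \<longleftrightarrow> (\<exists>e>0. \<forall>x. p - e \<le> x \<and> x \<le> p \<longrightarrow> app h x = app h p + 2 powi k * (x - p))"
proof -
  have "(\<forall>t. 0 \<le> t \<and> t \<le> e \<longrightarrow> app h (p - t) = app h p - 2 powi k * t) \<longleftrightarrow>
      (\<forall>x. p - e \<le> x \<and> x \<le> p \<longrightarrow> app h x = app h p + 2 powi k * (x - p))"
    (is "?L \<longleftrightarrow> ?R") for e
  proof
    show ?R if ?L
    proof (intro allI impI)
      fix x assume "p - e \<le> x \<and> x \<le> p"
      then show "app h x = app h p + 2 powi k * (x - p)"
        using that[rule_format, of "p - x"] by (simp add: right_diff_distrib)
    qed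
    show ?L if ?R
    proof (intro allI impI)
      fix t assume "0 \<le> t \<and> t \<le> e"
      then show "app h (p - t) = app h p - 2 powi k * t" using that[rule_format, of "p - t"] by simp
    qed
  qed
  then show ?thesis by (simp add: slope_at_def)
qed

lemma rgerm_exists: "\<exists>k. rgerm p k h"
  unfolding rgerm_iff by (rule germ[of p h]) blast

lemma lgerm_exists: "\<exists>k. lgerm p k h"
  unfolding lgerm_iff by (rule germ[of p h]) blast

lemma two_powi_inject: "(2::real) powi k = 2 powi l \<Longrightarrow> k = l"
  using power_int_strict_increasing[of k l "2::real"] power_int_strict_increasing[of l k "2::real"]
  by (cases k l rule: linorder_cases) auto

lemma slope_at_unique:
  assumes "slope_at s p k h" "slope_at s p l h" "s \<noteq> 0"
  shows "k = l"
proof -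
  obtain e where e: "e > 0" "\<And>t. 0 \<le> t \<Longrightarrow> t \<le> e \<Longrightarrow> app h (p + s * t) = app h p + s * (2 powi k * t)"
    using assms(1) unfolding slope_at_def by blast
  obtain e' where e': "e' > 0" "\<And>t. 0 \<le> t \<Longrightarrow> t \<le> e' \<Longrightarrow> app h (p + s * t) = app h p + s * (2 powi l * t)"
    using assms(2) unfolding slope_at_def by blast
  have "2 powi k * min e e' = 2 powi l * min e e'" "min e e' \<noteq> 0"
    using e(2)[of "min e e'"] e'(2)[of "min e e'"] e(1) e'(1) assms(3) by auto
  then have "(2::real) powi k = 2 powi l" by simp
  then show ?thesis by (rule two_powi_inject)
qed

lemma slope_at_mult:
  assumes "slope_at s p k h" "slope_at s (app h p) l g"
  shows "slope_at s p (k + l) (g * h)"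
proof -
  obtain e where e: "e > 0" "\<And>t. 0 \<le> t \<Longrightarrow> t \<le> e \<Longrightarrow> app h (p + s * t) = app h p + s * (2 powi k * t)"
    using assms(1) unfolding slope_at_def by blast
  obtain e' where e': "e' > 0" "\<And>t. 0 \<le> t \<Longrightarrow> t \<le> e' \<Longrightarrow>
      app g (app h p + s * t) = app g (app h p) + s * (2 powi l * t)"
    using assms(2) unfolding slope_at_def by blast
  have "app (g * h) (p + s * t) = app (g * h) p + s * (2 powi (k + l) * t)"
    if t: "0 \<le> t" "t \<le> min e (e' / 2 powi k)" for t
  proof -
    have "2 powi k * t \<le> 2 powi k * (e' / 2 powi k)" using t by (intro mult_left_mono) auto
    then have "app g (app h p + s * (2 powi k * t)) = app g (app h p) + s * (2 powi l * (2 powi k * t))"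
      using t by (intro e'(2)) auto
    moreover have "app h (p + s * t) = app h p + s * (2 powi k * t)" using t by (intro e(2)) auto
    ultimately show ?thesis by (simp add: power_int_add)
  qed
  moreover have "0 < min e (e' / 2 powi k)" using e(1) e'(1) by simp
  ultimately show ?thesis unfolding slope_at_def by blast
qed

lemma slope_at_one: "slope_at s p 0 1"
  unfolding slope_at_def by (auto intro: exI[of _ 1])

lemma slope_at_inverse:
  assumes "slope_at s p k h"
  shows "slope_at s (app h p) (- k) (inverse h)"
proof -
  obtain e where e: "e > 0" "\<And>t. 0 \<le> t \<Longrightarrow> t \<le> e \<Longrightarrow> app h (p + s * t) = app h p + s * (2 powi k * t)"
    using assms unfolding slope_at_def by blast
  have "app (inverse h) (app h p + s * t) = p + s * (2 powi (- k) * t)"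
    if t: "0 \<le> t" "t \<le> 2 powi k * e" for t
  proof -
    have "2 powi (- k) * t \<le> e" using t by (simp add: power_int_minus field_simps)
    then have "app h (p + s * (2 powi (- k) * t)) = app h p + s * (2 powi k * (2 powi (- k) * t))"
      using t by (intro e(2)) auto
    then show ?thesis by (simp add: app_inverse_eq_iff power_int_minus)
  qed
  moreover have "0 < 2 powi k * e" using e(1) by simp
  ultimately show ?thesis unfolding slope_at_def by fastforce
qed

lemma slope_at_conj_by:
  assumes "slope_at s p k h" "app h p = p" "slope_at s p l g"
  shows "slope_at s (app g p) k (conj_by g h)"
  using slope_at_mult[OF slope_at_inverse[OF assms(3)], of "k + l" "g * h"]
    slope_at_mult[OF assms(1), of l g] assms(2,3)
  by (simp add: conj_by_def mult.assoc)

lemma slope_at_power_int: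
  assumes "slope_at s p k h" "app h p = p"
  shows "slope_at s p (i * k) (h powi i)"
proof -
  have nat: "slope_at s p (int n * k) (h ^ n) \<and> app (h ^ n) p = p" for n
  proof (induction n)
    case (Suc n)
    then show ?case
      using slope_at_mult[of s p "int n * k" "h ^ n" k h] assms by (simp add: algebra_simps)
  qed (simp add: slope_at_one)
  show ?thesis
  proof (cases "i \<ge> 0")
    case True
    then show ?thesis using nat[of "nat i"] by (simp add: power_int_def)
  next
    case False
    then show ?thesis
      using nat[of "nat (- i)"] slope_at_inverse[of s p "int (nat (-i)) * k" "h ^ nat (- i)"]
      by (simp add: power_int_def mult_group_inverse_power)
  qed
qed

lemma rgerm_conj_by: "rgerm p k h \<Longrightarrow> app h p = p \<Longrightarrow> rgerm (app g p) k (conj_by g h)"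
  using rgerm_exists slope_at_conj_by by blast

lemma lgerm_conj_by: "lgerm p k h \<Longrightarrow> app h p = p \<Longrightarrow> lgerm (app g p) k (conj_by g h)"
  using lgerm_exists slope_at_conj_by by blast

text \<open>
  The elements with compact support are the kernel of the pair of slope homomorphisms.
\<close>

lemma PLc_iff_trivial_germs: "h \<in> PLc a b \<longleftrightarrow> h \<in> PL a b \<and> rgerm a 0 h \<and> lgerm b 0 h"
proof
  assume "h \<in> PLc a b"
  then obtain a' b' where *: "a < a'" "b' < b" "h \<in> PL a' b'" unfolding PLc_def by blast
  then have "rgerm a 0 h"
    unfolding rgerm_iff by (intro exI[of _ "a' - a"]) (simp add: PL_D)
  moreover have "lgerm b 0 h"
    unfolding lgerm_iff using * by (intro exI[of _ "b - b'"]) (simp add: PL_D)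
  ultimately show "h \<in> PL a b \<and> rgerm a 0 h \<and> lgerm b 0 h"
    using \<open>h \<in> PLc a b\<close> PLc_subset_PL by blast
next
  assume *: "h \<in> PL a b \<and> rgerm a 0 h \<and> lgerm b 0 h"
  then have fx: "app h a = a" "app h b = b" by (auto intro: PL_D)
  obtain e where e: "e > 0" "\<And>x. a \<le> x \<Longrightarrow> x \<le> a + e \<Longrightarrow> app h x = x"
    using * fx unfolding rgerm_iff by auto
  obtain e' where e': "e' > 0" "\<And>x. b - e' \<le> x \<Longrightarrow> x \<le> b \<Longrightarrow> app h x = x"
    using * fx unfolding lgerm_iff by auto
  have "h \<in> PL (a + e) (b - e')"
  proof (rule PL_I)
    show "app h x = x" if "x \<le> a + e" for x using that e *
      by (cases "x \<le> a") (auto simp: PL_def)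
    show "app h x = x" if "b - e' \<le> x" for x using that e' *
      by (cases "b \<le> x") (auto simp: PL_def)
  qed
  then show "h \<in> PLc a b" using e(1) e'(1) by (auto intro: PLc_I)
qed

text \<open>
  The map is linear near 0 with slope \<open>2\<^sup>m\<close> and near 1 with slope \<open>2\<^sup>-\<^sup>n\<close>. In between, an
  arbitrary dyadic map from \<open>[p, 1/2]\<close> to \<open>[1/2, 1 - q/2]\<close> stays above the diagonal because its
  domain lies to the left of its range; here \<open>q = 2\<^sup>-\<^sup>n\<close>.
\<close>

lemma bump:
  assumes "m > 0" "n > 0"
  obtains f where "f \<in> PL 0 1" "rgerm 0 m f" "lgerm 1 (- n) f" "\<And>x. 0 < x \<Longrightarrow> x < 1 \<Longrightarrow> x < app f x"
proof -
  define p :: real where "p = 2 powi (- m - 1)"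
  have "2 powi (-m - 1) < (2 powi (-1) :: real)" using assms by (intro power_int_strict_increasing) auto
  then have p: "0 < p" "p < 1/2" "p \<in> dyadic_rationals"
    unfolding p_def by (auto simp: dyadic_powi)
  have mp: "2 powi m * p = 1/2"
    unfolding p_def by (simp flip: power_int_add)
  have half: "1/2 \<in> dyadic_rationals" using dyadic_powi[of "-1"] by simp
  define q :: real where "q = 2 powi (-n)"
  have "2 powi (-n) < (2 powi 0 :: real)" using assms by (intro power_int_strict_increasing) auto
  then have q: "0 < q" "q < 1" "q \<in> dyadic_rationals" "1 - q \<in> dyadic_rationals"
    unfolding q_def by (auto simp: dyadic_powi intro!: dyadic_diff)
  have q2: "1 - q / 2 \<in> dyadic_rationals" 
    using dyadic_diff[OF dyadic_0_1(2) dyadic_mult[OF half q(3)]] by simp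
  obtain h where h: "app h p = 1/2" "app h (1/2) = 1 - q / 2"
    using interval_transitive[of p "1/2" "1/2" "1 - q / 2"] p half q q2 by auto
  define f1 where "f1 = glue 0 1 (affine_map m 0)"
  have f1: "app f1 x = (if x \<le> 0 then x else 2 powi m * x)" for x
    unfolding f1_def by (simp add: app_glue)
  define f2 where "f2 = glue p f1 h"
  have f2: "app f2 x = (if x \<le> p then app f1 x else app h x)" for x
    unfolding f2_def using p mp h by (simp add: app_glue f1)
  define f3 where "f3 = glue (1/2) f2 (affine_map (-n) (1 - q))"
  have f3: "app f3 x = (if x \<le> 1/2 then app f2 x else q * x + (1 - q))" for x
    unfolding f3_def using p mp h half q by (subst app_glue) (auto simp: f1 f2 q_def[symmetric] field_simps)
  define f where "f = glue 1 f3 1"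
  have f: "app f x = (if x \<le> 1 then app f3 x else x)" for x
    unfolding f_def by (subst app_glue) (auto simp: f3)
  note fs = f1 f2 f3 f
  show thesis
  proof (rule that[of f])
    show "f \<in> PL 0 1" using p by (auto simp: PL_def fs)
    show "rgerm 0 m f" unfolding rgerm_iff using p by (intro exI[of _ p]) (auto simp: fs)
    show "lgerm 1 (- n) f" unfolding lgerm_iff using p
      by (intro exI[of _ "1/3"]) (auto simp: fs q_def[symmetric] algebra_simps)
    fix x :: real assume x: "0 < x" "x < 1"
    have "(2 powi 0 :: real) < 2 powi m" using assms by (intro power_int_strict_increasing) auto
    then have m: "1 * x < 2 powi m * x" using x by (intro mult_strict_right_mono) auto
    have "(1 - x) * q < (1 - x) * 1" using x q by (intro mult_strict_left_mono) auto
    moreover have "1/2 \<le> app h x" if "p \<le> x" using that h(1) app_le_iff[of h p x] by linarith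
    moreover have "x < app h x" if "p < x" "x \<le> 1/2"
    proof (cases "x = 1/2")
      case True
      show ?thesis unfolding True h(2) using q by simp
    next
      case False
      then show ?thesis using h(1) app_less_iff[of h p x] that by linarith
    qed
    ultimately show "x < app f x" using x p m by (auto simp: fs algebra_simps)
  qed
qed

section \<open>Piecewise affine maps given by two lists of piece lengths\<close>

text \<open>
  A list \<open>ms\<close> of natural numbers, with an integer \<open>j\<close>, stands for a sequence of adjacent intervals of
  lengths \<open>2 powi (j + m)\<close>. Two such lists of the same length determine the map that sends the
  \<open>i\<close>-th interval of the first sequence affinely to the \<open>i\<close>-th interval of the second one. The map does
  not change when corresponding intervals are both halved. Only lengths are recorded, so that the
  intervals need not be standard dyadic ones and may be permuted freely.
\<close>

definition wt :: "nat list \<Rightarrow> nat" where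
  "wt ms = (\<Sum>m\<leftarrow>ms. 2 ^ m)"

lemma wt_simps [simp]: "wt [] = 0" "wt (m # ms) = 2 ^ m + wt ms" "wt (ms @ ns) = wt ms + wt ns"
  by (simp_all add: wt_def)

definition seglen :: "int \<Rightarrow> nat list \<Rightarrow> real" where
  "seglen j ms = 2 powi j * real (wt ms)"

lemma seglen_simps [simp]: "seglen j [] = 0" "seglen j (m # ms) = 2 powi (j + int m) + seglen j ms"
  "seglen j (ms @ ns) = seglen j ms + seglen j ns"
  by (simp_all add: seglen_def distrib_left power_int_add)

lemma seglen_nonneg: "0 \<le> seglen j ms"
  by (simp add: seglen_def)

lemma seglen_dyadic: "seglen j ms \<in> dyadic_rationals"
  unfolding seglen_def using dyadic_mult[OF dyadic_powi dyadic_int, of j "int (wt ms)"] by simp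

lemma seglen_eq: "wt ms = wt ns \<Longrightarrow> seglen j ms = seglen j ns"
  by (simp add: seglen_def)

fun piecewise :: "int \<Rightarrow> real \<Rightarrow> real \<Rightarrow> nat list \<Rightarrow> nat list \<Rightarrow> pl2" where
  "piecewise j a b (m # ms) (n # ns) =
     glue (a + 2 powi (j + int m))
       (affine_map (int n - int m) (b - 2 powi (int n - int m) * a))
       (piecewise j (a + 2 powi (j + int m)) (b + 2 powi (j + int n)) ms ns)"
| "piecewise j a b _ _ = affine_map 0 (b - a)"

declare piecewise.simps [simp del]

lemma powi_scale: "2 powi (int n - int m) * (2::real) powi (j + int m) = 2 powi (j + int n)"
  by (simp add: add.commute flip: power_int_add)

lemma app_piecewise_Nil [simp]:
  "a \<in> dyadic_rationals \<Longrightarrow> b \<in> dyadic_rationals \<Longrightarrow> app (piecewise j a b [] []) x = x - a + b"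
  by (simp add: piecewise.simps dyadic_diff)

lemma piecewise_start:
  assumes "a \<in> dyadic_rationals" "b \<in> dyadic_rationals" "length ms = length ns"
  shows "app (piecewise j a b ms ns) a = b"
  using assms(3,1,2)
proof (induction ms ns arbitrary: a b rule: list_induct2)
  case Nil
  then show ?case by simp
next
  case (Cons m ms n ns)
  let ?p = "a + 2 powi (j + int m)"
  let ?q = "b + 2 powi (j + int n)"
  have dy: "?p \<in> dyadic_rationals" "?q \<in> dyadic_rationals"
      "b - 2 powi (int n - int m) * a \<in> dyadic_rationals"
    using Cons.prems by (auto intro: dyadic_add dyadic_powi dyadic_diff dyadic_mult)
  have "app (piecewise j ?p ?q ms ns) ?p = ?q" using dy by (intro Cons.IH)
  then have "app (affine_map (int n - int m) (b - 2 powi (int n - int m) * a)) ?p = app (piecewise j ?p ?q ms ns) ?p"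
    using dy by (simp add: distrib_left powi_scale)
  then show ?case using dy by (simp add: piecewise.simps app_glue)
qed

lemma app_piecewise_Cons:
  assumes "a \<in> dyadic_rationals" "b \<in> dyadic_rationals" "length ms = length ns"
  shows "app (piecewise j a b (m # ms) (n # ns)) x =
    (if x \<le> a + 2 powi (j + int m) then b + 2 powi (int n - int m) * (x - a)
     else app (piecewise j (a + 2 powi (j + int m)) (b + 2 powi (j + int n)) ms ns) x)"
proof -
  let ?p = "a + 2 powi (j + int m)"
  let ?q = "b + 2 powi (j + int n)"
  have dy: "?p \<in> dyadic_rationals" "?q \<in> dyadic_rationals"
      "b - 2 powi (int n - int m) * a \<in> dyadic_rationals"
    using assms by (auto intro: dyadic_add dyadic_powi dyadic_diff dyadic_mult)
  have "app (piecewise j ?p ?q ms ns) ?p = ?q" using dy assms by (intro piecewise_start)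
  then have "app (affine_map (int n - int m) (b - 2 powi (int n - int m) * a)) ?p = app (piecewise j ?p ?q ms ns) ?p"
    using dy by (simp add: distrib_left powi_scale)
  then show ?thesis using dy by (simp add: piecewise.simps app_glue algebra_simps)
qed

lemma piecewise_end:
  assumes "length ms = length ns" "a \<in> dyadic_rationals" "b \<in> dyadic_rationals" "a + seglen j ms \<le> x"
  shows "app (piecewise j a b ms ns) x = x - (a + seglen j ms) + (b + seglen j ns)"
  using assms
proof (induction ms ns arbitrary: a b rule: list_induct2)
  case (Cons m ms n ns)
  let ?p = "a + 2 powi (j + int m)"
  let ?q = "b + 2 powi (j + int n)"
  have dy: "?p \<in> dyadic_rationals" "?q \<in> dyadic_rationals"
    using Cons.prems by (auto intro: dyadic_add dyadic_powi)
  have IH: "app (piecewise j ?p ?q ms ns) x = x - (?p + seglen j ms) + (?q + seglen j ns)"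
    using Cons.prems dy by (intro Cons.IH) auto
  show ?case
  proof (cases "x \<le> ?p")
    case True
    then have "x = ?p" using Cons.prems seglen_nonneg[of j ms] by simp
    then show ?thesis using IH piecewise_start[OF dy Cons.hyps(1), of j] Cons.prems Cons.hyps(1)
      by (simp add: app_piecewise_Cons powi_scale)
  qed (use Cons.prems Cons.hyps IH in \<open>simp add: app_piecewise_Cons\<close>)
qed simp

lemma piecewise_refl:
  assumes "a \<in> dyadic_rationals" "b \<in> dyadic_rationals"
  shows "app (piecewise j a b ms ms) x = x - a + b"
  using assms
proof (induction ms arbitrary: a b)
  case (Cons m ms)
  then show ?case by (simp add: app_piecewise_Cons dyadic_add dyadic_powi)
qed simp

lemma piecewise_comp:
  assumes "length ms = length ns" "length ns = length ps"
    "a \<in> dyadic_rationals" "b \<in> dyadic_rationals" "c \<in> dyadic_rationals"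
  shows "app (piecewise j b c ns ps) (app (piecewise j a b ms ns) x) = app (piecewise j a c ms ps) x"
  using assms
proof (induction ms ns ps arbitrary: a b c rule: list_induct3)
  case (Cons m ms n ns p ps)
  let ?a = "a + 2 powi (j + int m)"
  let ?b = "b + 2 powi (j + int n)"
  let ?c = "c + 2 powi (j + int p)"
  have dy: "?a \<in> dyadic_rationals" "?b \<in> dyadic_rationals" "?c \<in> dyadic_rationals"
    using Cons.prems by (auto intro: dyadic_add dyadic_powi)
  note IH = Cons.IH[OF dy]
  show ?case
  proof (cases "x \<le> ?a")
    case True
    let ?y = "b + 2 powi (int n - int m) * (x - a)"
    have "2 powi (int n - int m) * (x - a) \<le> 2 powi (int n - int m) * 2 powi (j + int m)"
      using True by (intro mult_left_mono) auto
    then have y: "?y \<le> ?b" by (simp add: powi_scale)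
    have "app (piecewise j a b (m # ms) (n # ns)) x = ?y"
      using True Cons by (simp add: app_piecewise_Cons)
    moreover have "app (piecewise j b c (n # ns) (p # ps)) ?y = c + 2 powi (int p - int n) * (?y - b)"
      using y Cons by (simp add: app_piecewise_Cons)
    moreover have "2 powi (int p - int n) * 2 powi (int n - int m) = (2::real) powi (int p - int m)"
      by (simp flip: power_int_add)
    ultimately show ?thesis using True Cons by (simp add: app_piecewise_Cons flip: mult.assoc)
  next
    case False
    let ?y = "app (piecewise j ?a ?b ms ns) x"
    have "app (piecewise j ?a ?b ms ns) ?a < ?y" using False by simp
    then have "?b < ?y" using piecewise_start[OF dy(1,2) Cons.hyps(1)] by simp
    then show ?thesis using False Cons IH by (simp add: app_piecewise_Cons)
  qed
qed simp

lemma piecewise_append: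
  assumes "length ms = length ns" "length ms' = length ns'"
    "a \<in> dyadic_rationals" "b \<in> dyadic_rationals" "a \<le> x"
  shows "app (piecewise j a b (ms @ ms') (ns @ ns')) x =
    (if x \<le> a + seglen j ms then app (piecewise j a b ms ns) x
     else app (piecewise j (a + seglen j ms) (b + seglen j ns) ms' ns') x)"
  using assms(1,3-5)
proof (induction ms ns arbitrary: a b rule: list_induct2)
  case Nil
  then show ?case using assms(2) by (auto simp: piecewise_start)
next
  case (Cons m ms n ns)
  let ?p = "a + 2 powi (j + int m)"
  let ?q = "b + 2 powi (j + int n)"
  have dy: "?p \<in> dyadic_rationals" "?q \<in> dyadic_rationals"
    using Cons.prems by (auto intro: dyadic_add dyadic_powi)
  show ?case
    using Cons.IH[OF dy] Cons.prems Cons.hyps assms(2) seglen_nonneg[of j ms]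
    by (cases "x \<le> ?p") (auto simp: app_piecewise_Cons add.assoc)
qed

lemma piecewise_split:
  assumes "length ms = length ns" "length ms' = length ns'"
    "a \<in> dyadic_rationals" "b \<in> dyadic_rationals"
  shows "app (piecewise j a b (ms @ Suc m # ms') (ns @ Suc n # ns')) x =
    app (piecewise j a b (ms @ m # m # ms') (ns @ n # n # ns')) x"
  using assms(1,3,4)
proof (induction ms ns arbitrary: a b rule: list_induct2)
  case Nil
  let ?P = "2 powi (j + int m) :: real" and ?Q = "2 powi (j + int n) :: real"
  let ?r = "2 powi (int n - int m) :: real"
  have double: "2 powi (j + int (Suc k)) = 2 powi (j + int k) + (2 powi (j + int k) :: real)" for k
    by (simp add: power_int_add)
  have e1: "app (piecewise j a b (Suc m # ms') (Suc n # ns')) x =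
      (if x \<le> a + (?P + ?P) then b + ?r * (x - a)
       else app (piecewise j (a + (?P + ?P)) (b + (?Q + ?Q)) ms' ns') x)"
    unfolding app_piecewise_Cons[OF Nil assms(2)] double by simp
  have e2: "app (piecewise j a b (m # m # ms') (n # n # ns')) x =
      (if x \<le> a + ?P then b + ?r * (x - a)
       else if x \<le> a + (?P + ?P) then b + ?Q + ?r * (x - (a + ?P))
       else app (piecewise j (a + (?P + ?P)) (b + (?Q + ?Q)) ms' ns') x)"
    using Nil assms(2) by (simp add: app_piecewise_Cons dyadic_add dyadic_powi add.assoc)
  have e3: "?r * (x - a) = ?Q + ?r * (x - (a + ?P))"
    using powi_scale[of n m j] by (simp add: algebra_simps)
  have "x \<le> a + ?P \<longrightarrow> x \<le> a + (?P + ?P)" using zero_less_power_int[of "2::real" "j + int m"] by linarith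
  then show ?case unfolding append_Nil e1 e2 using e3 by (simp only: split: if_split) linarith
next
  case (Cons p ms q ns)
  then show ?case
    using assms(2) by (simp add: app_piecewise_Cons dyadic_add dyadic_powi)
qed

lemma piecewise_shift:
  assumes "length ms = length ns" "a \<in> dyadic_rationals" "b \<in> dyadic_rationals"
  shows "app (piecewise j a b (map ((+) i) ms) (map ((+) i) ns)) x = app (piecewise (j + int i) a b ms ns) x"
  using assms
proof (induction ms ns arbitrary: a b rule: list_induct2)
  case (Cons m ms n ns)
  then show ?case by (simp add: app_piecewise_Cons dyadic_add dyadic_powi add.assoc)
qed simp

lemma piecewise_scale:
  assumes "length ms = length ns" "a \<in> dyadic_rationals" "b \<in> dyadic_rationals" "t \<in> dyadic_rationals"
  shows "app (piecewise (j + i) (2 powi i * a + t) (2 powi i * b + t) ms ns) (2 powi i * x + t) =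
    2 powi i * app (piecewise j a b ms ns) x + t"
  using assms
proof (induction ms ns arbitrary: a b rule: list_induct2)
  case Nil
  then show ?case
    by (simp add: dyadic_add dyadic_mult dyadic_powi algebra_simps)
next
  case (Cons m ms n ns)
  have sc: "2 powi (j + i + int k) = 2 powi i * (2 powi (j + int k) :: real)" for k
    by (simp add: power_int_add)
  have le: "2 powi i * x + t \<le> 2 powi i * a + t + 2 powi i * 2 powi (j + int m) \<longleftrightarrow>
      x \<le> a + 2 powi (j + int m)"
    using mult_le_cancel_left_pos[of "2 powi i" x "a + 2 powi (j + int m)"]
    by (simp add: distrib_left algebra_simps)
  have dy: "a + 2 powi (j + int m) \<in> dyadic_rationals" "b + 2 powi (j + int n) \<in> dyadic_rationals"
    "2 powi i * a + t \<in> dyadic_rationals" "2 powi i * b + t \<in> dyadic_rationals"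
    using Cons.prems by (auto intro: dyadic_add dyadic_powi dyadic_mult)
  note IH = Cons.IH[OF dy(1,2) Cons.prems(3)]
  have arg: "2 powi i * a + t + 2 powi i * 2 powi (j + int m) = 2 powi i * (a + 2 powi (j + int m)) + t"
    "2 powi i * b + t + 2 powi i * 2 powi (j + int n) = 2 powi i * (b + 2 powi (j + int n)) + t"
    by (simp_all add: algebra_simps)
  show ?case
    unfolding app_piecewise_Cons[OF dy(3,4) Cons.hyps(1)] app_piecewise_Cons[OF Cons.prems(1,2) Cons.hyps(1)]
      sc le unfolding arg IH
    by (simp add: algebra_simps)
qed

text \<open>
  If the two lists have the same total length, the map can be continued by the identity on both
  sides.
\<close>

definition rearr :: "int \<Rightarrow> real \<Rightarrow> nat list \<Rightarrow> nat list \<Rightarrow> pl2" where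
  "rearr j a ms ns = glue a 1 (piecewise j a a ms ns)"

lemma app_rearr:
  assumes "a \<in> dyadic_rationals" "length ms = length ns"
  shows "app (rearr j a ms ns) x = (if x \<le> a then x else app (piecewise j a a ms ns) x)"
  unfolding rearr_def using assms by (subst app_glue) (auto simp: piecewise_start)

lemma rearr_PL:
  assumes "a \<in> dyadic_rationals" "length ms = length ns" "wt ms = wt ns"
  shows "rearr j a ms ns \<in> PL a (a + seglen j ms)"
  using assms seglen_eq[OF assms(3), of j] seglen_nonneg[of j ms]
  by (intro PL_I) (auto simp: app_rearr piecewise_end)

lemma rearr_refl [simp]: "a \<in> dyadic_rationals \<Longrightarrow> rearr j a ms ms = 1"
  by (rule pl2_eqI) (simp add: app_rearr piecewise_refl)

lemma rearr_comp:
  assumes "a \<in> dyadic_rationals" "length ms = length ns" "length ns = length ps"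
  shows "rearr j a ns ps * rearr j a ms ns = rearr j a ms ps"
proof (rule pl2_eqI)
  fix x
  have "a < app (piecewise j a a ms ns) x" if "a < x"
    using app_less_iff[of "piecewise j a a ms ns" a x] that assms by (simp add: piecewise_start)
  then show "app (rearr j a ns ps * rearr j a ms ns) x = app (rearr j a ms ps) x"
    using assms piecewise_comp[of ms ns ps a a a j x] by (auto simp: app_rearr)
qed

lemma rearr_append:
  assumes "a \<in> dyadic_rationals" "length ms = length ns" "length ms' = length ns'" "wt ms = wt ns"
  shows "rearr j a (ms @ ms') (ns @ ns') = rearr j a ms ns * rearr j (a + seglen j ms) ms' ns'"
proof (rule pl2_eqI)
  fix x
  let ?b = "a + seglen j ms"
  have b: "?b \<in> dyadic_rationals" using assms(1) by (intro dyadic_add seglen_dyadic)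
  have sp: "seglen j ns = seglen j ms" using seglen_eq[OF assms(4)] by simp
  have le: "a \<le> ?b" using seglen_nonneg by simp
  show "app (rearr j a (ms @ ms') (ns @ ns')) x = app (rearr j a ms ns * rearr j ?b ms' ns') x"
  proof (cases "x \<le> ?b")
    case True
    then show ?thesis using assms b by (auto simp: app_rearr piecewise_append)
  next
    case False
    have "app (piecewise j ?b ?b ms' ns') ?b < app (piecewise j ?b ?b ms' ns') x" using False by simp
    then have "?b < app (piecewise j ?b ?b ms' ns') x"
      by (simp only: piecewise_start[OF b b assms(3)])
    then show ?thesis
      using False assms b sp le
      by (simp add: app_rearr piecewise_append piecewise_end)
  qed
qed

text \<open>
  Halving a pair of corresponding intervals. The two halved entries may have any sizes \<open>m\<close> and \<open>n\<close>,
  which is the key to the proof that all rearrangements are trivial modulo commutators.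
\<close>

lemma rearr_split:
  assumes "a \<in> dyadic_rationals" "length ms = length ns" "length ms' = length ns'"
  shows "rearr j a (ms @ Suc m # ms') (ns @ Suc n # ns') = rearr j a (ms @ m # m # ms') (ns @ n # n # ns')"
  using assms piecewise_split[OF assms(2,3,1,1)] by (intro pl2_eqI) (simp add: app_rearr)

lemma rearr_shift:
  assumes "a \<in> dyadic_rationals" "length ms = length ns"
  shows "rearr j a (map ((+) i) ms) (map ((+) i) ns) = rearr (j + int i) a ms ns"
  using assms by (intro pl2_eqI) (simp add: app_rearr piecewise_shift)

lemma rearr_scale:
  assumes "a \<in> dyadic_rationals" "length ms = length ns" "t \<in> dyadic_rationals"
  shows "conj_by (affine_map i t) (rearr j a ms ns) = rearr (j + i) (2 powi i * a + t) ms ns"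
proof -
  have dy: "2 powi i * a + t \<in> dyadic_rationals" using assms by (intro dyadic_add dyadic_mult dyadic_powi)
  have "affine_map i t * rearr j a ms ns = rearr (j + i) (2 powi i * a + t) ms ns * affine_map i t"
  proof (rule pl2_eqI)
    fix x
    show "app (affine_map i t * rearr j a ms ns) x = app (rearr (j + i) (2 powi i * a + t) ms ns * affine_map i t) x"
      using assms dy piecewise_scale[OF assms(2,1,1,3), of j i x] by (simp add: app_rearr)
  qed
  then show ?thesis by (simp add: conj_by_def mult.assoc)
qed

lemma piecewise_replicate:
  assumes "a \<in> dyadic_rationals" "b \<in> dyadic_rationals" "a \<le> x" "x \<le> a + seglen j (replicate r m)"
  shows "app (piecewise j a b (replicate r m) (replicate r n)) x = b + 2 powi (int n - int m) * (x - a)"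
  using assms
proof (induction r arbitrary: a b)
  case 0
  then show ?case by simp
next
  case (Suc r)
  let ?a = "a + 2 powi (j + int m)"
  let ?b = "b + 2 powi (j + int n)"
  have dy: "?a \<in> dyadic_rationals" "?b \<in> dyadic_rationals"
    using Suc.prems by (auto intro: dyadic_add dyadic_powi)
  show ?case
  proof (cases "x \<le> ?a")
    case False
    have "app (piecewise j ?a ?b (replicate r m) (replicate r n)) x = ?b + 2 powi (int n - int m) * (x - ?a)"
      using False Suc.prems dy by (intro Suc.IH) auto
    then show ?thesis
      using False Suc.prems powi_scale[of n m j] by (simp add: app_piecewise_Cons algebra_simps)
  qed (use Suc.prems in \<open>simp add: app_piecewise_Cons\<close>)
qed

definition has_pieces :: "pl2 \<Rightarrow> real \<Rightarrow> real \<Rightarrow> bool" where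
  "has_pieces h p q \<longleftrightarrow> (\<exists>J. \<forall>j\<le>J. \<exists>ms ns. length ms = length ns \<and> p + seglen j ms = q \<and>
      app h p + seglen j ns = app h q \<and>
      (\<forall>x. p \<le> x \<and> x \<le> q \<longrightarrow> app h x = app (piecewise j p (app h p) ms ns) x))"

text \<open>
  For all sufficiently small units \<open>2 powi j\<close> one can cut \<open>[p, q]\<close> into equal intervals whose lengths
  are powers of two. The freedom in \<open>j\<close> is needed to join adjacent pieces with different slopes.
\<close>

lemma has_pieces_affine:
  assumes "p \<in> dyadic_rationals" "q \<in> dyadic_rationals" "p < q"
    "\<And>x. p \<le> x \<Longrightarrow> x \<le> q \<Longrightarrow> app h x = app h p + 2 powi k * (x - p)"
  shows "has_pieces h p q"
proof -
  obtain m N where mN: "q - p = of_int m / 2 ^ N"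
    using dyadic_diff[OF assms(2,1)] unfolding dyadic_rationals_def by blast
  have "0 < of_int m / (2::real) ^ N" using mN assms(3) by simp
  then have "m > 0" by (simp add: zero_less_divide_iff)
  have rep: "seglen j (replicate r n) = real r * 2 powi (j + int n)" for j r n
    by (induction r) (auto simp: algebra_simps)
  show ?thesis
    unfolding has_pieces_def
  proof (rule exI[of _ "min (- int N) (k - int N)"], intro allI impI)
    fix j :: int
    assume j: "j \<le> min (- int N) (k - int N)"
    define u where "u = nat (- int N - j)"
    define v where "v = nat (k - int N - j)"
    let ?ms = "replicate (nat m) u" let ?ns = "replicate (nat m) v"
    have uv: "j + int u = - int N" "j + int v = k - int N" "int v - int u = k"
      using j by (simp_all add: u_def v_def)
    have sp: "seglen j ?ms = q - p"
      using \<open>m > 0\<close> mN by (simp add: rep uv power_int_minus field_simps)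
    have "real (nat m) * 2 powi (k - int N) = 2 powi k * (q - p)"
      unfolding mN using \<open>m > 0\<close> by (simp add: power_int_diff)
    then have sp': "app h p + seglen j ?ns = app h q"
      using assms(4)[OF less_imp_le[OF assms(3)] order_refl] by (simp add: rep uv)
    have hx: "app h x = app (piecewise j p (app h p) ?ms ?ns) x" if "p \<le> x" "x \<le> q" for x
    proof -
      have "app (piecewise j p (app h p) ?ms ?ns) x = app h p + 2 powi k * (x - p)"
        using piecewise_replicate[of p "app h p" x j "nat m" u v] that assms(1) sp by (simp add: uv)
      then show ?thesis by (rule trans[OF assms(4)[OF that] sym])
    qed
    have "\<forall>x. p \<le> x \<and> x \<le> q \<longrightarrow> app h x = app (piecewise j p (app h p) ?ms ?ns) x"
      using hx by blast
    moreover have "length ?ms = length ?ns" "p + seglen j ?ms = q" using sp by simp_all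
    ultimately show "\<exists>ms ns. length ms = length ns \<and> p + seglen j ms = q \<and>
      app h p + seglen j ns = app h q \<and>
      (\<forall>x. p \<le> x \<and> x \<le> q \<longrightarrow> app h x = app (piecewise j p (app h p) ms ns) x)"
      using sp' by blast
  qed
qed

lemma has_pieces_trans:
  assumes "p \<in> dyadic_rationals" "q \<in> dyadic_rationals" "has_pieces h p q" "has_pieces h q r"
  shows "has_pieces h p r"
proof -
  obtain J where J: "\<And>j. j \<le> J \<Longrightarrow> \<exists>ms ns. length ms = length ns \<and> p + seglen j ms = q \<and>
      app h p + seglen j ns = app h q \<and>
      (\<forall>x. p \<le> x \<and> x \<le> q \<longrightarrow> app h x = app (piecewise j p (app h p) ms ns) x)"
    using assms(3) unfolding has_pieces_def by blast
  obtain J' where J': "\<And>j. j \<le> J' \<Longrightarrow> \<exists>ms ns. length ms = length ns \<and> q + seglen j ms = r \<and>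
      app h q + seglen j ns = app h r \<and>
      (\<forall>x. q \<le> x \<and> x \<le> r \<longrightarrow> app h x = app (piecewise j q (app h q) ms ns) x)"
    using assms(4) unfolding has_pieces_def by blast
  show ?thesis
    unfolding has_pieces_def
  proof (rule exI[of _ "min J J'"], intro allI impI)
    fix j assume "j \<le> min J J'"
    then have "j \<le> J" "j \<le> J'" by auto
    from J[OF this(1)] J'[OF this(2)] obtain ms ns ms' ns' where
      1: "length ms = length ns" "p + seglen j ms = q" "app h p + seglen j ns = app h q"
        "\<And>x. p \<le> x \<Longrightarrow> x \<le> q \<Longrightarrow> app h x = app (piecewise j p (app h p) ms ns) x" and
      2: "length ms' = length ns'" "q + seglen j ms' = r" "app h q + seglen j ns' = app h r"
        "\<And>x. q \<le> x \<Longrightarrow> x \<le> r \<Longrightarrow> app h x = app (piecewise j q (app h q) ms' ns') x"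
      by blast
    show "\<exists>ms ns. length ms = length ns \<and> p + seglen j ms = r \<and>
      app h p + seglen j ns = app h r \<and>
      (\<forall>x. p \<le> x \<and> x \<le> r \<longrightarrow> app h x = app (piecewise j p (app h p) ms ns) x)"
    proof (intro exI conjI allI impI)
      fix x assume x: "p \<le> x \<and> x \<le> r"
      have ap: "app (piecewise j p (app h p) (ms @ ms') (ns @ ns')) x =
          (if x \<le> q then app (piecewise j p (app h p) ms ns) x else app (piecewise j q (app h q) ms' ns') x)"
        using piecewise_append[OF 1(1) 2(1), of p "app h p" x j] x assms(1) unfolding 1(2,3) by simp
      show "app h x = app (piecewise j p (app h p) (ms @ ms') (ns @ ns')) x"
      proof (cases "x \<le> q")
        case True
        then show ?thesis unfolding ap using 1(4)[of x] x by (simp only: if_True)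
      next
        case False
        then show ?thesis unfolding ap using 2(4)[of x] x by (simp only: if_False)
      qed
    qed (use 1(1-3) 2(1-3) in auto)
  qed
qed

lemma has_pieces_all:
  assumes "p \<in> dyadic_rationals" "q \<in> dyadic_rationals" "p < q"
  shows "has_pieces h p q"
proof -
  obtain B where B: "finite B" "B \<subseteq> dyadic_rationals"
    "\<And>a b. {a<..<b} \<inter> B = {} \<Longrightarrow> \<exists>(k::int) c. \<forall>x\<in>{a<..<b}. app h x = 2 powi k * x + c"
    using is_pl2_app[of h] unfolding is_pl2_def by blast
  show ?thesis using assms
  proof (induction "card ({p<..<q} \<inter> B)" arbitrary: p q rule: less_induct)
    case less
    show ?case
    proof (cases "{p<..<q} \<inter> B = {}")
      case True
      then obtain k c where k: "\<forall>x\<in>{p<..<q}. app h x = 2 powi (k::int) * x + c" using B(3) by blast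
      have "continuous_on (closure {p<..<q}) (\<lambda>x. app h x - (2 powi k * x + c))"
        by (intro continuous_intros) (simp add: app_continuous continuous_at_imp_continuous_on)
      from continuous_constant_on_closure[OF this, of 0]
      have "app h x = 2 powi k * x + c" if "p \<le> x" "x \<le> q" for x
        using k less.prems that by auto
      then have "app h x = app h p + 2 powi k * (x - p)" if "p \<le> x" "x \<le> q" for x
        using that less.prems by (simp add: algebra_simps)
      then show ?thesis by (rule has_pieces_affine[OF less.prems])
    next
      case False
      then obtain s where s: "p < s" "s < q" "s \<in> B" by auto
      have "card ({p<..<s} \<inter> B) < card ({p<..<q} \<inter> B)" "card ({s<..<q} \<inter> B) < card ({p<..<q} \<inter> B)"
        using s B(1) by (auto intro!: psubset_card_mono)
      then show ?thesis
        using less.hyps s less.prems B(2) by (intro has_pieces_trans[of p s h q]) auto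
    qed
  qed
qed

lemma rearr_exists:
  assumes "h \<in> PL a b" "a \<in> dyadic_rationals" "b \<in> dyadic_rationals" "a < b"
  obtains j ms ns where "length ms = length ns" "wt ms = wt ns" "a + seglen j ms = b" "h = rearr j a ms ns"
proof -
  have fx: "app h a = a" "app h b = b" using assms by (auto intro: PL_D)
  obtain J where J: "\<And>j. j \<le> J \<Longrightarrow> \<exists>ms ns. length ms = length ns \<and> a + seglen j ms = b \<and>
      app h a + seglen j ns = app h b \<and>
      (\<forall>x. a \<le> x \<and> x \<le> b \<longrightarrow> app h x = app (piecewise j a (app h a) ms ns) x)"
    using has_pieces_all[OF assms(2-4), of h] unfolding has_pieces_def by blast
  obtain ms ns where *: "length ms = length ns" "a + seglen J ms = b" "a + seglen J ns = b"
    "\<And>x. a \<le> x \<Longrightarrow> x \<le> b \<Longrightarrow> app h x = app (piecewise J a a ms ns) x"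
    using J[of J] unfolding fx by blast
  have "seglen J ms = seglen J ns" using *(2,3) by simp
  then have "wt ms = wt ns" by (simp add: seglen_def)
  moreover have "h = rearr J a ms ns"
  proof (rule pl2_eqI)
    fix x
    consider "x \<le> a" | "a < x" "x \<le> b" | "b < x" by linarith
    then show "app h x = app (rearr J a ms ns) x"
    proof cases
      case 1
      then show ?thesis using assms PL_D(1)[OF assms(1)] *(1) by (simp add: app_rearr)
    next
      case 2
      then show ?thesis using *(4)[of x] assms(2) *(1) by (auto simp: app_rearr)
    next
      case 3
      then show ?thesis
        using assms(2,4) PL_D(2)[OF assms(1), of x] *(1-3) piecewise_end[OF *(1) assms(2,2), of J x]
        by (simp add: app_rearr)
    qed
  qed
  ultimately show thesis using that * by blast
qed

section \<open>The compactly supported elements form a perfect group\<close>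

text \<open>
  The subgroup \<open>K\<close> contains all commutators, so the cosets of \<open>K\<close> behave like the elements of an
  abelian quotient of \<open>PLc c d\<close>. The relation \<open>x \<doteq> y\<close> below says that \<open>x\<close> and \<open>y\<close> have the same image in
  this quotient; the aim is that everything has the image of 1.
\<close>

locale abelian_image =
  fixes c d :: real and K :: "pl2 set"
  assumes cd: "c < d" and K: "is_subgroup K"
    and commutator_K: "x \<in> PLc c d \<Longrightarrow> y \<in> PLc c d \<Longrightarrow> commutator x y \<in> K"
begin

definition eqv :: "pl2 \<Rightarrow> pl2 \<Rightarrow> bool" (infix "\<doteq>" 50) where
  "x \<doteq> y \<longleftrightarrow> x \<in> PLc c d \<and> y \<in> PLc c d \<and> x * inverse y \<in> K"

lemma eqvD: "x \<doteq> y \<Longrightarrow> x \<in> PLc c d" "x \<doteq> y \<Longrightarrow> y \<in> PLc c d"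
  by (simp_all add: eqv_def)

lemma one_PLc [simp]: "1 \<in> PLc c d"
  using subgroup_one[OF is_subgroup_PLc] .

lemma mult_PLc [simp]: "x \<in> PLc c d \<Longrightarrow> y \<in> PLc c d \<Longrightarrow> x * y \<in> PLc c d"
  by (rule subgroup_mult[OF is_subgroup_PLc])

lemma inverse_PLc [simp]: "inverse x \<in> PLc c d \<longleftrightarrow> x \<in> PLc c d"
  by (rule subgroup_inverse_iff[OF is_subgroup_PLc])

lemma eqv_refl: "x \<in> PLc c d \<Longrightarrow> x \<doteq> x"
  using subgroup_one[OF K] by (simp add: eqv_def)

lemma eqv_sym: "x \<doteq> y \<Longrightarrow> y \<doteq> x"
  using subgroup_inverse[OF K, of "x * inverse y"] by (simp add: eqv_def)

lemma eqv_trans [trans]: "x \<doteq> y \<Longrightarrow> y \<doteq> z \<Longrightarrow> x \<doteq> z"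
  using subgroup_mult[OF K, of "x * inverse y" "y * inverse z"] by (simp add: eqv_def mult.assoc)

lemma conj_by_K:
  assumes "x \<in> PLc c d" "n \<in> PLc c d" "n \<in> K"
  shows "conj_by x n \<in> K"
proof -
  have "conj_by x n = commutator x n * n" by (simp add: conj_by_def commutator_def mult.assoc)
  then show ?thesis using assms commutator_K subgroup_mult[OF K] by simp
qed

lemma eqv_mult: "x \<doteq> x' \<Longrightarrow> y \<doteq> y' \<Longrightarrow> x * y \<doteq> x' * y'"
  using subgroup_mult[OF K, of "conj_by x (y * inverse y')" "x * inverse x'"]
    conj_by_K[of x "y * inverse y'"]
  by (simp add: eqv_def mult.assoc) (simp add: conj_by_def mult.assoc)

lemma eqv_inverse: "x \<doteq> y \<Longrightarrow> inverse x \<doteq> inverse y"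
  using conj_by_K[of "inverse x" "y * inverse x"] eqv_sym[of x y]
  by (simp add: eqv_def conj_by_def mult.assoc)

lemma eqv_cancel: "x * y \<doteq> x * z \<Longrightarrow> x \<in> PLc c d \<Longrightarrow> y \<doteq> z"
  using eqv_mult[OF eqv_refl[of "inverse x"], of "x * y" "x * z"] by simp

lemma eqv_one_iff: "x \<doteq> 1 \<longleftrightarrow> x \<in> PLc c d \<and> x \<in> K"
  by (simp add: eqv_def)

lemma eqv_conj_by: "k \<in> PLc c d \<Longrightarrow> x \<in> PLc c d \<Longrightarrow> conj_by k x \<doteq> x"
  using commutator_K[of k x] by (simp add: eqv_def commutator_def conj_by_def mult.assoc)

definition room :: "int \<Rightarrow> real \<Rightarrow> nat list \<Rightarrow> bool" where
  "room j a ms \<longleftrightarrow> a \<in> dyadic_rationals \<and> c < a \<and> a + seglen j ms < d"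

lemma room_wt: "room j a ms \<Longrightarrow> wt ms = wt ns \<Longrightarrow> room j a ns"
  using seglen_eq[of ms ns j] by (simp add: room_def)

lemma room_exists: "\<exists>j a. \<forall>ms. wt ms \<le> W \<longrightarrow> room j a ms"
proof -
  obtain a where a: "a \<in> dyadic_rationals" "c < a" "a < d" using dyadic_dense cd by blast
  obtain n where n: "(1/2) ^ n < (d - a) / (real W + 1)"
    using real_arch_pow_inv[of "(d - a) / (real W + 1)" "1/2"] a by auto
  have "a + seglen (- int n) ms < d" if "wt ms \<le> W" for ms
  proof -
    have "seglen (- int n) ms = (1/2) ^ n * real (wt ms)"
      by (simp add: seglen_def power_int_minus field_simps)
    also have "\<dots> \<le> (1/2) ^ n * (real W + 1)" using that by (intro mult_left_mono) auto
    also have "\<dots> < d - a" using n by (simp add: pos_less_divide_eq)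
    finally show ?thesis by simp
  qed
  then show ?thesis using a by (auto simp: room_def)
qed

lemma rearr_PLc: "room j a ms \<Longrightarrow> length ms = length ns \<Longrightarrow> wt ms = wt ns \<Longrightarrow> rearr j a ms ns \<in> PLc c d"
  using rearr_PL[of a ms ns j] by (auto simp: room_def intro: PLc_I)

text \<open>
  An affine map carries one rearrangement to the other. On the support it agrees with an element of
  \<open>PLc c d\<close>, and conjugation by such an element does not change the coset. So the coset of a
  rearrangement depends neither on its position nor on the unit of length.
\<close>

lemma rearr_indep:
  assumes "room j a ms" "room j' a' ms" "length ms = length ns" "wt ms = wt ns"
  shows "rearr j a ms ns \<doteq> rearr j' a' ms ns"
proof -
  define i where "i = j' - j"
  define t where "t = a' - 2 powi i * a"
  define b where "b = a + seglen j ms"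
  have dy: "a \<in> dyadic_rationals" "b \<in> dyadic_rationals" "t \<in> dyadic_rationals"
    using assms(1,2) unfolding room_def t_def b_def
    by (auto intro: dyadic_add dyadic_diff dyadic_mult dyadic_powi seglen_dyadic)
  have "2 powi i * seglen j ms = seglen j' ms"
    unfolding seglen_def i_def by (simp flip: power_int_add mult.assoc)
  then have ends: "app (affine_map i t) a = a'" "app (affine_map i t) b = a' + seglen j' ms"
    using dy by (simp_all add: t_def b_def distrib_left)
  obtain k where k: "k \<in> PLc c d" "\<And>x. a \<le> x \<Longrightarrow> x \<le> b \<Longrightarrow> app k x = app (affine_map i t) x"
    using extend_to_PLc[of a b c d "affine_map i t"] dy ends assms(1,2) seglen_nonneg[of j ms]
    by (auto simp: room_def b_def)
  have "conj_by k (rearr j a ms ns) = conj_by (affine_map i t) (rearr j a ms ns)"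
    using k(2) rearr_PL[OF dy(1) assms(3,4), of j] by (intro conj_by_agree[of _ a b]) (auto simp: b_def)
  also have "\<dots> = rearr j' a' ms ns"
    using rearr_scale[OF dy(1) assms(3) dy(3), of i j] by (simp add: i_def t_def)
  finally show ?thesis
    using eqv_sym[OF eqv_conj_by[OF k(1) rearr_PLc[OF assms(1,3,4)]]] by simp
qed

lemma swap_class_exists:
  "\<exists>s. \<forall>j a n. room j a [n + k, n] \<longrightarrow> rearr j a [n + k, n] [n, n + k] \<doteq> s"
proof -
  obtain j0 a0 where r: "room j0 a0 [k, 0]" using room_exists[of "wt [k, 0]"] by blast
  have "rearr j a [n + k, n] [n, n + k] \<doteq> rearr j0 a0 [k, 0] [0, k]" if "room j a [n + k, n]" for j a n
  proof -
    have "room (j + int n) a [k, 0]" using that by (simp add: room_def add.assoc)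
    moreover have "rearr j a [n + k, n] [n, n + k] = rearr (j + int n) a [k, 0] [0, k]"
      using that rearr_shift[of a "[k, 0]" "[0, k]" j n] by (simp add: room_def)
    ultimately show ?thesis using rearr_indep[of "j + int n" a "[k, 0]" j0 a0 "[0, k]"] r by simp
  qed
  then show ?thesis by blast
qed

text \<open>
  A representative of the coset of all maps that exchange the lengths of two adjacent intervals whose
  lengths have the ratio \<open>2\<^sup>k\<close>.
\<close>

definition swap_class :: "nat \<Rightarrow> pl2" where
  "swap_class k = (SOME s. \<forall>j a n. room j a [n + k, n] \<longrightarrow> rearr j a [n + k, n] [n, n + k] \<doteq> s)"

lemma rearr_swap_class: "room j a [n + k, n] \<Longrightarrow> rearr j a [n + k, n] [n, n + k] \<doteq> swap_class k"
  using someI_ex[OF swap_class_exists[of k]] unfolding swap_class_def by blast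

lemma rearr_swap:
  assumes "room j a (ps @ (n + k) # n # qs)"
  shows "rearr j a (ps @ (n + k) # n # qs) (ps @ n # (n + k) # qs) \<doteq> swap_class k"
proof -
  let ?a = "a + seglen j ps"
  have a: "a \<in> dyadic_rationals" "?a \<in> dyadic_rationals"
    using assms by (auto simp: room_def intro: dyadic_add seglen_dyadic)
  have "rearr j a (ps @ ([n + k, n] @ qs)) (ps @ ([n, n + k] @ qs)) = rearr j ?a ([n + k, n] @ qs) ([n, n + k] @ qs)"
    using a by (subst rearr_append) auto
  also have "\<dots> = rearr j ?a [n + k, n] [n, n + k]"
    using a by (subst rearr_append) (auto simp: dyadic_add dyadic_powi)
  finally have "rearr j a (ps @ (n + k) # n # qs) (ps @ n # (n + k) # qs) = rearr j ?a [n + k, n] [n, n + k]"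
    by simp
  moreover have "room j ?a [n + k, n]"
    using assms a seglen_nonneg[of j ps] seglen_nonneg[of j qs] by (auto simp: room_def)
  ultimately show ?thesis using rearr_swap_class by simp
qed

lemma rearr_step:
  assumes "rearr j a ms ns \<doteq> x" "rearr j a ns ps \<doteq> y" "a \<in> dyadic_rationals"
    "length ms = length ns" "length ns = length ps"
  shows "rearr j a ms ps \<doteq> y * x"
  using eqv_mult[OF assms(2,1)] rearr_comp[OF assms(3-5), of j] by simp

lemma rearr_rev:
  assumes "rearr j a ms ns \<doteq> x" "a \<in> dyadic_rationals" "length ms = length ns"
  shows "rearr j a ns ms \<doteq> inverse x"
proof -
  have "rearr j a ns ms = inverse (rearr j a ms ns)"
    using rearr_comp[OF assms(2,3), of ms j] assms by (metis inverse_unique inverse_inverse rearr_refl)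
  then show ?thesis using eqv_inverse[OF assms(1)] by simp
qed

lemma swap_class_PLc [simp]: "swap_class k \<in> PLc c d"
proof -
  obtain j a where "room j a [0 + k, 0]" using room_exists[of "wt [0 + k, 0]"] by blast
  then show ?thesis using rearr_swap_class eqvD by blast
qed

lemma swap_class_0: "swap_class 0 \<doteq> 1"
proof -
  obtain j a where r: "room j a [0 + 0, 0]" using room_exists[of "wt [0 + 0, 0]"] by blast
  then show ?thesis using rearr_swap_class[OF r] by (simp add: room_def eqv_sym)
qed

text \<open>
  Halving both pairs of corresponding intervals turns one swap into four swaps with the same ratio.
\<close>

lemma swap_class_fourth: "swap_class k \<doteq> swap_class k * (swap_class k * (swap_class k * swap_class k))"
proof -
  obtain j a where R: "\<And>ms. wt ms \<le> wt [Suc k, 1] \<Longrightarrow> room j a ms" using room_exists by blast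
  have a: "a \<in> dyadic_rationals" using R[of "[]"] by (simp add: room_def)
  have "rearr j a [Suc k, Suc 0] [Suc 0, Suc k] = rearr j a [k, k, Suc 0] [0, 0, Suc k]"
    using rearr_split[OF a, of "[]" "[]" "[Suc 0]" "[Suc k]"] by simp
  also have "\<dots> = rearr j a [k, k, 0, 0] [0, 0, k, k]"
    using rearr_split[OF a, of "[k, k]" "[0, 0]" "[]" "[]"] by simp
  finally have "rearr j a [k, k, 0, 0] [0, 0, k, k] \<doteq> swap_class k"
    using rearr_swap[of j a "[]" 1 k "[]"] R by simp
  then have "swap_class k \<doteq> rearr j a [k, k, 0, 0] [0, 0, k, k]" by (rule eqv_sym)
  also have "\<dots> \<doteq> swap_class k * (swap_class k * (swap_class k * swap_class k))"
  proof -
    have 1: "rearr j a [k, k, 0, 0] [k, 0, k, 0] \<doteq> swap_class k"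
      using rearr_swap[of j a "[k]" 0 k "[0]"] R by simp
    have 2: "rearr j a [k, 0, k, 0] [0, k, k, 0] \<doteq> swap_class k"
      using rearr_swap[of j a "[]" 0 k "[k, 0]"] R by simp
    have 3: "rearr j a [0, k, k, 0] [0, k, 0, k] \<doteq> swap_class k"
      using rearr_swap[of j a "[0, k]" 0 k "[]"] R by simp
    have 4: "rearr j a [0, k, 0, k] [0, 0, k, k] \<doteq> swap_class k"
      using rearr_swap[of j a "[0]" 0 k "[k]"] R by simp
    show ?thesis
      by (rule rearr_step[OF rearr_step[OF rearr_step[OF 1 2] 3] 4]) (simp_all add: a)
  qed
  finally show ?thesis .
qed

text \<open>
  Write \<open>X\<close> and \<open>Y\<close> for two lengths of ratio \<open>2\<^sup>k\<^sup>+\<^sup>1\<close>. Halving only the first pair of corresponding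
  intervals of the swap from \<open>(X, Y)\<close> to \<open>(Y, X)\<close> gives a map from \<open>(X/2, X/2, Y)\<close> to
  \<open>(Y/2, Y/2, X)\<close>. Halving only the second pair gives a map from \<open>(X, Y/2, Y/2)\<close> to
  \<open>(Y, X/2, X/2)\<close>. Both represent the same class. Sorting closes them to a cycle, in which \<open>X\<close> passes
  two intervals \<open>Y/2\<close> and \<open>Y\<close> passes two intervals \<open>X/2\<close>.
\<close>

lemma swap_class_square:
  "swap_class (k + 2) * swap_class (k + 2) \<doteq> swap_class (k + 1) * (inverse (swap_class k * swap_class k) * swap_class (k + 1))"
proof -
  obtain j a where R: "\<And>ms. wt ms \<le> wt [Suc (Suc k), 1] \<Longrightarrow> room j a ms" using room_exists by blast
  have a: "a \<in> dyadic_rationals" using R[of "[]"] by (simp add: room_def)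
  let ?k = "Suc k"
  have s: "rearr j a [Suc ?k, Suc 0] [Suc 0, Suc ?k] \<doteq> swap_class ?k"
    using rearr_swap[of j a "[]" 1 ?k "[]"] R by simp
  have 1: "rearr j a [?k, ?k, 1] [0, 0, Suc ?k] \<doteq> swap_class ?k"
    using s rearr_split[OF a, of "[]" "[]" "[Suc 0]" "[Suc ?k]"] by simp
  have 2: "rearr j a [Suc ?k, 0, 0] [1, ?k, ?k] \<doteq> swap_class ?k"
    using s rearr_split[OF a, of "[Suc ?k]" "[Suc 0]" "[]" "[]"] by simp
  have 4: "rearr j a [?k, ?k, 1] [?k, 1, ?k] \<doteq> swap_class k"
    using rearr_swap[of j a "[?k]" 1 k "[]"] R by simp
  have 5: "rearr j a [?k, 1, ?k] [1, ?k, ?k] \<doteq> swap_class k"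
    using rearr_swap[of j a "[]" 1 k "[?k]"] R by simp
  have 3: "rearr j a [1, ?k, ?k] [?k, ?k, 1] \<doteq> inverse (swap_class k * swap_class k)"
    by (rule rearr_rev[OF rearr_step[OF 4 5]]) (simp_all add: a)
  have 6: "rearr j a [Suc ?k, 0, 0] [0, Suc ?k, 0] \<doteq> swap_class (Suc ?k)"
    using rearr_swap[of j a "[]" 0 "Suc ?k" "[0]"] R by simp
  have 7: "rearr j a [0, Suc ?k, 0] [0, 0, Suc ?k] \<doteq> swap_class (Suc ?k)"
    using rearr_swap[of j a "[0]" 0 "Suc ?k" "[]"] R by simp
  have "rearr j a [Suc ?k, 0, 0] [0, 0, Suc ?k] \<doteq> swap_class (Suc ?k) * swap_class (Suc ?k)"
    by (rule rearr_step[OF 6 7]) (simp_all add: a)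
  moreover have "rearr j a [Suc ?k, 0, 0] [0, 0, Suc ?k] \<doteq>
      swap_class ?k * (inverse (swap_class k * swap_class k) * swap_class ?k)"
    by (rule rearr_step[OF rearr_step[OF 2 3] 1]) (simp_all add: a)
  ultimately have "swap_class (Suc ?k) * swap_class (Suc ?k) \<doteq> swap_class ?k * (inverse (swap_class k * swap_class k) * swap_class ?k)"
    using eqv_sym eqv_trans by blast
  then show ?thesis by simp
qed

text \<open>
  With \<open>x\<close> the map from \<open>(2, 1, 1)\<close> to \<open>(1, 1, 2)\<close>, written in exponents, the square of
  \<open>x\<close> goes from \<open>(2, 1, 0, 0)\<close> through \<open>(1, 1, 1, 1)\<close> to \<open>(0, 0, 1, 2)\<close>. The left-hand side
  counts it as two copies of \<open>x\<close>, each of them made of two swaps. The right-hand side sorts the four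
  intervals directly. This is the pentagon relation of associativity.
\<close>

lemma swap_class_pentagon:
  "swap_class 1 * swap_class 1 * (swap_class 1 * swap_class 1) \<doteq>
    swap_class 1 * (swap_class 1 * (swap_class 2 * (swap_class 2 * swap_class 1)))"
proof -
  obtain j a where R: "\<And>ms. wt ms \<le> 8 \<Longrightarrow> room j a ms" using room_exists by blast
  have a: "a \<in> dyadic_rationals" using R[of "[]"] by (simp add: room_def)
  have 3: "rearr j a [2, 1, 1] [1, 2, 1] \<doteq> swap_class 1"
    using rearr_swap[of j a "[]" 1 1 "[1]"] R by (simp add: numeral_2_eq_2)
  have 4: "rearr j a [1, 2, 1] [1, 1, 2] \<doteq> swap_class 1"
    using rearr_swap[of j a "[1]" 1 1 "[]"] R by (simp add: numeral_2_eq_2)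
  have x: "rearr j a [2, 1, 1] [1, 1, 2] \<doteq> swap_class 1 * swap_class 1"
    by (rule rearr_step[OF 3 4]) (simp_all add: a)
  have 1: "rearr j a [2, 1, 0, 0] [1, 1, 1, 1] \<doteq> swap_class 1 * swap_class 1"
    using x rearr_split[OF a, of "[2, 1]" "[1, 1]" "[]" "[]" j 0 1] by (simp add: numeral_2_eq_2)
  have 2: "rearr j a [1, 1, 1, 1] [0, 0, 1, 2] \<doteq> swap_class 1 * swap_class 1"
    using x rearr_split[OF a, of "[]" "[]" "[1, 1]" "[1, 2]" j 1 0] by (simp add: numeral_2_eq_2)
  have "rearr j a [2, 1, 0, 0] [0, 0, 1, 2] \<doteq> swap_class 1 * swap_class 1 * (swap_class 1 * swap_class 1)"
    by (rule rearr_step[OF 1 2]) (simp_all add: a)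
  moreover have "rearr j a [2, 1, 0, 0] [0, 0, 1, 2] \<doteq>
      swap_class 1 * (swap_class 1 * (swap_class 2 * (swap_class 2 * swap_class 1)))"
  proof -
    have 5: "rearr j a [2, 1, 0, 0] [1, 2, 0, 0] \<doteq> swap_class 1"
      using rearr_swap[of j a "[]" 1 1 "[0, 0]"] R by (simp add: numeral_2_eq_2)
    have 6: "rearr j a [1, 2, 0, 0] [1, 0, 2, 0] \<doteq> swap_class 2"
      using rearr_swap[of j a "[1]" 0 2 "[0]"] R by (simp add: numeral_2_eq_2)
    have 7: "rearr j a [1, 0, 2, 0] [1, 0, 0, 2] \<doteq> swap_class 2"
      using rearr_swap[of j a "[1, 0]" 0 2 "[]"] R by (simp add: numeral_2_eq_2)
    have 8: "rearr j a [1, 0, 0, 2] [0, 1, 0, 2] \<doteq> swap_class 1"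
      using rearr_swap[of j a "[]" 0 1 "[0, 2]"] R by (simp add: numeral_2_eq_2)
    have 9: "rearr j a [0, 1, 0, 2] [0, 0, 1, 2] \<doteq> swap_class 1"
      using rearr_swap[of j a "[0]" 0 1 "[2]"] R by (simp add: numeral_2_eq_2)
    show ?thesis
      by (rule rearr_step[OF rearr_step[OF rearr_step[OF rearr_step[OF 5 6] 7] 8] 9]) (simp_all add: a)
  qed
  ultimately show ?thesis using eqv_sym eqv_trans by blast
qed

lemma swap_class_1: "swap_class 1 \<doteq> 1"
proof -
  let ?s = "swap_class 1" and ?t = "swap_class 2"
  have "?s * (?s * (?s * ?s)) \<doteq> ?s * (?s * (?t * (?t * ?s)))"
    using swap_class_pentagon by (simp add: mult.assoc)
  from eqv_cancel[OF eqv_cancel[OF this]] have 1: "?s * ?s \<doteq> ?t * (?t * ?s)" by simp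
  have "?t * ?t \<doteq> ?s * (inverse (swap_class 0 * swap_class 0) * ?s)"
    using swap_class_square[of 0] by (simp add: numeral_2_eq_2)
  also have "\<dots> \<doteq> ?s * (inverse (1 * 1) * ?s)"
    by (intro eqv_mult eqv_inverse swap_class_0 eqv_refl) auto
  finally have "?t * ?t * ?s \<doteq> ?s * (inverse (1 * 1) * ?s) * ?s"
    by (rule eqv_mult[OF _ eqv_refl]) simp
  then have 2: "?t * (?t * ?s) \<doteq> ?s * (?s * ?s)" by (simp add: mult.assoc)
  have "?s * (?s * 1) \<doteq> ?s * (?s * ?s)" using eqv_trans[OF 1 2] by simp
  from eqv_cancel[OF eqv_cancel[OF this]] have "1 \<doteq> ?s" by simp
  then show ?thesis by (rule eqv_sym)
qed

text \<open>
  Write the quotient additively and \<open>\<sigma>\<^sub>k\<close> for the class of the swaps. The three relations say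
  \<open>\<sigma>\<^sub>k = 4 \<sigma>\<^sub>k\<close>, \<open>2 \<sigma>\<^sub>k\<^sub>+\<^sub>2 = 2 \<sigma>\<^sub>k\<^sub>+\<^sub>1 - 2 \<sigma>\<^sub>k\<close> and \<open>4 \<sigma>\<^sub>1 = 3 \<sigma>\<^sub>1 + 2 \<sigma>\<^sub>2\<close>. With \<open>\<sigma>\<^sub>0 = 0\<close> the last two
  give \<open>\<sigma>\<^sub>1 = 0\<close>, and inductively \<open>2 \<sigma>\<^sub>k = 0\<close> and \<open>3 \<sigma>\<^sub>k = 0\<close>.
\<close>

lemma swap_class_trivial: "swap_class k \<doteq> 1"
proof (induction k rule: induct_nat_012)
  case (ge2 n)
  let ?s = "swap_class (n + 2)"
  have "?s * ?s \<doteq> swap_class (n + 1) * (inverse (swap_class n * swap_class n) * swap_class (n + 1))"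
    by (rule swap_class_square)
  also have "\<dots> \<doteq> 1 * (inverse (1 * 1) * 1)"
    using ge2 by (intro eqv_mult eqv_inverse) auto
  finally have sq: "?s * ?s \<doteq> 1" by simp
  have "?s \<doteq> ?s * (?s * (?s * ?s))" by (rule swap_class_fourth)
  also have "?s * (?s * (?s * ?s)) \<doteq> 1 * 1"
    using eqv_mult[OF sq sq] by (simp add: mult.assoc)
  finally show ?case by (simp add: numeral_2_eq_2)
qed (use swap_class_0 swap_class_1 in auto)

lemma rearr_swap_trivial:
  assumes "room j a (ps @ m # n # qs)"
  shows "rearr j a (ps @ m # n # qs) (ps @ n # m # qs) \<doteq> 1"
proof (cases "n \<le> m")
  case True
  then have "m = n + (m - n)" by simp
  then show ?thesis using rearr_swap[of j a ps n "m - n" qs] assms swap_class_trivial eqv_trans by metis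
next
  case False
  then have n: "n = m + (n - m)" by simp
  have "room j a (ps @ n # m # qs)" using assms by (rule room_wt) simp
  then have "rearr j a (ps @ n # m # qs) (ps @ m # n # qs) \<doteq> 1"
    using rearr_swap[of j a ps m "n - m" qs] n swap_class_trivial eqv_trans by metis
  from rearr_rev[OF this] show ?thesis using assms by (simp add: room_def)
qed

lemma rearr_to_front:
  assumes "room j a (ps @ m # qs)"
  shows "rearr j a (ps @ m # qs) (m # ps @ qs) \<doteq> 1"
  using assms
proof (induction ps arbitrary: qs rule: rev_induct)
  case Nil
  then show ?case by (simp add: room_def eqv_refl)
next
  case (snoc p ps)
  have a: "a \<in> dyadic_rationals" using snoc.prems by (simp add: room_def)
  have "rearr j a (ps @ p # m # qs) (ps @ m # p # qs) \<doteq> 1"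
    using snoc.prems by (intro rearr_swap_trivial) simp
  moreover have "rearr j a (ps @ m # p # qs) (m # ps @ p # qs) \<doteq> 1"
    using room_wt[OF snoc.prems] by (intro snoc.IH) simp
  ultimately have "rearr j a (ps @ p # m # qs) (m # ps @ p # qs) \<doteq> 1 * 1"
    using a by (intro rearr_step[where ns = "ps @ m # p # qs"]) auto
  then show ?case by simp
qed

lemma length_le_wt: "length ms \<le> wt ms"
proof (induction ms)
  case (Cons m ms)
  have "(1::nat) \<le> 2 ^ m" by simp
  then show ?case using Cons.IH by (simp only: wt_simps list.size)
qed simp

lemma wt_eq_length: "wt ms = length ms \<Longrightarrow> ms = replicate (length ms) 0"
proof (induction ms)
  case (Cons m ms)
  have "(1::nat) \<le> 2 ^ m" by simp
  moreover have "2 ^ m + wt ms = length ms + 1" using Cons.prems by simp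
  ultimately have "wt ms = length ms" "(2::nat) ^ m = 1" using length_le_wt[of ms] by linarith+
  then show ?case using Cons.IH by simp
qed simp

lemma large_entry:
  assumes "wt ms \<noteq> length ms"
  obtains ps m qs where "ms = ps @ Suc m # qs"
proof -
  have "\<exists>x\<in>set ms. x \<noteq> 0"
  proof (rule ccontr)
    assume "\<not> ?thesis"
    then have "wt ms = length ms" by (induction ms) auto
    then show False using assms by simp
  qed
  then obtain x where "x \<in> set ms" "x \<noteq> 0" by blast
  then show thesis using that by (metis in_set_conv_decomp not0_implies_Suc)
qed

text \<open>
  Swaps being trivial, the intervals of both sequences may be permuted independently of each other.
  If some interval is longer than the unit, then both sequences have such an interval, since their
  total lengths and their numbers of intervals agree. Move one in each sequence to the front and halve
  this pair. The process ends when all intervals have unit length, simultaneously in both sequences,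
  and then the map is the identity.
\<close>

lemma rearr_trivial:
  assumes "room j a ms" "length ms = length ns" "wt ms = wt ns"
  shows "rearr j a ms ns \<doteq> 1"
  using assms
proof (induction "wt ms - length ms" arbitrary: ms ns rule: less_induct)
  case less
  have a: "a \<in> dyadic_rationals" using less.prems by (simp add: room_def)
  show ?case
  proof (cases "wt ms = length ms")
    case True
    then have "ms = ns" using wt_eq_length[of ms] wt_eq_length[of ns] less.prems by metis
    then show ?thesis using a by (simp add: eqv_refl)
  next
    case False
    then obtain ps m qs where ms: "ms = ps @ Suc m # qs" by (rule large_entry)
    obtain ps' n qs' where ns: "ns = ps' @ Suc n # qs'"
      using False less.prems large_entry[of ns] by metis
    have 1: "rearr j a ms (Suc m # ps @ qs) \<doteq> 1"
      using less.prems(1) unfolding ms by (rule rearr_to_front)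
    have "rearr j a ns (Suc n # ps' @ qs') \<doteq> 1"
      using room_wt[OF less.prems(1,3)] unfolding ns by (rule rearr_to_front)
    from rearr_rev[OF this a] have 3: "rearr j a (Suc n # ps' @ qs') ns \<doteq> 1" by (simp add: ns)
    have "rearr j a (Suc m # ps @ qs) (Suc n # ps' @ qs') =
        rearr j a (m # m # ps @ qs) (n # n # ps' @ qs')"
      using rearr_split[OF a, of "[]" "[]" "ps @ qs" "ps' @ qs'" j m n] less.prems ms ns by simp
    also have "\<dots> \<doteq> 1"
    proof (rule less.hyps)
      show "wt (m # m # ps @ qs) - length (m # m # ps @ qs) < wt ms - length ms"
        using False length_le_wt[of ms] by (simp add: ms)
      show "room j a (m # m # ps @ qs)" using less.prems(1) by (rule room_wt) (simp add: ms)
    qed (use less.prems ms ns in auto)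
    finally have 2: "rearr j a (Suc m # ps @ qs) (Suc n # ps' @ qs') \<doteq> 1" .
    have "rearr j a ms ns \<doteq> 1 * (1 * 1)"
      by (rule rearr_step[OF rearr_step[OF 1 2] 3]) (use less.prems ms ns a in auto)
    then show ?thesis by simp
  qed
qed

text \<open>
  With the commutator subgroup for \<open>K\<close>, this is the perfectness of \<open>PLc c d\<close>.
\<close>

theorem PLc_subset_K: "PLc c d \<subseteq> K"
proof
  fix h assume "h \<in> PLc c d"
  then obtain a b where ab: "a \<in> dyadic_rationals" "b \<in> dyadic_rationals" "c < a" "b < d" "a < b" "h \<in> PL a b"
    using PLc_dyadicE[of h c d d c] cd by blast
  obtain j ms ns where "length ms = length ns" "wt ms = wt ns" "a + seglen j ms = b" "h = rearr j a ms ns"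
    by (rule rearr_exists[OF ab(6,1,2,5)])
  then show "h \<in> K" using rearr_trivial[of j a ms ns] ab by (simp add: room_def eqv_one_iff)
qed

end

section \<open>Simplicity\<close>

text \<open>
  Higman's argument. If \<open>m\<close> moves an interval \<open>(u, v)\<close> off itself and \<open>y, z\<close> are supported in \<open>(u, v)\<close>,
  then the commutator of \<open>z\<close> with the commutator of \<open>y\<close> and \<open>m\<close> lies in \<open>M\<close> and equals the commutator
  of \<open>z\<close> and \<open>y\<close>. Any two elements of \<open>PLc c d\<close> can be conjugated into \<open>(u, v)\<close> together, so \<open>M\<close>
  contains all commutators.
\<close>

lemma PLc_simple:
  assumes "c < d" "is_subgroup M" "\<And>x y. x \<in> PLc c d \<Longrightarrow> y \<in> M \<Longrightarrow> conj_by x y \<in> M"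
    "m \<in> M" "c < w" "w < d" "app m w \<noteq> w"
  shows "PLc c d \<subseteq> M"
proof -
  obtain m where m: "m \<in> M" "w < app m w"
  proof (cases "w < app m w")
    case False
    then have "w < app (inverse m) w" using assms(7) by (simp add: app_inverse_less_iff)
    then show ?thesis using that subgroup_inverse[OF assms(2,4)] by blast
  qed (use assms(4) in blast)
  obtain v where v: "v \<in> dyadic_rationals" "w < v" "v < min (app m w) d"
    using dyadic_dense[of w "min (app m w) d"] m assms by auto
  obtain u where u: "u \<in> dyadic_rationals" "w < u" "u < v" using dyadic_dense v by blast
  have vmu: "v \<le> app m u" using u v app_less_iff[of m w u] by linarith
  have uv: "commutator y z \<in> M" if y: "y \<in> PL u v" and z: "z \<in> PL u v" for y z
  proof -
    have PLc: "y \<in> PLc c d" "z \<in> PLc c d" using y z u v assms by (auto intro: PLc_I)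
    have M: "commutator x n \<in> M" if "n \<in> M" "x \<in> PLc c d" for x n
      using subgroup_mult[OF assms(2) assms(3)[OF that(2,1)] subgroup_inverse[OF assms(2) that(1)]]
      by (simp add: conj_by_def commutator_def)
    define t where "t = conj_by m (inverse y)"
    have t: "t \<in> PL (app m u) (app m v)"
      unfolding t_def using y by (intro PL_conj_by subgroup_inverse[OF is_subgroup_PL])
    have com: "commute z t" by (rule commute_disjoint[OF z t vmu])
    have e: "commutator y m = y * t"
      by (simp add: t_def conj_by_def commutator_def mult.assoc)
    have "commutator z (commutator y m) \<in> M" using M m PLc by blast
    \<comment> \<open>the conjugate \<open>t\<close> of \<open>y\<^sup>-\<^sup>1\<close> by \<open>m\<close> is supported in \<open>m (u, v)\<close>, which \<open>z\<close> fixes pointwise\<close>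
    also have "commutator z (commutator y m) = conj_by z y * conj_by z t * inverse (y * t)"
      unfolding e by (simp add: commutator_def conj_by_def mult.assoc)
    also have "\<dots> = conj_by z y * inverse y"
      using commute_conj_by[OF com] by (simp add: mult.assoc)
    also have "\<dots> = commutator z y" by (simp add: conj_by_def commutator_def)
    finally show ?thesis using subgroup_inverse[OF assms(2)] inverse_commutator by metis
  qed
  interpret abelian_image c d M
  proof
    fix x y assume x: "x \<in> PLc c d" and y: "y \<in> PLc c d"
    obtain a b where ab: "c < a" "b < d" "x \<in> PL a b"
      using x unfolding PLc_def by blast
    obtain a' b' where ab': "a' \<in> dyadic_rationals" "b' \<in> dyadic_rationals" "c < a'" "a' < a" "b < b'" "b' < d"
      "a' < b'" "y \<in> PL a' b'"
      by (rule PLc_dyadicE[OF y, of a b]) (use ab assms in auto)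
    have x': "x \<in> PL a' b'" using ab ab' by (auto elim: PL_mono)
    obtain k where k: "k \<in> PLc c d" "app k a' = u" "app k b' = v"
      using PLc_transitive[of a' b' u v c d] ab' u v assms by auto
    have "commutator (conj_by k x) (conj_by k y) \<in> M"
      using uv PL_conj_by[OF x', of k] PL_conj_by[OF ab'(8), of k] k by simp
    then have "conj_by k (commutator x y) \<in> M" by (simp add: conj_by_commutator)
    from assms(3)[OF _ this, of "inverse k"] show "commutator x y \<in> M"
      using subgroup_inverse[OF is_subgroup_PLc k(1)] by simp
  qed (use assms in auto)
  show ?thesis by (rule PLc_subset_K)
qed

section \<open>Isolating a commutator in a product\<close>

lemma commutator_product:
  fixes a b a' b' :: "'a :: mult_group"
  assumes "commute b a" "commute b a'" "commute b' a" "commute b' a'"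
  shows "commutator (b * a) (b' * a') = commutator b b' * commutator a a'"
proof -
  have 1: "conj_by (b * a) (b' * a') = conj_by b b' * conj_by a a'"
    using assms
    by (simp add: conj_by_mult commute_conj_by commute_sym flip: conj_by_conj_by)
      (metis assms(2,4) commute_conj_by commute_conj_by_iff commute_sym conj_by_conj_by)
  have "commute b' (conj_by a a')"
    using assms(3,4) commute_conj_by_iff[of a b' a'] commute_conj_by[OF commute_sym[OF assms(3)]] by simp
  then have 2: "commute (inverse b') (conj_by a a')" by (rule commute_inverse_left)
  have "commutator (b * a) (b' * a') = conj_by (b * a) (b' * a') * inverse (b' * a')"
    by (simp add: commutator_def conj_by_def)
  also have "\<dots> = conj_by b b' * (conj_by a a' * inverse (b' * a'))"
    unfolding 1 by (simp only: mult.assoc)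
  also have "inverse (b' * a') = inverse b' * inverse a'"
    using assms(4) by (metis commute_def inverse_mult)
  also have "conj_by a a' * (inverse b' * inverse a') = inverse b' * (conj_by a a' * inverse a')"
    using 2 by (metis commute_def mult.assoc)
  finally show ?thesis by (simp add: commutator_def conj_by_def mult.assoc)
qed

lemma commute_prod_list:
  assumes "\<And>x. x \<in> set xs \<Longrightarrow> commute z x"
  shows "commute z (prod_list xs)"
  using assms by (induction xs) (auto intro: commute_mult_right)

lemma prod_list_extract:
  assumes "i < K" "\<And>j. j < K \<Longrightarrow> j \<noteq> i \<Longrightarrow> commute (w i) (w j)"
  obtains s' where "prod_list (map w [0..<K]) = w i * (s' :: 'a :: mult_group)"
    "\<And>z. (\<And>j. j < K \<Longrightarrow> j \<noteq> i \<Longrightarrow> commute z (w j)) \<Longrightarrow> commute z s'"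
proof -
  obtain k where "K = i + Suc k" using less_imp_Suc_add[OF assms(1)] by auto
  then have "[0..<K] = [0..<i] @ i # [Suc i..<K]"
    using upt_add_eq_append[of 0 i "Suc k"] upt_conv_Cons[of i K] by simp
  then have eq: "prod_list (map w [0..<K]) =
      prod_list (map w [0..<i]) * w i * prod_list (map w [Suc i..<K])"
    by (simp add: mult.assoc)
  have com: "commute z (prod_list (map w [0..<i]))" "commute z (prod_list (map w [Suc i..<K]))"
    if "\<And>j. j < K \<Longrightarrow> j \<noteq> i \<Longrightarrow> commute z (w j)" for z
    using assms(1) that by (auto intro!: commute_prod_list)
  show thesis
  proof (rule that)
    show "prod_list (map w [0..<K]) = w i * (prod_list (map w [0..<i]) * prod_list (map w [Suc i..<K]))"
      unfolding eq using com(1)[of "w i"] assms(2) by (simp add: commute_def flip: mult.assoc)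
  qed (use com in \<open>auto intro: commute_mult_right\<close>)
qed

lemma conj_by_prod_list: "conj_by z (prod_list xs) = prod_list (map (conj_by z) xs)"
  by (induction xs) (simp_all add: conj_by_mult)

text \<open>
  The powers of four form a Sidon set: a difference of two distinct ones determines both.
\<close>

lemma power4_sidon:
  fixes a b c d :: nat
  assumes "(4::int) ^ a + 4 ^ b = 4 ^ c + 4 ^ d"
  shows "(a = c \<and> b = d) \<or> (a = d \<and> b = c)"
proof -
  have key: "b = d \<and> a = c" if le: "a \<le> b" "c \<le> d" and eq: "(4::int) ^ a + 4 ^ b = 4 ^ c + 4 ^ d"
    for a b c d :: nat
  proof -
    have aux: "\<not> b < d" if "a \<le> b" "(4::int) ^ a + 4 ^ b = 4 ^ c + 4 ^ d" for a b c d :: nat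
    proof
      assume "b < d"
      have "(4::int) ^ a \<le> 4 ^ b" using that by (intro power_increasing) auto
      moreover have "(4::int) ^ Suc b \<le> 4 ^ d" using \<open>b < d\<close> by (intro power_increasing) auto
      moreover have "(0::int) < 4 ^ c" "(0::int) < 4 ^ b" by auto
      ultimately show False using that(2) unfolding power_Suc by linarith
    qed
    have "b = d" using aux[OF le(1) eq] aux[OF le(2) eq[symmetric]] by simp
    then show ?thesis using eq by simp
  qed
  show ?thesis
  proof (cases "a \<le> b"; cases "c \<le> d")
    assume "a \<le> b" "c \<le> d" then show ?thesis using key[of a b c d] assms by auto
  next
    assume "a \<le> b" "\<not> c \<le> d" then show ?thesis using key[of a b d c] assms by auto
  next
    assume "\<not> a \<le> b" "c \<le> d" then show ?thesis using key[of b a c d] assms by auto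
  next
    assume "\<not> a \<le> b" "\<not> c \<le> d" then show ?thesis using key[of b a d c] assms by auto
  qed
qed

lemma power4_difference:
  fixes E c :: int
  assumes "0 < c" "3 * c \<le> E"
  shows "i' \<noteq> i \<or> j' \<noteq> j \<Longrightarrow> i \<noteq> j \<Longrightarrow> c \<le> \<bar>E * 4 ^ j - E * 4 ^ i - (E * 4 ^ j' - E * 4 ^ i')\<bar>"
    and "c \<le> \<bar>E * z + c\<bar>"
    and "i \<noteq> j \<Longrightarrow> c \<le> \<bar>E * 4 ^ i - E * 4 ^ j\<bar>"
proof -
  have big: "c \<le> \<bar>E * z\<bar>" if "z \<noteq> 0" for z
  proof -
    have "c * 1 \<le> \<bar>E\<bar> * \<bar>z\<bar>" using that assms by (intro mult_mono) auto
    then show ?thesis by (simp add: abs_mult)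
  qed
  show "c \<le> \<bar>E * 4 ^ j - E * 4 ^ i - (E * 4 ^ j' - E * 4 ^ i')\<bar>" if "i' \<noteq> i \<or> j' \<noteq> j" "i \<noteq> j"
  proof -
    have "(4::int) ^ j - 4 ^ i - (4 ^ j' - 4 ^ i') \<noteq> 0"
      using power4_sidon[of j i' j' i] that by auto
    from big[OF this] show ?thesis by (simp add: algebra_simps)
  qed
  show "c \<le> \<bar>E * 4 ^ i - E * 4 ^ j\<bar>" if "i \<noteq> j"
    using big[of "4 ^ i - 4 ^ j"] that by (simp add: right_diff_distrib)
  show "c \<le> \<bar>E * z + c\<bar>"
  proof -
    consider "z = 0" | "1 \<le> z" | "z \<le> -1" by linarith
    then show ?thesis
    proof cases
      case 2
      then have "0 \<le> E * z" using assms by simp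
      then show ?thesis using assms by simp
    next
      case 3
      then have "E * z \<le> E * (-1)" using assms by (intro mult_left_mono) auto
      then show ?thesis using assms by linarith
    qed (use assms in simp)
  qed
qed

text \<open>
  The elements \<open>e i\<close> behave like elements with compact support in an interval that \<open>f\<close> translates: they
  commute with translates of each other by a distance of at least \<open>c\<close>. The element \<open>r\<close> behaves like an element
  supported to the right of all positions that occur, except for \<open>r_far\<close>. That hypothesis says
  that the words used to isolate commutators are trivial on \<open>r\<close>. The \<open>i\<close>-th factor is put at
  position \<open>- P - E * 4 ^ i\<close>; the offset \<open>P\<close> keeps all factors away from \<open>r\<close> under the shifts that are
  needed, which are bounded by \<open>E * 4 ^ K\<close>.
\<close>

locale isolation =
  fixes f r :: "'a :: mult_group" and e :: "nat \<Rightarrow> 'a" and K :: nat and c E P :: int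
  assumes c: "0 < c" "3 * c \<le> E"
    and e_far: "\<And>i j k. i < K \<Longrightarrow> j < K \<Longrightarrow> c \<le> \<bar>k\<bar> \<Longrightarrow> commute (e i) (conj_by (f powi k) (e j))"
    and r_e: "\<And>i x y. i < K \<Longrightarrow> 0 \<le> x \<Longrightarrow> x \<le> E * 4 ^ K \<Longrightarrow> 0 \<le> y \<Longrightarrow> y \<le> E * 4 ^ K \<Longrightarrow>
      commute (conj_by (f powi y) r) (conj_by (f powi (x - P - E * 4 ^ i)) (e i))"
    and r_far: "\<And>m. E \<le> m \<Longrightarrow> commute
      (conj_by (f powi m) (inverse r * conj_by (f powi c) r))
      (conj_by r (conj_by (f powi m) (inverse r * conj_by (f powi c) r)))"
begin

text \<open>
  The \<open>i\<close>-th factor of the product, after a shift by \<open>m\<close>.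
\<close>

definition spread :: "int \<Rightarrow> nat \<Rightarrow> 'a" where
  "spread m i = conj_by (f powi (m - P - E * 4 ^ i)) (e i)"

definition packed :: 'a where
  "packed = prod_list (map (spread 0) [0..<K])"

lemma conj_by_spread: "conj_by (f powi m) (spread n i) = spread (m + n) i"
  by (simp add: spread_def conj_by_conj_by algebra_simps flip: mult_group_power_int_add)

lemma conj_by_packed: "conj_by (f powi m) packed = prod_list (map (spread m) [0..<K])"
  by (simp add: packed_def conj_by_prod_list conj_by_spread comp_def)

lemma commute_spread:
  assumes "i < K" "j < K" "c \<le> \<bar>m - E * 4 ^ i - (n - E * 4 ^ j)\<bar>"
  shows "commute (spread m i) (spread n j)"
proof -
  let ?k = "m - P - E * 4 ^ i" and ?l = "n - P - E * 4 ^ j"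
  have "commute (conj_by (f powi ?k) (e i)) (conj_by (f powi ?k) (conj_by (f powi (?l - ?k)) (e j)))"
    using assms by (simp add: e_far)
  moreover have "conj_by (f powi ?k) (conj_by (f powi (?l - ?k)) (e j)) = conj_by (f powi ?l) (e j)"
    unfolding conj_by_conj_by mult_group_power_int_add[symmetric] by (simp add: algebra_simps)
  ultimately show ?thesis unfolding spread_def by (simp only:)
qed

text \<open>
  The shift \<open>m\<close> puts the \<open>j\<close>-th factor \<open>u\<close> of the shifted product on top of the \<open>i\<close>-th factor \<open>t\<close> of the
  unshifted one. By the Sidon property all other factors that could interact are at distance at
  least \<open>c\<close>. So \<open>A\<close> is \<open>u\<^sup>-\<^sup>1\<close> up to a factor \<open>b\<close> that commutes with everything in sight, and conjugation by
  the whole product acts on \<open>u\<close> like conjugation by \<open>t\<close>.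
\<close>

lemma isolate_packed:
  assumes "i < j" "j < K"
  defines "m \<equiv> E * 4 ^ j - E * 4 ^ i"
  defines "A \<equiv> conj_by (f powi m) (inverse packed * conj_by (f powi c) packed)"
  shows "commutator A (conj_by packed A) =
    conj_by (f powi (- P - E * 4 ^ i)) (commutator (inverse (e j)) (conj_by (e i) (inverse (e j))))"
proof -

  define t where "t = spread 0 i"
  define u where "u = spread m j"
  have ij: "i < K" "i \<noteq> j" using assms by auto
  obtain s' where s': "packed = t * s'"
    "\<And>z. (\<And>i'. i' < K \<Longrightarrow> i' \<noteq> i \<Longrightarrow> commute z (spread 0 i')) \<Longrightarrow> commute z s'"
    unfolding packed_def t_def
  proof (rule prod_list_extract[of i K "spread 0"])
    show "commute (spread 0 i) (spread 0 j')" if "j' < K" "j' \<noteq> i" for j'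
      using that ij power4_difference(3)[OF c, of j' i] by (intro commute_spread) auto
  qed (use ij in auto)
  obtain v where v: "conj_by (f powi m) packed = u * v"
    "\<And>z. (\<And>j'. j' < K \<Longrightarrow> j' \<noteq> j \<Longrightarrow> commute z (spread m j')) \<Longrightarrow> commute z v"
    unfolding conj_by_packed u_def
  proof (rule prod_list_extract[of j K "spread m"])
    show "commute (spread m j) (spread m j')" if "j' < K" "j' \<noteq> j" for j'
      using that assms power4_difference(3)[OF c, of j' j] by (intro commute_spread) auto
  qed (use assms in auto)
  define w where "w = conj_by (f powi (m + c)) packed"
  have w: "commute z w" if "\<And>j'. j' < K \<Longrightarrow> commute z (spread (m + c) j')" for z
    unfolding w_def conj_by_packed using that by (intro commute_prod_list) auto
  have packed: "commute z packed" if "\<And>i'. i' < K \<Longrightarrow> commute z (spread 0 i')" for z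
    unfolding packed_def using that by (intro commute_prod_list) auto
  define b where "b = inverse v * w"
  have s'u: "commute u s'"
    unfolding u_def
  proof (intro s'(2) commute_spread)
    fix i' assume "i' < K" "i' \<noteq> i"
    then show "c \<le> \<bar>m - E * 4 ^ j - (0 - E * 4 ^ i')\<bar>"
      using power4_difference(3)[OF c, of i' i] by (simp add: m_def)
  qed (use assms in auto)
  have uv: "commute u v"
    unfolding u_def using assms power4_difference(3)[OF c, of _ j]
    by (intro v(2) commute_spread) auto
  have "commute u w"
    unfolding u_def
  proof (intro w commute_spread)
    fix j'
    show "c \<le> \<bar>m - E * 4 ^ j - (m + c - E * 4 ^ j')\<bar>"
      using power4_difference(2)[OF c, of "4 ^ j - 4 ^ j'"]
        abs_minus_cancel[of "E * (4 ^ j - 4 ^ j') + c"] by (simp add: algebra_simps)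
  qed (use assms in auto)
  then have ub: "commute u b"
    unfolding b_def using uv by (intro commute_mult_right commute_inverse_right)
  have "commute packed v"
  proof (rule v(2))
    fix j' assume j': "j' < K" "j' \<noteq> j"
    have "commute (spread m j') packed"
    proof (intro packed commute_spread j')
      fix i'
      show "c \<le> \<bar>m - E * 4 ^ j' - (0 - E * 4 ^ i')\<bar>"
        using power4_difference(1)[OF c, of i' i j' j] j' ij by (simp add: m_def algebra_simps)
    qed
    then show "commute packed (spread m j')" by (rule commute_sym)
  qed
  moreover have "commute packed w"
  proof (rule w)
    fix j' assume j': "j' < K"
    have "commute (spread (m + c) j') packed"
    proof (intro packed commute_spread j')
      fix i'
      show "c \<le> \<bar>m + c - E * 4 ^ j' - (0 - E * 4 ^ i')\<bar>"
        using power4_difference(2)[OF c, of "4 ^ j - 4 ^ i - 4 ^ j' + 4 ^ i'"]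
        by (simp add: m_def algebra_simps)
    qed
    then show "commute packed (spread (m + c) j')" by (rule commute_sym)
  qed
  ultimately have pb: "commute packed b"
    unfolding b_def by (intro commute_mult_right commute_inverse_right)
  have "A = inverse (u * v) * w"
    unfolding A_def w_def
    by (simp only: conj_by_mult conj_by_inverse conj_by_conj_by v(1) mult_group_power_int_add)
  also have "\<dots> = inverse u * b"
    unfolding b_def using commute_inverse_left[OF commute_inverse_right[OF uv]]
    by (simp add: commute_def flip: mult.assoc)
  finally have A: "A = inverse u * b" .
  have "conj_by packed u = conj_by t u"
    unfolding s'(1) using commute_conj_by[OF commute_sym[OF s'u]] by (simp flip: conj_by_conj_by)
  then have pA: "conj_by packed A = inverse (conj_by t u) * b"
    unfolding A using commute_conj_by[OF pb] by (simp add: conj_by_mult conj_by_inverse)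
  have "commute (conj_by packed u) (conj_by packed b)" using ub by simp
  then have tub: "commute (conj_by t u) b"
    using commute_conj_by[OF pb] \<open>conj_by packed u = conj_by t u\<close> by simp
  have "commutator A (conj_by packed A) = commutator (inverse u) (inverse (conj_by t u)) * commutator b b"
    unfolding pA unfolding A using ub tub by (intro commutator_product commute_inverse_left)
  also have "commutator b b = 1" by (simp add: commutator_eq_one_iff)
  finally have "commutator A (conj_by packed A) = commutator (inverse u) (conj_by t (inverse u))"
    by (simp add: conj_by_inverse)
  moreover have "u = conj_by (f powi (- P - E * 4 ^ i)) (e j)"
    unfolding u_def spread_def m_def by (simp add: algebra_simps)
  moreover have "t = conj_by (f powi (- P - E * 4 ^ i)) (e i)"
    unfolding t_def spread_def by simp
  moreover have "conj_by (conj_by x y) (conj_by x z) = conj_by x (conj_by y z)" for x y z :: 'a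
    by (simp add: conj_by_def mult.assoc)
  ultimately show ?thesis
    by (simp add: conj_by_commutator flip: conj_by_inverse)
qed

text \<open>
  Since \<open>r\<close> commutes with all translates of \<open>packed\<close> that occur, the word evaluated at \<open>r * packed\<close> is the
  product of its values at \<open>r\<close> and at \<open>packed\<close>, and the first value is 1.
\<close>

lemma isolate:
  assumes "i < j" "j < K"
  shows "commutator (inverse (e j)) (conj_by (e i) (inverse (e j))) \<in> gen {f, r * packed}"
proof -
  let ?H = "gen {f, r * packed}"
  define m where "m = E * 4 ^ j - E * 4 ^ i"
  define A where "A g = conj_by (f powi m) (inverse g * conj_by (f powi c) g)" for g
  have H: "is_subgroup ?H" "f \<in> ?H" "r * packed \<in> ?H"
    by (auto intro: is_subgroup_gen gen_base)
  have "4 ^ j - 4 ^ i \<ge> (1::int)"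
    using power_strict_increasing[OF assms(1), of "4::int"] by linarith
  then have "E * 1 \<le> E * (4 ^ j - 4 ^ i)" using c by (intro mult_left_mono) auto
  then have mE: "E \<le> m" by (simp add: m_def right_diff_distrib)
  have "(4::int) ^ Suc j \<le> 4 ^ K" using assms by (intro power_increasing) auto
  moreover have "1 \<le> (4::int) ^ j" "0 < (4::int) ^ i" by auto
  ultimately have "4 ^ j - 4 ^ i + 1 \<le> (4::int) ^ K" unfolding power_Suc by linarith
  then have "E * (4 ^ j - 4 ^ i + 1) \<le> E * 4 ^ K" using c by (intro mult_left_mono) auto
  moreover have "E * (4 ^ j - 4 ^ i + 1) = m + E" by (simp add: m_def algebra_simps)
  ultimately have mK: "m + c \<le> E * 4 ^ K" using c by linarith
  have rp: "commute (conj_by (f powi y) r) (conj_by (f powi x) packed)"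
    if "x \<in> {0, m, m + c}" "y \<in> {0, m, m + c}" for x y
    unfolding conj_by_packed
  proof (rule commute_prod_list)
    have "0 \<le> z \<and> z \<le> E * 4 ^ K" if "z \<in> {0, m, m + c}" for z
      using that
    proof (elim insertE emptyE)
      show "0 \<le> z \<and> z \<le> E * 4 ^ K" if "z = 0" unfolding that using mE mK c by linarith
      show "0 \<le> z \<and> z \<le> E * 4 ^ K" if "z = m" unfolding that using mE mK c by linarith
      show "0 \<le> z \<and> z \<le> E * 4 ^ K" if "z = m + c" unfolding that using mE mK c by linarith
    qed
    from this[OF that(1)] this[OF that(2)]
    have xy: "0 \<le> x" "x \<le> E * 4 ^ K" "0 \<le> y" "y \<le> E * 4 ^ K" by blast+
    fix z assume "z \<in> set (map (spread x) [0..<K])"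
    then obtain i' where "i' < K" "z = spread x i'" by auto
    then show "commute (conj_by (f powi y) r) z"
      unfolding spread_def using r_e[OF _ xy, of i'] by simp
  qed
  have pw: "conj_by (f powi m) (conj_by (f powi c) g) = conj_by (f powi (m + c)) g" for g
    by (simp add: conj_by_conj_by mult_group_power_int_add)
  have f0: "conj_by (f powi 0) g = g" for g by (simp add: power_int_def)
  have A: "A g = inverse (conj_by (f powi m) g) * conj_by (f powi (m + c)) g" for g
    unfolding A_def by (simp add: conj_by_mult conj_by_inverse pw)
  have rA: "commute (A r) (conj_by (f powi x) packed)" if "x \<in> {0, m, m + c}" for x
    unfolding A using rp that by (intro commute_mult_left commute_inverse_left) auto
  have Ap: "commute (conj_by (f powi y) r) (A packed)" if "y \<in> {0, m, m + c}" for y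
    unfolding A using rp that by (intro commute_mult_right commute_inverse_right) auto
  have AA: "commute (A r) (A packed)"
    unfolding A[of packed] using rA by (intro commute_mult_right commute_inverse_right) auto
  have r_packed: "commute r packed" "commute (A r) packed" "commute r (A packed)"
    using rp[of 0 0] rA[of 0] Ap[of 0] by (simp_all add: f0)
  let ?r = "conj_by (f powi m) r" and ?p = "conj_by (f powi m) packed"
  let ?r' = "conj_by (f powi (m + c)) r" and ?p' = "conj_by (f powi (m + c)) packed"
  have "A (r * packed) = inverse ?p * (inverse ?r * ?r') * ?p'"
    by (simp add: A conj_by_mult mult.assoc)
  also have "commute (inverse ?p) (inverse ?r * ?r')"
    using rp by (intro commute_mult_right commute_inverse_right commute_inverse_left commute_sym[OF rp]) auto
  then have "inverse ?p * (inverse ?r * ?r') * ?p' = A r * A packed"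
    by (simp add: A commute_def mult.assoc)
  finally have Ag: "A (r * packed) = A r * A packed" .
  have "conj_by (r * packed) (A r * A packed) =
      conj_by r (conj_by packed (A r)) * conj_by r (conj_by packed (A packed))"
    by (simp add: conj_by_mult conj_by_conj_by)
  also have "conj_by packed (A r) = A r"
    by (rule commute_conj_by[OF commute_sym[OF r_packed(2)]])
  also have "conj_by r (conj_by packed (A packed)) = conj_by packed (conj_by r (A packed))"
    using r_packed(1) by (simp add: conj_by_conj_by commute_def)
  also have "conj_by r (A packed) = A packed" by (rule commute_conj_by[OF r_packed(3)])
  finally have conj: "conj_by (r * packed) (A r * A packed) = conj_by r (A r) * conj_by packed (A packed)" .
  have "commutator (A (r * packed)) (conj_by (r * packed) (A (r * packed))) =
      commutator (A r) (conj_by r (A r)) * commutator (A packed) (conj_by packed (A packed))"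
    unfolding Ag conj
  proof (rule commutator_product)
    show 1: "commute (A r) (conj_by packed (A packed))"
      using AA commute_conj_by_iff[of packed "A r" "A packed"]
        commute_conj_by[OF commute_sym[OF r_packed(2)]] by simp
    show 2: "commute (conj_by r (A r)) (A packed)"
      using AA commute_conj_by_iff[of r "A r" "A packed"] commute_conj_by[OF r_packed(3)] by simp
    have "commute (conj_by packed (conj_by r (A r))) (conj_by packed (A packed))" using 2 by simp
    moreover have "conj_by packed (conj_by r (A r)) = conj_by r (A r)"
    proof -
      have "conj_by packed (conj_by r (A r)) = conj_by r (conj_by packed (A r))"
        using r_packed(1) by (simp add: conj_by_conj_by commute_def)
      then show ?thesis using commute_conj_by[OF commute_sym[OF r_packed(2)]] by simp
    qed
    ultimately show "commute (conj_by r (A r)) (conj_by packed (A packed))" by simp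
  qed (rule AA)
  also have "commutator (A r) (conj_by r (A r)) = 1"
    using r_far[OF mE] by (simp add: A_def commutator_eq_one_iff)
  finally have "commutator (A (r * packed)) (conj_by (r * packed) (A (r * packed))) =
      commutator (A packed) (conj_by packed (A packed))" by simp
  moreover have "A (r * packed) \<in> ?H"
    unfolding A_def
    by (rule subgroup_conj_by[OF H(1) subgroup_power_int[OF H(1,2)]
          subgroup_mult[OF H(1) subgroup_inverse[OF H(1,3)]
            subgroup_conj_by[OF H(1) subgroup_power_int[OF H(1,2)] H(3)]]])
  ultimately have "commutator (A packed) (conj_by packed (A packed)) \<in> ?H"
    using subgroup_commutator[OF H(1) _ subgroup_conj_by[OF H(1,3)], of "A (r * packed)" "A (r * packed)"]
    by simp
  then have "conj_by (f powi (- P - E * 4 ^ i)) (commutator (inverse (e j)) (conj_by (e i) (inverse (e j)))) \<in> ?H"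
    using isolate_packed[OF assms] unfolding A_def m_def by simp
  from subgroup_conj_by[OF H(1) subgroup_inverse[OF H(1) subgroup_power_int[OF H(1,2)]] this,
      of "- P - E * 4 ^ i"]
  show ?thesis by simp
qed

end

section \<open>Maps that move an interval to the right\<close>

locale right_moving =
  fixes g :: pl2 and l h :: real
  assumes lh: "l < h" and fixed: "app g l = l" "app g h = h"
    and moves: "\<And>x. l < x \<Longrightarrow> x < h \<Longrightarrow> x < app g x"
begin

lemma power_fixed [simp]: "app (g ^ n) l = l" "app (g ^ n) h = h"
  by (induction n) (simp_all add: fixed)

lemma power_int_fixed [simp]: "app (g powi k) l = l" "app (g powi k) h = h"
  by (simp_all add: power_int_def mult_group_inverse_power app_inverse_eq_iff)

lemma power_int_range: "l < x \<Longrightarrow> x < h \<Longrightarrow> l < app (g powi k) x \<and> app (g powi k) x < h"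
  using app_less_iff[of "g powi k" l x] app_less_iff[of "g powi k" x h] by simp

lemma power_ge: "l < x \<Longrightarrow> x < h \<Longrightarrow> x \<le> app (g ^ n) x"
proof (induction n)
  case (Suc n)
  have "l < app (g ^ n) x \<and> app (g ^ n) x < h"
    using app_less_iff[of "g ^ n" l x] app_less_iff[of "g ^ n" x h] Suc.prems by simp
  then have "app (g ^ n) x < app g (app (g ^ n) x)" using moves by simp
  then show ?case using Suc by simp
qed simp

lemma power_int_mono: "l < x \<Longrightarrow> x < h \<Longrightarrow> i \<le> j \<Longrightarrow> app (g powi i) x \<le> app (g powi j) x"
proof -
  assume x: "l < x" "x < h" and "i \<le> j"
  then have "g powi j = g powi int (nat (j - i)) * g powi i"
    by (simp flip: mult_group_power_int_add)
  then show ?thesis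
    using power_ge[of "app (g powi i) x" "nat (j - i)"] power_int_range[OF x, of i]
    by (simp add: power_int_def)
qed

text \<open>
  Otherwise the increasing orbit of \<open>x\<close> would converge to a fixed point inside the interval.
\<close>

lemma power_escapes:
  assumes x: "l < x" "x < h" and y: "y < h"
  shows "\<exists>n. y < app (g ^ n) x"
proof (rule ccontr)
  assume "\<not> ?thesis"
  then have bound: "app (g ^ n) x \<le> y" for n by (simp add: not_less)
  have rng: "l < app (g ^ n) x \<and> app (g ^ n) x < h" for n
    using app_less_iff[of "g ^ n" l x] app_less_iff[of "g ^ n" x h] x by simp
  have "incseq (\<lambda>n. app (g ^ n) x)"
    by (rule incseq_SucI) (use moves rng in \<open>simp add: less_imp_le\<close>)
  then obtain L where L: "(\<lambda>n. app (g ^ n) x) \<longlonglongrightarrow> L" "\<And>n. app (g ^ n) x \<le> L"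
    using incseq_convergent[of "\<lambda>n. app (g ^ n) x" y] bound by blast
  have "L \<le> y" using LIMSEQ_le_const2[OF L(1)] bound by blast
  moreover have "l < L" using L(2)[of 0] x by simp
  ultimately have "L < app g L" using moves y by simp
  moreover have "(\<lambda>n. app g (app (g ^ n) x)) \<longlonglongrightarrow> app g L"
    using isCont_tendsto_compose[OF app_continuous L(1)] .
  then have "(\<lambda>n. app (g ^ Suc n) x) \<longlonglongrightarrow> app g L" by simp
  then have "app g L = L" using LIMSEQ_unique LIMSEQ_Suc[OF L(1)] by blast
  ultimately show False by simp
qed

lemma escapes_right:
  assumes x: "l < x" "x < h" and y: "y < h"
  obtains N where "N > 0" "\<And>k. N \<le> k \<Longrightarrow> y < app (g powi k) x"
proof -
  obtain n where n: "y < app (g ^ n) x" using power_escapes[OF assms] by blast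
  show thesis
  proof (rule that[of "int n + 1"])
    show "y < app (g powi k) x" if "int n + 1 \<le> k" for k
      using n power_int_mono[OF x, of "int n" k] that by (simp add: power_int_def)
  qed simp
qed

lemma escapes_left:
  assumes x: "l < x" "x < h" and y: "l < y"
  obtains N where "N > 0" "\<And>k. N \<le> k \<Longrightarrow> app (g powi (- k)) x < y"
proof (cases "y < h")
  case True
  obtain N where N: "N > 0" "\<And>k. N \<le> k \<Longrightarrow> x < app (g powi k) y"
    using escapes_right[OF y True x(2)] by blast
  show thesis
    by (rule that[OF N(1)]) (use N(2) in \<open>simp add: mult_group_power_int_minus app_inverse_less_iff\<close>)
next
  case False
  show thesis
  proof (rule that[of 1])
    show "app (g powi (- k)) x < y" for k using power_int_range[OF x, of "- k"] False by simp
  qed simp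
qed

lemma PLc_power_conj: "x \<in> PLc l h \<Longrightarrow> conj_by (g powi k) x \<in> PLc l h"
  using PLc_conj_by[of x l h "g powi k"] by simp

end

text \<open>
  An element supported in \<open>(a, b')\<close> is conjugate, by an element supported in \<open>(a', b')\<close> that pushes the
  right end of the support to the left of \<open>b\<close>, to an element supported in \<open>(a, b)\<close>.
\<close>

lemma PLc_overlap:
  assumes "is_subgroup H" "PLc a b \<subseteq> H" "PLc a' b' \<subseteq> H" "a < a'" "a' < b" "b < b'"
  shows "PLc a b' \<subseteq> H"
proof
  fix x assume "x \<in> PLc a b'"
  then obtain s t where st: "s \<in> dyadic_rationals" "t \<in> dyadic_rationals" "a < s" "s < a'" "b < t" "t < b'"
    "x \<in> PL s t"
    using PLc_dyadicE[of x a b' a' b] assms(4-6) by auto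
  obtain p where p: "p \<in> dyadic_rationals" "a' < p" "p < b" using dyadic_dense assms by blast
  obtain q where q: "q \<in> dyadic_rationals" "p < q" "q < b" using dyadic_dense p by blast
  obtain k where k: "k \<in> PLc a' b'" "app k p = p" "app k t = q"
    using PLc_transitive[of p t p q a' b'] p q st assms by auto
  have "app k s = s" using k(1) PLc_subset_PL st PL_D(1) by (metis less_imp_le subsetD)
  then have "conj_by k x \<in> PL s q" using PL_conj_by[OF st(7), of k] k by simp
  then have "conj_by k x \<in> H" using st q assms(2) by (auto intro: PLc_I)
  moreover have "k \<in> H" using k assms by blast
  ultimately have "conj_by (inverse k) (conj_by k x) \<in> H"
    using subgroup_conj_by[OF assms(1) subgroup_inverse[OF assms(1)]] by blast
  then show "x \<in> H" by simp
qed

lemma PLc_bounded: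
  assumes "finite S" "S \<subseteq> PLc c d" "c < d"
  obtains a b where "c < a" "a < b" "b < d" "S \<subseteq> PL a b"
proof -
  have "\<exists>a b. c < a \<and> a < b \<and> b < d \<and> S \<subseteq> PL a b"
    using assms(1,2)
  proof (induction S)
    case empty
    obtain a where a: "c < a" "a < d" using dense assms(3) by blast
    obtain b where "a < b" "b < d" using dense a by blast
    then show ?case using a by blast
  next
    case (insert x S)
    then obtain a b where ab: "c < a" "a < b" "b < d" "S \<subseteq> PL a b" by auto
    obtain a' b' where ab': "c < a'" "a' < a" "b < b'" "b' < d" "x \<in> PL a' b'"
      by (rule PLc_dyadicE[of x c d a b]) (use insert.prems ab assms(3) in auto)
    have "S \<subseteq> PL a' b'" using PL_mono[of _ a b a' b'] ab(4) ab'(2,3) by auto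
    then show ?case using ab ab' by (intro exI[of _ a'] exI[of _ b']) auto
  qed
  then show thesis using that by blast
qed

lemma bump_on:
  assumes "p \<in> dyadic_rationals" "q \<in> dyadic_rationals" "p < q" "m > 0" "n > 0"
  obtains f where "f \<in> PL p q" "rgerm p m f" "lgerm q (- n) f" "\<And>x. p < x \<Longrightarrow> x < q \<Longrightarrow> x < app f x"
proof -
  obtain A where A: "app A 0 = p" "app A 1 = q"
    using interval_transitive[of 0 1 p q] assms by auto
  obtain f where f: "f \<in> PL 0 1" "rgerm 0 m f" "lgerm 1 (- n) f" "\<And>x. 0 < x \<Longrightarrow> x < 1 \<Longrightarrow> x < app f x"
    using bump[OF assms(4,5)] by blast
  show thesis
  proof (rule that[of "conj_by A f"])
    show "conj_by A f \<in> PL p q" using PL_conj_by[OF f(1), of A] A by simp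
    show "rgerm p m (conj_by A f)" using rgerm_conj_by[OF f(2), of A] f(1) A by (simp add: PL_D)
    show "lgerm q (- n) (conj_by A f)" using lgerm_conj_by[OF f(3), of A] f(1) A by (simp add: PL_D)
    fix x assume "p < x" "x < q"
    then have "0 < app (inverse A) x" "app (inverse A) x < 1"
      using A by (simp_all add: app_inverse_less_iff)
    from f(4)[OF this] have "app A (app (inverse A) x) < app A (app f (app (inverse A) x))"
      by (simp only: app_less_iff)
    then show "x < app (conj_by A f) x" by (simp add: conj_by_def)
  qed
qed

text \<open>
  The generated subgroup is normalized by \<open>PLc c d\<close>, so by simplicity it is enough to find one generator
  that is not 1. Take \<open>y\<close> that moves all points of \<open>(a, b)\<close> to the right and \<open>x\<close> that sends \<open>(a, b)\<close> to an
  interval \<open>(a', b')\<close> further to the right which overlaps \<open>(a, b)\<close>. If \<open>y\<close> commuted with its conjugate by \<open>x\<close>, it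
  would preserve the support of the latter and therefore fix the end point \<open>a'\<close>.
\<close>

lemma PLc_generated_by_twisted_commutators:
  assumes "c < d"
  shows "PLc c d \<subseteq> gen {commutator y (conj_by x y) | x y. x \<in> PLc c d \<and> y \<in> PLc c d}"
    (is "_ \<subseteq> gen ?W")
proof -
  obtain a where a: "a \<in> dyadic_rationals" "c < a" "a < d" using dyadic_dense assms by blast
  obtain b where b: "b \<in> dyadic_rationals" "a < b" "b < d" using dyadic_dense a by blast
  obtain a' where a': "a' \<in> dyadic_rationals" "a < a'" "a' < b" using dyadic_dense b by blast
  obtain b' where b': "b' \<in> dyadic_rationals" "b < b'" "b' < d" using dyadic_dense b by blast
  obtain x where x: "x \<in> PLc c d" "app x a = a'" "app x b = b'"
    using PLc_transitive[of a b a' b' c d] a b a' b' by auto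
  obtain y where y: "y \<in> PL a b" "\<And>t. a < t \<Longrightarrow> t < b \<Longrightarrow> t < app y t"
    using bump_on[of a b 1 1] a b by auto
  have yc: "y \<in> PLc c d" using y a b by (auto intro: PLc_I)
  let ?z = "conj_by x y"
  have "\<not> commute y ?z"
  proof
    assume "commute y ?z"
    then have "app y (app ?z a') = app ?z (app y a')"
      by (simp add: commute_def flip: app_mult)
    moreover have "app ?z a' = a'" using PL_D(1)[OF PL_conj_by[OF y(1), of x]] x by simp
    ultimately have fz: "app ?z (app y a') = app y a'" by simp
    define t where "t = app (inverse x) (app y a')"
    have "a' < app y a'" "app y a' < b"
      using y a' app_less_iff[of y a' b] PL_D(2)[OF y(1), of b] by auto
    then have "a < t" "t < b" unfolding t_def using x b' by (simp_all add: app_inverse_less_iff)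
    then have "app x t < app x (app y t)" using y by simp
    then show False using fz by (simp add: conj_by_def t_def)
  qed
  then have "commutator y ?z \<noteq> 1" by (simp add: commutator_eq_one_iff)
  then obtain w where w: "app (commutator y ?z) w \<noteq> w" by (metis app_one pl2_eqI)
  have cW: "commutator y ?z \<in> ?W" using x yc by blast
  have "commutator y ?z \<in> PLc c d"
    using x yc by (intro subgroup_commutator[OF is_subgroup_PLc] subgroup_conj_by[OF is_subgroup_PLc])
  then have "commutator y ?z \<in> PL c d" using PLc_subset_PL by blast
  from PL_D[OF this, of w] w have "c < w" "w < d" by force+
  show ?thesis
  proof (rule PLc_simple[OF assms is_subgroup_gen _ gen_base[OF cW] \<open>c < w\<close> \<open>w < d\<close> w])
    fix u v assume u: "u \<in> PLc c d" and v: "v \<in> gen ?W"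
    show "conj_by u v \<in> gen ?W"
    proof (rule gen_normalized[OF _ v])
      fix g assume "g \<in> ?W"
      then obtain x y where g: "g = commutator y (conj_by x y)" "x \<in> PLc c d" "y \<in> PLc c d" by blast
      have "conj_by u g = commutator (conj_by u y) (conj_by (conj_by u x) (conj_by u y))"
        unfolding g conj_by_commutator by (simp add: conj_by_def mult.assoc)
      moreover have "conj_by u x \<in> PLc c d" "conj_by u y \<in> PLc c d"
        using u g by (auto intro: subgroup_conj_by[OF is_subgroup_PLc])
      ultimately show "conj_by u g \<in> ?W" by blast
    qed
  qed
qed

lemma finite_subset_gen_finite:
  assumes "finite T" "T \<subseteq> gen S"
  obtains Y where "finite Y" "Y \<subseteq> S" "T \<subseteq> gen Y"
proof -
  have "\<forall>t\<in>T. \<exists>Y. finite Y \<and> Y \<subseteq> S \<and> t \<in> gen Y" using assms gen_finite_support by blast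
  then obtain Y where Y: "\<And>t. t \<in> T \<Longrightarrow> finite (Y t) \<and> Y t \<subseteq> S \<and> t \<in> gen (Y t)" by metis
  have "T \<subseteq> gen (\<Union>t\<in>T. Y t)"
  proof
    fix t assume t: "t \<in> T"
    then have "gen (Y t) \<subseteq> gen (\<Union>t\<in>T. Y t)"
      by (intro gen_least[OF _ is_subgroup_gen]) (auto intro: gen_base)
    then show "t \<in> gen (\<Union>t\<in>T. Y t)" using Y t by blast
  qed
  then show thesis using Y assms(1) by (intro that[of "\<Union>t\<in>T. Y t"]) blast+
qed

section \<open>Capturing a finite set with two elements\<close>

text \<open>
  Each element of \<open>T\<close> is a word in finitely many commutators of \<open>y\<close> with the conjugate of \<open>y\<close> by \<open>x\<close>. List
  all the elements \<open>x\<close> and \<open>y\<^sup>-\<^sup>1\<close> that occur as \<open>e 0, e 1, \<dots>\<close> in pairs, and isolate the commutator of each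
  pair.
\<close>

lemma capture_finite_set:
  assumes f: "right_moving f 0 p" and r: "0 < u" "u < p" "r \<in> PL u w"
    and r_far: "\<And>c. 0 < c \<Longrightarrow> \<exists>M. \<forall>m\<ge>M. commute
      (conj_by (f powi m) (inverse r * conj_by (f powi c) r))
      (conj_by r (conj_by (f powi m) (inverse r * conj_by (f powi c) r)))"
    and T: "finite T" "T \<subseteq> PLc 0 p"
  obtains s where "s \<in> PLc 0 p" "T \<subseteq> gen {f, r * s}"
proof -
  interpret f: right_moving f 0 p by (rule f)
  define W where "W = {commutator y (conj_by x y) | x y. x \<in> PLc 0 p \<and> y \<in> PLc 0 p}"
  have "T \<subseteq> gen W"
    using T PLc_generated_by_twisted_commutators[OF f.lh] unfolding W_def by blast
  then obtain Y where Y: "finite Y" "Y \<subseteq> W" "T \<subseteq> gen Y" by (rule finite_subset_gen_finite[OF T(1)])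
  have "\<forall>w\<in>Y. \<exists>x y. w = commutator y (conj_by x y) \<and> x \<in> PLc 0 p \<and> y \<in> PLc 0 p"
    using Y(2) unfolding W_def by blast
  then obtain X1 X2 where X: "\<And>w. w \<in> Y \<Longrightarrow> w = commutator (X2 w) (conj_by (X1 w) (X2 w)) \<and>
      X1 w \<in> PLc 0 p \<and> X2 w \<in> PLc 0 p" by metis
  obtain ws where ws: "set ws = Y" using finite_list[OF Y(1)] by blast
  define K where "K = 2 * length ws"
  \<comment> \<open>the pair number \<open>q\<close> occupies the indices \<open>2 q\<close> and \<open>2 q + 1\<close>\<close>
  define e where "e i = (if even i then X1 (ws ! (i div 2)) else inverse (X2 (ws ! (i div 2))))" for i
  have e: "e i \<in> PLc 0 p" if "i < K" for i
  proof -
    have "ws ! (i div 2) \<in> Y" using that ws unfolding K_def by (metis less_mult_imp_div_less mult.commute nth_mem)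
    then show ?thesis using X unfolding e_def by (simp add: subgroup_inverse[OF is_subgroup_PLc])
  qed
  obtain a b where ab: "0 < a" "a < b" "b < p" "e ` {..<K} \<subseteq> PL a b"
    using PLc_bounded[of "e ` {..<K}" 0 p] e f.lh by auto
  have e_ab: "e i \<in> PL a b" if "i < K" for i using ab that by auto
  have conj_ab: "conj_by (f powi k) (e i) \<in> PL (app (f powi k) a) (app (f powi k) b)" if "i < K" for i k
    using PL_conj_by[OF e_ab[OF that]] .
  obtain c where c: "c > 0" "\<And>k. c \<le> k \<Longrightarrow> b < app (f powi k) a"
    using f.escapes_right[of a b] ab by auto
  obtain M where M: "\<And>m. M \<le> m \<Longrightarrow> commute
      (conj_by (f powi m) (inverse r * conj_by (f powi c) r))
      (conj_by r (conj_by (f powi m) (inverse r * conj_by (f powi c) r)))"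
    using r_far[OF c(1)] by blast
  define E where "E = max (3 * c) M"
  \<comment> \<open>beyond \<open>N\<close> steps to the left, the supports of the \<open>e i\<close> avoid the support of \<open>r\<close>\<close>
  obtain N where N: "\<And>k. N \<le> k \<Longrightarrow> app (f powi (- k)) b < u"
    by (rule f.escapes_left[of b u]) (use ab r in auto)
  define P where "P = N + E * 4 ^ K"
  interpret isolation f r e K c E P
  proof
    show "0 < c" "3 * c \<le> E" using c by (auto simp: E_def)
    show "commute (conj_by (f powi m) (inverse r * conj_by (f powi c) r))
      (conj_by r (conj_by (f powi m) (inverse r * conj_by (f powi c) r)))" if "E \<le> m" for m
      using that by (intro M) (simp add: E_def)
    fix i assume i: "i < K"
    show "commute (e i) (conj_by (f powi k) (e j))" if j: "j < K" and k: "c \<le> \<bar>k\<bar>" for j k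
    proof (cases "0 \<le> k")
      case True
      then have "b \<le> app (f powi k) a" using c(2)[of k] k by simp
      then show ?thesis using commute_disjoint[OF e_ab[OF i] conj_ab[OF j]] by blast
    next
      case False
      then have "b < app (f powi (- k)) a" using c(2)[of "- k"] k by simp
      then have "app (f powi k) b \<le> a"
        by (simp add: mult_group_power_int_minus app_inverse_less_iff)
      then show ?thesis using commute_sym[OF commute_disjoint[OF conj_ab[OF j] e_ab[OF i]]] by blast
    qed
    fix x y assume x: "0 \<le> x" "x \<le> E * 4 ^ K" and y: "0 \<le> y" "y \<le> E * 4 ^ K"
    have r': "conj_by (f powi y) r \<in> PL (app (f powi y) u) (app (f powi y) w)"
      using PL_conj_by[OF r(3)] .
    have "u \<le> app (f powi y) u" using f.power_int_mono[of u 0 y] r y by (simp add: power_int_def)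
    moreover have "app (f powi (x - P - E * 4 ^ i)) b < u"
    proof -
      have "0 \<le> E * 4 ^ i" using c by (simp add: E_def)
      then have "N \<le> - (x - P - E * 4 ^ i)" using x unfolding P_def by linarith
      from N[OF this] show ?thesis by simp
    qed
    ultimately show "commute (conj_by (f powi y) r) (conj_by (f powi (x - P - E * 4 ^ i)) (e i))"
      by (intro commute_sym[OF commute_disjoint[OF conj_ab[OF i] r']]) simp
  qed
  show thesis
  proof (rule that[of packed])
    have "spread 0 i \<in> PLc 0 p" if "i < K" for i
      unfolding spread_def using e[OF that] by (rule f.PLc_power_conj)
    then have "set (map (spread 0) [0..<K]) \<subseteq> PLc 0 p" by auto
    moreover have "set xs \<subseteq> PLc 0 p \<Longrightarrow> prod_list xs \<in> PLc 0 p" for xs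
      by (induction xs) (auto intro: subgroup_mult[OF is_subgroup_PLc] subgroup_one[OF is_subgroup_PLc])
    ultimately show "packed \<in> PLc 0 p" unfolding packed_def by blast
    have "w \<in> gen {f, r * packed}" if "w \<in> Y" for w
    proof -
      have "w \<in> set ws" using that ws by simp
      then obtain q where q: "q < length ws" "ws ! q = w" unfolding in_set_conv_nth by blast
      have "commutator (inverse (e (2 * q + 1))) (conj_by (e (2 * q)) (inverse (e (2 * q + 1)))) \<in> gen {f, r * packed}"
        using q(1) by (intro isolate) (auto simp: K_def)
      moreover have "e (2 * q) = X1 w" "inverse (e (2 * q + 1)) = X2 w"
        unfolding e_def using q(2) by simp_all
      ultimately have "commutator (X2 w) (conj_by (X1 w) (X2 w)) \<in> gen {f, r * packed}"
        by (simp only:)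
      then show ?thesis using X[OF that] by (simp only:)
    qed
    then have "gen Y \<subseteq> gen {f, r * packed}" by (intro gen_least[OF _ is_subgroup_gen]) auto
    then show "T \<subseteq> gen {f, r * packed}" using Y(3) by blast
  qed
qed

text \<open>
  Conjugating \<open>S\<close> by a map from \<open>[0, 1]\<close> to \<open>[a, b]\<close> gives a finite set that generates at least
  \<open>PLc a b\<close>. Since \<open>f a < b\<close>, consecutive translates of \<open>(a, b)\<close> by \<open>f\<close> overlap, and together they
  exhaust \<open>(0, p)\<close>.
\<close>

lemma generate_interval:
  assumes f: "right_moving f 0 p" and r: "0 < u" "u < p" "r \<in> PL u w"
    and r_far: "\<And>c. 0 < c \<Longrightarrow> \<exists>M. \<forall>m\<ge>M. commute
      (conj_by (f powi m) (inverse r * conj_by (f powi c) r))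
      (conj_by r (conj_by (f powi m) (inverse r * conj_by (f powi c) r)))"
    and S: "finite S" "S \<subseteq> PL 0 1" "PLc 0 1 \<subseteq> gen S"
  obtains s where "s \<in> PLc 0 p" "PLc 0 p \<subseteq> gen {f, r * s}"
proof -
  interpret f: right_moving f 0 p by (rule f)
  obtain a where a: "a \<in> dyadic_rationals" "0 < a" "a < p" using dyadic_dense f.lh by blast
  have fa: "a < app f a" "app f a < p"
    using f.moves[OF a(2,3)] app_less_iff[of f a p] a f.fixed by auto
  obtain b where b: "b \<in> dyadic_rationals" "app f a < b" "b < p" using dyadic_dense fa by blast
  obtain A where A: "app A 0 = a" "app A 1 = b"
    using interval_transitive[of 0 1 a b] a b fa by auto
  define T where "T = conj_by A ` S"
  have T: "T \<subseteq> PL a b" unfolding T_def using S(2) PL_conj_by[of _ 0 1 A] A by auto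
  have "PLc a b \<subseteq> gen T"
  proof
    fix x assume "x \<in> PLc a b"
    then have "conj_by (inverse A) x \<in> PLc 0 1"
      using PLc_conj_by[of x a b "inverse A"] A app_inverse_app(1)[of A] by metis
    then have "conj_by A (conj_by (inverse A) x) \<in> conj_by A ` gen S" using S(3) by blast
    then show "x \<in> gen T" unfolding T_def gen_conj_by by simp
  qed
  obtain s where s: "s \<in> PLc 0 p" "T \<subseteq> gen {f, r * s}"
  proof (rule capture_finite_set[OF f r r_far])
    show "finite T" unfolding T_def using S(1) by simp
    show "T \<subseteq> PLc 0 p" using T a b by (auto intro: PLc_I)
  qed blast+
  let ?H = "gen {f, r * s}"
  have H: "is_subgroup ?H" "f \<in> ?H" by (auto intro: is_subgroup_gen gen_base)
  have "gen T \<subseteq> ?H" using s(2) by (intro gen_least[OF _ is_subgroup_gen])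
  then have base: "PLc a b \<subseteq> ?H" using \<open>PLc a b \<subseteq> gen T\<close> by blast
  have shift: "PLc (app (f powi k) a) (app (f powi k) b) \<subseteq> ?H" for k
  proof
    fix x assume "x \<in> PLc (app (f powi k) a) (app (f powi k) b)"
    then have "conj_by (inverse (f powi k)) x \<in> PLc a b"
      using PLc_conj_by[of x _ _ "inverse (f powi k)"] by fastforce
    then have "conj_by (f powi k) (conj_by (inverse (f powi k)) x) \<in> ?H"
      using base by (intro subgroup_conj_by[OF H(1) subgroup_power_int[OF H]]) auto
    then show "x \<in> ?H" by simp
  qed
  have pa: "app (f powi k) a < app (f powi (k + 1)) a" "app (f powi (k + 1)) a < app (f powi k) b"
     "app (f powi k) b < app (f powi (k + 1)) b" for k
  proof -
    have e: "f powi (k + 1) = f powi k * f"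
      unfolding mult_group_power_int_add by (simp add: power_int_def)
    show "app (f powi k) a < app (f powi (k + 1)) a" "app (f powi (k + 1)) a < app (f powi k) b"
     "app (f powi k) b < app (f powi (k + 1)) b"
      unfolding e using fa b a f.moves[of b] by simp_all
  qed
  have right: "PLc a (app (f powi int n) b) \<subseteq> ?H" for n
  proof (induction n)
    case 0
    then show ?case using base by (simp add: power_int_def)
  next
    case (Suc n)
    have "a \<le> app (f powi int n) a" using f.power_int_mono[of a 0 "int n"] a by (simp add: power_int_def)
    then show ?case
      using PLc_overlap[OF H(1) Suc shift[of "int n + 1"]] pa[of "int n"] by (simp add: add.commute)
  qed
  have both: "PLc (app (f powi (- int m)) a) (app (f powi int n) b) \<subseteq> ?H" for m n
  proof (induction m)
    case 0
    then show ?case using right by (simp add: power_int_def)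
  next
    case (Suc m)
    have e: "- int (Suc m) + 1 = - int m" by simp
    have "app (f powi (- int m)) b \<le> app (f powi int n) b"
      using f.power_int_mono[of b "- int m" "int n"] a b fa by simp
    then show ?case
      using PLc_overlap[OF H(1) shift[of "- int (Suc m)"] Suc] pa[of "- int (Suc m)"] unfolding e by simp
  qed
  have "PLc 0 p \<subseteq> ?H"
  proof
    fix x assume "x \<in> PLc 0 p"
    then obtain a' b' where x: "0 < a'" "b' < p" "x \<in> PL a' b'" unfolding PLc_def by blast
    obtain N where N: "N > 0" "\<And>k. N \<le> k \<Longrightarrow> b' < app (f powi k) b"
      using f.escapes_right[of b b'] a b fa x by auto
    obtain N' where N': "N' > 0" "\<And>k. N' \<le> k \<Longrightarrow> app (f powi (- k)) a < a'"
      using f.escapes_left[of a a'] a x by auto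
    have "x \<in> PLc (app (f powi (- int (nat N'))) a) (app (f powi int (nat N)) b)"
      using x N N' by (intro PLc_I[OF x(3)]) auto
    then show "x \<in> ?H" using both by blast
  qed
  then show thesis using that s(1) by blast
qed

section \<open>Generating pairs\<close>

lemma generating_pair_opposite:
  assumes "0 < a" "b < 0" and S: "finite S" "S \<subseteq> PL 0 1" "PLc 0 1 \<subseteq> gen S"
  obtains f s where "f \<in> PL 0 1" "rgerm 0 a f" "lgerm 1 b f" "s \<in> PLc 0 1" "PLc 0 1 \<subseteq> gen {f, s}"
proof -
  obtain f where f: "f \<in> PL 0 1" "rgerm 0 a f" "lgerm 1 b f" "\<And>x. 0 < x \<Longrightarrow> x < 1 \<Longrightarrow> x < app f x"
    using bump[of a "- b"] assms by auto
  have "right_moving f 0 1"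
    by unfold_locales (use f in \<open>auto intro: PL_D\<close>)
  then obtain s where "s \<in> PLc 0 1" "PLc 0 1 \<subseteq> gen {f, 1 * s}"
    using generate_interval[of f 1 "1/2" 1 1 S] S subgroup_one[OF is_subgroup_PL] by auto
  then show thesis using f by (intro that[of f s]) auto
qed

text \<open>
  Slopes greater than 1 at both ends force a fixed point \<open>p\<close> of \<open>f\<close>; choose it as the only one in \<open>(0, 1)\<close>,
  attracting from both sides. The element \<open>r\<close> has the prescribed slope at 1 and satisfies \<open>p < r p\<close>. Near 1
  both \<open>f\<close> and \<open>r\<close> are linear and commute, so \<open>B = r\<^sup>-\<^sup>1 (f\<^sup>c r f\<^sup>-\<^sup>c)\<close> has compact support in \<open>(0, 1)\<close>. High
  powers of \<open>f\<close> shrink this support to a neighbourhood of \<open>p\<close> that \<open>r\<close> moves off itself, and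
  therefore the translate of \<open>B\<close> commutes with its conjugate by \<open>r\<close>.
\<close>

lemma generating_pair_same:
  assumes "0 < a" "0 < b" and S: "finite S" "S \<subseteq> PL 0 1" "PLc 0 1 \<subseteq> gen S"
  obtains f r s where "f \<in> PL 0 1" "rgerm 0 a f" "lgerm 1 b f"
    "r \<in> PL 0 1" "rgerm 0 0 r" "lgerm 1 d r" "s \<in> PLc 0 1" "PLc 0 1 \<subseteq> gen {f, r * s}"
proof -
  have dy: "1/2 \<in> dyadic_rationals" "1/4 \<in> dyadic_rationals" "3/4 \<in> dyadic_rationals"
    using dyadic_powi[of "-1"] dyadic_powi[of "-2"] dyadic_diff[OF dyadic_0_1(2) dyadic_powi[of "-2"]]
    by (simp_all add: power_int_def power2_eq_square)
  define p :: real where "p = 1/2"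
  have p: "p \<in> dyadic_rationals" "0 < p" "p < 1" using dy by (simp_all add: p_def)
  obtain f1 where f1: "f1 \<in> PL 0 p" "rgerm 0 a f1" "\<And>x. 0 < x \<Longrightarrow> x < p \<Longrightarrow> x < app f1 x"
    using bump_on[OF dyadic_0_1(1) p(1,2) assms(1) zero_less_one] by blast
  obtain f2 where f2: "f2 \<in> PL p 1" "lgerm 1 (- b) f2" "\<And>x. p < x \<Longrightarrow> x < 1 \<Longrightarrow> x < app f2 x"
    using bump_on[OF p(1) dyadic_0_1(2) p(3) zero_less_one assms(2)] by blast
  define f where "f = f1 * inverse f2"
  have if2: "inverse f2 \<in> PL p 1" using f2 by (intro subgroup_inverse[OF is_subgroup_PL])
  have f_left: "app f x = app f1 x" if "x \<le> p" for x
    using PL_D(1)[OF if2 that] by (simp add: f_def)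
  have f_right: "app f x = app (inverse f2) x" if "p \<le> x" for x
  proof -
    have "p \<le> app (inverse f2) x" using that PL_D(1)[OF f2(1), of p] by (simp add: app_inverse_le_iff)
    then show ?thesis using PL_D(2)[OF f1(1)] by (simp add: f_def)
  qed
  have f: "f \<in> PL 0 1"
    unfolding f_def using f1 if2 p by (intro subgroup_mult[OF is_subgroup_PL]) (auto elim: PL_mono)
  have f_rgerm: "rgerm 0 a f"
  proof -
    have "rgerm 0 0 (inverse f2)"
      unfolding rgerm_iff using p PL_D(1)[OF if2] by (intro exI[of _ p]) auto
    from slope_at_mult[OF this, of a f1] f1 PL_D(1)[OF if2, of 0] p show ?thesis by (simp add: f_def)
  qed
  have f_lgerm: "lgerm 1 b f"
  proof -
    have "lgerm 1 b (inverse f2)" using slope_at_inverse[OF f2(2)] PL_D(2)[OF f2(1)] by simp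
    moreover have "lgerm 1 0 f1"
      unfolding lgerm_iff using p PL_D(2)[OF f1(1)] by (intro exI[of _ "1 - p"]) auto
    ultimately show ?thesis
      using slope_at_mult[of "- 1" 1 b "inverse f2" 0 f1] PL_D(2)[OF if2, of 1] by (simp add: f_def)
  qed
  interpret f: right_moving f 0 p
    by unfold_locales (use p f1 in \<open>auto simp: f_left PL_D\<close>)
  interpret f': right_moving "inverse f" p 1
  proof
    show "app (inverse f) p = p" "app (inverse f) 1 = 1"
      using f.fixed PL_D(2)[OF f] by (simp_all add: app_inverse_eq_iff)
    fix x assume x: "p < x" "x < 1"
    have "app f x < x"
      using f_right[of x] x f2(3)[OF x] by (simp add: app_inverse_less_iff)
    then show "x < app (inverse f) x" by (simp add: app_inverse_less_iff)
  qed (use p in auto)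
  obtain r1 where r1: "r1 \<in> PL (1/4) (3/4)" "\<And>x. 1/4 < x \<Longrightarrow> x < 3/4 \<Longrightarrow> x < app r1 x"
    using bump_on[OF dy(2,3) _ zero_less_one zero_less_one] by auto
  \<comment> \<open>\<open>r1\<close> moves \<open>p\<close> to the right, \<open>r2\<close> contributes the slope at 1\<close>
  obtain r2 where r2: "r2 \<in> PL (3/4) 1" "lgerm 1 d r2"
  proof -
    consider "d = 0" | "d < 0" | "d > 0" by linarith
    then show thesis
    proof cases
      case 1
      then show thesis using that[of 1] slope_at_one subgroup_one[OF is_subgroup_PL] by auto
    next
      case 2
      then show thesis using bump_on[of "3/4" 1 1 "- d"] dy that by auto
    next
      case 3
      then obtain h where h: "h \<in> PL (3/4) 1" "lgerm 1 (- d) h"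
        using bump_on[of "3/4" 1 1 d] dy by auto
      then have "lgerm 1 d (inverse h)" using slope_at_inverse[OF h(2)] PL_D(2)[OF h(1), of 1] by simp
      then show thesis using that[of "inverse h"] subgroup_inverse[OF is_subgroup_PL h(1)] by blast
    qed
  qed
  define r where "r = r1 * r2"
  define u :: real where "u = 1/4"
  have u: "0 < u" "u < p" by (simp_all add: u_def p_def)
  have r: "r \<in> PL u 1"
    unfolding r_def u_def using r1(1) r2(1)
    by (intro subgroup_mult[OF is_subgroup_PL]) (auto elim: PL_mono)
  then have r01: "r \<in> PL 0 1" using u by (auto elim: PL_mono)
  have r_rgerm: "rgerm 0 0 r"
    unfolding rgerm_iff using u PL_D(1)[OF r] by (intro exI[of _ u]) auto
  have r_lgerm: "lgerm 1 d r"
  proof -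
    have "lgerm 1 0 r1"
      unfolding lgerm_iff using PL_D(2)[OF r1(1)] by (intro exI[of _ "1/4"]) auto
    then show ?thesis using slope_at_mult[OF r2(2), of 0 r1] PL_D(2)[OF r2(1), of 1] by (simp add: r_def)
  qed
  have "p < app r p"
  proof -
    have r2p: "app r2 p = p" using PL_D(1)[OF r2(1), of p] unfolding p_def by linarith
    have "p < app r1 p" using r1(2)[of p] unfolding p_def by linarith
    then show ?thesis unfolding r_def app_mult r2p .
  qed
  moreover have "app r p < 1" using app_less_iff[of r p 1] PL_D(2)[OF r, of 1] p by simp
  ultimately obtain z where z: "p < z" "z < app r p" "z < 1" using dense by (meson order.strict_trans)
  have q: "app (inverse r) z < p" using z by (simp add: app_inverse_less_iff)
  have "\<exists>M. \<forall>m\<ge>M. commute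
      (conj_by (f powi m) (inverse r * conj_by (f powi c) r))
      (conj_by r (conj_by (f powi m) (inverse r * conj_by (f powi c) r)))" if "0 < c" for c
  proof -
    define B where "B = inverse r * conj_by (f powi c) r"
    have "u \<le> app (f powi c) u" using f.power_int_mono[of u 0 c] u that by (simp add: power_int_def)
    then have "conj_by (f powi c) r \<in> PL u 1"
      using PL_conj_by[OF r, of "f powi c"] f'.power_int_fixed[of "- c"]
        PL_D(2)[OF subgroup_power_int[OF is_subgroup_PL f], of 1 c]
      by (auto elim: PL_mono)
    then have B: "B \<in> PL u 1"
      unfolding B_def using r by (intro subgroup_mult[OF is_subgroup_PL] subgroup_inverse[OF is_subgroup_PL])
    have "lgerm 1 d (conj_by (f powi c) r)"
      using lgerm_conj_by[OF r_lgerm, of "f powi c"] PL_D(2)[OF r, of 1]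
        PL_D(2)[OF subgroup_power_int[OF is_subgroup_PL f], of 1 c] by simp
    moreover have "app (conj_by (f powi c) r) 1 = 1"
      using PL_D(2)[OF \<open>conj_by (f powi c) r \<in> PL u 1\<close>, of 1] by simp
    moreover have "lgerm 1 (- d) (inverse r)" using slope_at_inverse[OF r_lgerm] PL_D(2)[OF r, of 1] by simp
    ultimately have "lgerm 1 0 B"
      unfolding B_def using slope_at_mult[of "- 1" 1 d "conj_by (f powi c) r" "- d" "inverse r"] by simp
    moreover have "rgerm 0 0 B"
      unfolding rgerm_iff using u PL_D(1)[OF B] by (intro exI[of _ u]) auto
    ultimately have "B \<in> PLc 0 1" using B u PLc_iff_trivial_germs by (auto elim: PL_mono)
    then obtain y where y: "y < 1" "p < y" "B \<in> PL u y"
    proof -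
      assume "B \<in> PLc 0 1"
      then obtain y' where y': "y' < 1" "\<And>x. y' \<le> x \<Longrightarrow> app B x = x"
        unfolding PLc_def using PL_D(2) by blast
      show thesis
      proof (rule that)
        show "max y' ((p + 1) / 2) < 1" "p < max y' ((p + 1) / 2)"
          using y'(1) p by (simp_all add: less_max_iff_disj)
        show "B \<in> PL u (max y' ((p + 1) / 2))" using PL_D(1)[OF B] y' by (auto intro: PL_I)
      qed
    qed
    obtain N where N: "\<And>m. N \<le> m \<Longrightarrow> app (inverse r) z < app (f powi m) u"
      using f.escapes_right[OF u q] by blast
    obtain N' where N': "N' > 0" "\<And>m. N' \<le> m \<Longrightarrow> app (inverse f powi (- m)) y < z"
      using f'.escapes_left[OF y(2,1) z(1)] by blast
    have inv_pow: "inverse f powi (- m) = f powi m" for m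
      using mult_group_power_int_minus[of "inverse f" m]
      by (simp add: power_int_def mult_group_inverse_power)
    show ?thesis
    proof (intro exI allI impI)
      fix m assume m: "max N N' \<le> m"
      have "app (f powi m) y < z" using N'(2)[of m] m inv_pow[of m] by simp
      moreover have "z < app r (app (f powi m) u)" using N[of m] m by (simp add: app_inverse_less_iff)
      moreover have "conj_by (f powi m) B \<in> PL (app (f powi m) u) (app (f powi m) y)"
        using PL_conj_by[OF y(3)] .
      moreover from this have "conj_by r (conj_by (f powi m) B) \<in>
          PL (app r (app (f powi m) u)) (app r (app (f powi m) y))"
        by (rule PL_conj_by)
      ultimately show "commute
          (conj_by (f powi m) (inverse r * conj_by (f powi c) r))
          (conj_by r (conj_by (f powi m) (inverse r * conj_by (f powi c) r)))"
        unfolding B_def[symmetric] by (intro commute_disjoint) auto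
    qed
  qed
  then obtain s where s: "s \<in> PLc 0 p" "PLc 0 p \<subseteq> gen {f, r * s}"
    using generate_interval[OF f.right_moving_axioms u r _ S] by blast
  let ?H = "gen {f, r * s}"
  have H: "is_subgroup ?H" "f \<in> ?H" by (auto intro: is_subgroup_gen gen_base)
  have "r * s \<in> ?H" by (auto intro: gen_base)
  from subgroup_mult[OF H(1) this subgroup_inverse[OF H(1)]] have "r * s * inverse s \<in> ?H"
    using s by blast
  then have rH: "r \<in> ?H" by (simp add: mult.assoc)
  have "PLc 0 1 \<subseteq> ?H"
  proof
    fix x assume "x \<in> PLc 0 1"
    then obtain a' b' where x: "0 < a'" "p < b'" "b' < 1" "x \<in> PL a' b'"
      by (rule PLc_dyadicE[of x 0 1 1 p]) (use p in auto)
    obtain N where N: "N > 0" "\<And>m. N \<le> m \<Longrightarrow> app (inverse f powi (- m)) b' < z"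
      using f'.escapes_left[OF x(2,3) z(1)] by blast
    have inv_pow: "inverse f powi (- N) = f powi N"
      using N(1) by (simp add: power_int_def)
    define k where "k = inverse r * f powi N"
    have k: "k \<in> ?H"
      unfolding k_def using H rH by (intro subgroup_mult subgroup_inverse subgroup_power_int)
    have "app k b' < app (inverse r) z" using N(2)[of N] by (simp add: k_def inv_pow)
    then have 1: "app k b' < p" using q by simp
    have "app k 0 = 0"
      using PL_D(1)[OF subgroup_power_int[OF is_subgroup_PL f], of 0 N]
        PL_D(1)[OF subgroup_inverse[OF is_subgroup_PL r01], of 0] by (simp add: k_def)
    then have 2: "0 < app k a'" using app_less_iff[of k 0 a'] x by simp
    have "conj_by k x \<in> PLc 0 p" using PL_conj_by[OF x(4), of k] 2 1 by (rule PLc_I)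
    then have "conj_by (inverse k) (conj_by k x) \<in> ?H"
      using subgroup_conj_by[OF H(1) subgroup_inverse[OF H(1) k]] s(2) by blast
    then show "x \<in> ?H" by simp
  qed
  moreover have "s \<in> PLc 0 1" using s(1) p by (auto intro: PLc_mono)
  ultimately show thesis using that f f_rgerm f_lgerm r01 r_rgerm r_lgerm by blast
qed

section \<open>Normal subgroups\<close>

lemma nontrivial_in_PLc:
  assumes "l < h"
  obtains x w where "x \<in> PLc l h" "l < w" "w < h" "app x w \<noteq> w"
proof -
  obtain a where a: "a \<in> dyadic_rationals" "l < a" "a < h" using dyadic_dense assms by blast
  obtain b where b: "b \<in> dyadic_rationals" "a < b" "b < h" using dyadic_dense a by blast
  obtain x where x: "x \<in> PL a b" "\<And>t. a < t \<Longrightarrow> t < b \<Longrightarrow> t < app x t"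
    using bump_on[OF a(1) b(1,2) zero_less_one zero_less_one] by blast
  obtain w where "a < w" "w < b" using dense b by blast
  then show thesis using that[of x w] x a b PLc_I[OF x(1), of l h] by force
qed

text \<open>
  If all the generators are the identity near 0, then, being finitely many, they are the identity on
  a common interval \<open>[0, e]\<close>, and so is everything they generate.
\<close>

lemma rgerm_nontrivial:
  assumes "finite S" "S \<subseteq> PL 0 1" "PLc 0 1 \<subseteq> gen S"
  shows "\<exists>n\<in>S. \<not> rgerm 0 0 n"
proof (rule ccontr)
  assume "\<not> ?thesis"
  then have triv: "\<forall>n\<in>S. rgerm 0 0 n" by blast
  have "\<exists>e>0. e < 1 \<and> S \<subseteq> PL e 1"
    using assms(1,2) triv
  proof (induction S)
    case (insert x S)
    then obtain e where e: "0 < e" "e < 1" "S \<subseteq> PL e 1" by auto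
    obtain e' where e': "0 < e'" "\<And>t. 0 \<le> t \<Longrightarrow> t \<le> e' \<Longrightarrow> app x t = t"
      using insert.prems PL_D(1)[of x 0 1 0] unfolding rgerm_iff by auto
    have "x \<in> PL (min e e') 1"
    proof (rule PL_I)
      fix t :: real assume "t \<le> min e e'"
      then show "app x t = t" using e'(2)[of t] PL_D(1)[of x 0 1 t] insert.prems by (cases "0 \<le> t") auto
    qed (use insert.prems PL_D(2)[of x 0 1] in auto)
    moreover have "S \<subseteq> PL (min e e') 1" using e(3) PL_mono[of _ e 1 "min e e'" 1] by auto
    ultimately show ?case using e e' by (intro exI[of _ "min e e'"]) auto
  qed (intro exI[of _ "1/2"], simp)
  then obtain e where e: "0 < e" "e < 1" "S \<subseteq> PL e 1" by blast
  then have "gen S \<subseteq> PL e 1" by (intro gen_least is_subgroup_PL)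
  moreover obtain x w where x: "x \<in> PLc 0 e" "0 < w" "w < e" "app x w \<noteq> w"
    using nontrivial_in_PLc[OF e(1)] by blast
  moreover have "x \<in> PLc 0 1" using x e by (auto intro: PLc_mono)
  ultimately have "x \<in> PL e 1" using assms(3) by blast
  then show False using PL_D(1)[of x e 1 w] x by simp
qed

lemma lgerm_nontrivial:
  assumes "finite S" "S \<subseteq> PL 0 1" "PLc 0 1 \<subseteq> gen S"
  shows "\<exists>n\<in>S. \<not> lgerm 1 0 n"
proof (rule ccontr)
  assume "\<not> ?thesis"
  then have triv: "\<forall>n\<in>S. lgerm 1 0 n" by blast
  have "\<exists>e>0. e < 1 \<and> S \<subseteq> PL 0 e"
    using assms(1,2) triv
  proof (induction S)
    case (insert x S)
    then obtain e where e: "0 < e" "e < 1" "S \<subseteq> PL 0 e" by auto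
    obtain e' where e': "0 < e'" "\<And>t. 1 - e' \<le> t \<Longrightarrow> t \<le> 1 \<Longrightarrow> app x t = t"
      using insert.prems PL_D(2)[of x 0 1 1] unfolding lgerm_iff by auto
    have "x \<in> PL 0 (max e (1 - e'))"
    proof (rule PL_I)
      fix t :: real assume "max e (1 - e') \<le> t"
      then show "app x t = t" using e'(2)[of t] PL_D(2)[of x 0 1 t] insert.prems by (cases "t \<le> 1") auto
    qed (use insert.prems PL_D(1)[of x 0 1] in auto)
    moreover have "S \<subseteq> PL 0 (max e (1 - e'))" using e(3) PL_mono[of _ 0 e 0 "max e (1 - e')"] by auto
    ultimately show ?case using e e' by (intro exI[of _ "max e (1 - e')"]) auto
  qed (intro exI[of _ "1/2"], simp)
  then obtain e where e: "0 < e" "e < 1" "S \<subseteq> PL 0 e" by blast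
  then have "gen S \<subseteq> PL 0 e" by (intro gen_least is_subgroup_PL)
  moreover obtain x w where x: "x \<in> PLc e 1" "e < w" "w < 1" "app x w \<noteq> w"
    using nontrivial_in_PLc[OF e(2)] by blast
  moreover have "x \<in> PLc 0 1" using x e by (auto intro: PLc_mono)
  ultimately have "x \<in> PL 0 e" using assms(3) by blast
  then show False using PL_D(2)[of x 0 e w] x by simp
qed

lemma int_subgroup_cyclic:
  fixes A :: "int set"
  assumes "0 \<in> A" "\<And>x y. x \<in> A \<Longrightarrow> y \<in> A \<Longrightarrow> x - y \<in> A"
  obtains a where "0 \<le> a" "a \<in> A" "\<And>x. x \<in> A \<Longrightarrow> \<exists>i. x = i * a"
proof (cases "A = {0}")
  case True
  then show thesis using that[of 0] by auto
next
  case False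
  have neg: "- x \<in> A" if "x \<in> A" for x using assms(2)[OF assms(1) that] by simp
  have add: "x + y \<in> A" if "x \<in> A" "y \<in> A" for x y using assms(2)[OF that(1) neg[OF that(2)]] by simp
  have nat: "int n * x \<in> A" if "x \<in> A" for n x
    by (induction n) (use assms(1) add that in \<open>auto simp: distrib_right\<close>)
  have mult: "i * x \<in> A" if "x \<in> A" for i x
    using nat[OF that, of "nat i"] neg[OF nat[OF that, of "nat (- i)"]] by (cases "0 \<le> i") auto
  obtain x where "x \<in> A" "x \<noteq> 0" using False assms(1) by blast
  then have "int (nat \<bar>x\<bar>) \<in> A \<and> 0 < nat \<bar>x\<bar>" using neg by (cases "x \<ge> 0") auto
  then obtain n where n: "int n \<in> A" "0 < n" "\<And>m. m < n \<Longrightarrow> \<not> (int m \<in> A \<and> 0 < m)"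
    using exists_least_iff[of "\<lambda>n. int n \<in> A \<and> 0 < n"] by blast
  show thesis
  proof (rule that[of "int n"])
    fix x assume x: "x \<in> A"
    have "x mod int n = x - x div int n * int n" by (simp add: minus_div_mult_eq_mod)
    then have "x mod int n \<in> A" using assms(2)[OF x mult[OF n(1)]] by simp
    moreover have "0 \<le> x mod int n" "x mod int n < int n" using n(2) by auto
    ultimately have "x mod int n = 0"
      using n(3)[of "nat (x mod int n)"] by (cases "x mod int n = 0") (auto simp: nat_less_iff)
    then show "\<exists>i. x = i * int n" by (metis mult.commute dvd_def dvd_eq_mod_eq_0)
  qed (use n in auto)
qed

definition germs :: "int \<Rightarrow> int \<Rightarrow> pl2 \<Rightarrow> bool" where
  "germs a b h \<longleftrightarrow> h \<in> PL 0 1 \<and> rgerm 0 a h \<and> lgerm 1 b h"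

lemma germs_exist: "h \<in> PL 0 1 \<Longrightarrow> \<exists>a b. germs a b h"
  unfolding germs_def using rgerm_exists lgerm_exists by blast

lemma germs_mult: "germs a b h \<Longrightarrow> germs a' b' h' \<Longrightarrow> germs (a + a') (b + b') (h * h')"
  unfolding germs_def
  using slope_at_mult[of 1 0 a' h' a h] slope_at_mult[of "- 1" 1 b' h' b h] subgroup_mult[OF is_subgroup_PL, of h 0 1 h']
  by (auto simp: PL_D add.commute)

lemma germs_inverse: "germs a b h \<Longrightarrow> germs (- a) (- b) (inverse h)"
  unfolding germs_def
  using slope_at_inverse[of 1 0 a h] slope_at_inverse[of "- 1" 1 b h] subgroup_inverse[OF is_subgroup_PL, of h 0 1]
  by (auto simp: PL_D)

lemma germs_power_int: "germs a b h \<Longrightarrow> germs (i * a) (i * b) (h powi i)"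
  unfolding germs_def
  using slope_at_power_int[of 1 0 a h i] slope_at_power_int[of "- 1" 1 b h i] subgroup_power_int[OF is_subgroup_PL, of h 0 1 i]
  by (auto simp: PL_D)

lemma germs_one: "germs 0 0 1"
  by (simp add: germs_def slope_at_one slope_at_one subgroup_one[OF is_subgroup_PL])

lemma germs_PLc: "germs 0 0 h \<longleftrightarrow> h \<in> PLc 0 1"
  by (simp add: germs_def PLc_iff_trivial_germs)

text \<open>
  Two elements with the same slopes at 0 and at 1 differ by an element with compact support.
\<close>

lemma same_germs_mem:
  assumes "is_subgroup H" "PLc 0 1 \<subseteq> H" "germs a b h" "germs a b h'" "h' \<in> H"
  shows "h \<in> H"
proof -
  have "germs 0 0 (h * inverse h')" using germs_mult[OF assms(3) germs_inverse[OF assms(4)]] by simp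
  then have "h * inverse h' \<in> H" using assms(2) germs_PLc by blast
  from subgroup_mult[OF assms(1) this assms(5)] show ?thesis by (simp add: mult.assoc)
qed

text \<open>
  Here \<open>A\<close> is the group of slope exponents at 0, and \<open>D\<close> is the group of slope exponents at 1 of the
  elements that are the identity near 0. Both are cyclic, with generators \<open>a\<close> and \<open>d\<close>, which gives the
  basis \<open>(a, b0)\<close>, \<open>(0, d)\<close> of the group of pairs of exponents.
\<close>

theorem two_generated_PL:
  assumes N: "is_subgroup N" "N \<subseteq> PL 0 1"
    and normal: "\<And>x y. x \<in> PL 0 1 \<Longrightarrow> y \<in> N \<Longrightarrow> conj_by x y \<in> N"
    and S: "finite S" "gen S = N"
  shows "\<exists>g\<in>PL 0 1. \<exists>h\<in>PL 0 1. gen {g, h} = N"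
proof (cases "N = {1}")
  case True
  have "gen {1, 1 :: pl2} \<subseteq> {1}" by (rule gen_least) (auto simp: is_subgroup_def)
  then have "gen {1, 1} = N" using True gen_one by auto
  then show ?thesis using subgroup_one[OF is_subgroup_PL] by blast
next
  case False
  then obtain m where m: "m \<in> N" "m \<noteq> 1" using subgroup_one[OF N(1)] by blast
  then obtain w where w: "app m w \<noteq> w" by (metis app_one pl2_eqI)
  then have w01: "0 < w" "w < 1" using m N(2) PL_D[of m 0 1 w] by force+
  have CN: "PLc 0 1 \<subseteq> N"
    by (rule PLc_simple[OF zero_less_one N(1) _ m(1) w01 w]) (use normal PLc_subset_PL in blast)
  have S': "finite S" "S \<subseteq> PL 0 1" "PLc 0 1 \<subseteq> gen S" using S N(2) CN gen_base by auto
  have ex: "\<exists>a b. germs a b n" if "n \<in> N" for n using germs_exist that N(2) by blast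
  define A where "A = {a. \<exists>b. \<exists>n\<in>N. germs a b n}"
  have "0 \<in> A" unfolding A_def using germs_one subgroup_one[OF N(1)] by blast
  moreover have "x - y \<in> A" if xy: "x \<in> A" "y \<in> A" for x y
  proof -
    obtain b n b' n' where "n \<in> N" "germs x b n" "n' \<in> N" "germs y b' n'" using xy unfolding A_def by blast
    then show ?thesis
      using germs_mult[OF _ germs_inverse, of x b n y b' n'] subgroup_mult[OF N(1) _ subgroup_inverse[OF N(1)], of n n']
      unfolding A_def by auto
  qed
  ultimately obtain a where a: "0 \<le> a" "a \<in> A" "\<And>x. x \<in> A \<Longrightarrow> \<exists>i. x = i * a"
    using int_subgroup_cyclic[of A] by blast
  define D where "D = {b. \<exists>n\<in>N. germs 0 b n}"
  have "0 \<in> D" unfolding D_def using germs_one subgroup_one[OF N(1)] by blast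
  moreover have "x - y \<in> D" if xy: "x \<in> D" "y \<in> D" for x y
  proof -
    obtain n n' where "n \<in> N" "germs 0 x n" "n' \<in> N" "germs 0 y n'" using xy unfolding D_def by blast
    then show ?thesis
      using germs_mult[OF _ germs_inverse, of 0 x n 0 y n'] subgroup_mult[OF N(1) _ subgroup_inverse[OF N(1)], of n n']
      unfolding D_def by auto
  qed
  ultimately obtain d where d: "0 \<le> d" "d \<in> D" "\<And>x. x \<in> D \<Longrightarrow> \<exists>j. x = j * d"
    using int_subgroup_cyclic[of D] by blast
  obtain b0 n0 where n0: "n0 \<in> N" "germs a b0 n0" using a(2) unfolding A_def by blast
  obtain nd where nd: "nd \<in> N" "germs 0 d nd" using d(2) unfolding D_def by blast
  have shape: "\<exists>i j. germs (i * a) (i * b0 + j * d) n" if n: "n \<in> N" for n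
  proof -
    obtain x y where xy: "germs x y n" using ex[OF n] by blast
    then obtain i where i: "x = i * a" using a(3)[of x] n unfolding A_def by blast
    have "germs 0 (y - i * b0) (n * inverse (n0 powi i))"
      using germs_mult[OF xy germs_inverse[OF germs_power_int[OF n0(2), of i]]] i by simp
    moreover have "n * inverse (n0 powi i) \<in> N"
      using n n0(1) by (intro subgroup_mult[OF N(1)] subgroup_inverse[OF N(1)] subgroup_power_int[OF N(1)])
    ultimately obtain j where "y - i * b0 = j * d" using d(3)[of "y - i * b0"] unfolding D_def by blast
    then have "y = i * b0 + j * d" by simp
    then show ?thesis using xy i by blast
  qed
  have "a \<noteq> 0"
  proof
    assume "a = 0"
    obtain n where n: "n \<in> S" "\<not> rgerm 0 0 n" using rgerm_nontrivial[OF S'] by blast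
    then show False using shape[of n] \<open>a = 0\<close> S gen_base unfolding germs_def by auto
  qed
  then have "0 < a" using a(1) by simp
  have b0d: "\<not> (b0 = 0 \<and> d = 0)"
  proof
    assume *: "b0 = 0 \<and> d = 0"
    obtain n where n: "n \<in> S" "\<not> lgerm 1 0 n" using lgerm_nontrivial[OF S'] by blast
    then show False using shape[of n] * S gen_base unfolding germs_def by auto
  qed
  obtain k f r s where f: "germs a (b0 + k * d) f" and r: "germs 0 d r" and s: "s \<in> PLc 0 1"
    and gen: "PLc 0 1 \<subseteq> gen {f, r * s}"
  proof (cases "d = 0 \<and> b0 < 0")
    case True
    obtain f s where "f \<in> PL 0 1" "rgerm 0 a f" "lgerm 1 b0 f" "s \<in> PLc 0 1" "PLc 0 1 \<subseteq> gen {f, s}"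
      using generating_pair_opposite[of a b0 S] \<open>0 < a\<close> True S' by blast
    then show thesis using that[of 0 f 1 s] True germs_one by (simp add: germs_def)
  next
    case False
    \<comment> \<open>adding \<open>\<bar>b0\<bar> + 1\<close> times the second basis vector makes the slope exponent at 1 positive\<close>
    define k where "k = (if d = 0 then 0 else \<bar>b0\<bar> + 1)"
    have "0 < b0 + k * d"
    proof (cases "d = 0")
      case True
      then show ?thesis using False b0d by (simp add: k_def)
    next
      case d0: False
      have k: "k = \<bar>b0\<bar> + 1" using d0 by (simp add: k_def)
      have "k * 1 \<le> k * d" using d(1) d0 k by (intro mult_left_mono) auto
      then show ?thesis using k by linarith
    qed
    then obtain f r s where "f \<in> PL 0 1" "rgerm 0 a f" "lgerm 1 (b0 + k * d) f"
      "r \<in> PL 0 1" "rgerm 0 0 r" "lgerm 1 d r" "s \<in> PLc 0 1" "PLc 0 1 \<subseteq> gen {f, r * s}"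
      using generating_pair_same[of a "b0 + k * d" S d] \<open>0 < a\<close> S' by blast
    then show thesis using that[of k f r s] by (simp add: germs_def)
  qed
  have "germs a (b0 + k * d) (n0 * nd powi k)"
    using germs_mult[OF n0(2) germs_power_int[OF nd(2), of k]] by simp
  then have fN: "f \<in> N"
    using same_germs_mem[OF N(1) CN f] n0(1) nd(1) subgroup_mult[OF N(1)] subgroup_power_int[OF N(1)] by blast
  have rN: "r \<in> N" by (rule same_germs_mem[OF N(1) CN r nd(2,1)])
  let ?H = "gen {f, r * s}"
  have H: "is_subgroup ?H" "f \<in> ?H" "r * s \<in> ?H" by (auto intro: is_subgroup_gen gen_base)
  have "r * s \<in> N" using rN s CN subgroup_mult[OF N(1)] by blast
  then have "?H \<subseteq> N" using fN by (intro gen_least N(1)) auto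
  moreover have "N \<subseteq> ?H"
  proof
    fix n assume n: "n \<in> N"
    obtain i j where ij: "germs (i * a) (i * b0 + j * d) n" using shape[OF n] by blast
    have "r * s * inverse s \<in> ?H"
      using subgroup_mult[OF H(1,3) subgroup_inverse[OF H(1)]] s gen by blast
    then have rH: "r \<in> ?H" by (simp add: mult.assoc)
    have "germs (i * a) (i * b0 + j * d) (f powi i * r powi (j - i * k))"
      using germs_mult[OF germs_power_int[OF f, of i] germs_power_int[OF r, of "j - i * k"]]
      by (simp add: algebra_simps)
    then show "n \<in> ?H"
      using same_germs_mem[OF H(1) gen ij] H rH by (meson subgroup_mult subgroup_power_int)
  qed
  ultimately have "?H = N" by blast
  moreover have "f \<in> PL 0 1" "r * s \<in> PL 0 1" using fN \<open>r * s \<in> N\<close> N(2) by auto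
  ultimately show ?thesis by blast
qed

section \<open>Thompson's group as a group of maps of the line\<close>

definition on_unit :: "pl2 \<Rightarrow> real \<Rightarrow> real" where
  "on_unit h = restrict (app h) {0..1}"

lemma on_unit_maps:
  assumes "h \<in> PL 0 1"
  shows "on_unit h \<in> thompson_F_maps"
proof -
  have bounds: "app h x \<in> {0..1}" if "x \<in> {0..1}" for x
    using PL_app_bounds[OF assms, of x] that by auto
  have "bij_betw (app h) {0..1} {0..1}"
  proof (rule bij_betwI[where g = "app (inverse h)"])
    show "app (inverse h) \<in> {0..1} \<rightarrow> {0..1}"
      using PL_app_bounds[OF subgroup_inverse[OF is_subgroup_PL assms]] by auto
  qed (use bounds in auto)
  then have bij: "bij_betw (on_unit h) {0..1} {0..1}"
    by (subst bij_betw_cong[of _ _ "app h"]) (auto simp: on_unit_def)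
  have "continuous_on {0..1} (app h)"
    by (simp add: app_continuous continuous_at_imp_continuous_on)
  then have "continuous_on {0..1} (on_unit h)"
    by (rule continuous_on_eq) (simp add: on_unit_def)
  then have hom: "\<exists>g. homeomorphism {0..1} {0..1} (on_unit h) g"
    using bij homeomorphism_unit_interval_iff by blast
  obtain B where B: "finite B" "B \<subseteq> dyadic_rationals"
    "\<And>a b. {a<..<b} \<inter> B = {} \<Longrightarrow> \<exists>(k::int) c. \<forall>x\<in>{a<..<b}. app h x = 2 powi k * x + c"
    using is_pl2_app[of h] unfolding is_pl2_def by blast
  have "affine_pow2_off (B \<inter> {0<..<1}) (on_unit h)"
    unfolding affine_pow2_off_def
  proof (intro allI impI)
    fix a b :: real assume ab: "{a<..<b} \<subseteq> {0..1} - B \<inter> {0<..<1}"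
    have "{a<..<b} \<subseteq> {0<..<1}"
    proof
      fix x assume x: "x \<in> {a<..<b}"
      then have "(a + x) / 2 \<in> {a<..<b}" "(x + b) / 2 \<in> {a<..<b}" by auto
      then have "(a + x) / 2 \<in> {0..1}" "(x + b) / 2 \<in> {0..1}" using ab by blast+
      then show "x \<in> {0<..<1}" using x by auto
    qed
    then have "{a<..<b} \<inter> B = {}" using ab by blast
    from B(3)[OF this] ab show "\<exists>(k::int) c. \<forall>x\<in>{a<..<b}. on_unit h x = 2 powi k * x + c"
      unfolding on_unit_def by (metis Diff_iff restrict_apply' subsetD)
  qed
  moreover have "finite (B \<inter> {0<..<1})" "B \<inter> {0<..<1} \<subseteq> dyadic_rationals \<inter> {0<..<1}" using B by auto
  ultimately show ?thesis
    unfolding thompson_F_maps_def using hom by (auto simp: on_unit_def)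
qed

lemma on_unit_surj:
  assumes "f \<in> thompson_F_maps"
  obtains h where "h \<in> PL 0 1" "on_unit h = f"
proof -
  obtain B where B: "finite B" "B \<subseteq> dyadic_rationals \<inter> {0<..<1}" "affine_pow2_off B f"
    using assms unfolding thompson_F_maps_def by blast
  have ext: "f \<in> extensional {0..1}" using assms unfolding thompson_F_maps_def by blast
  have bij: "bij_betw f {0..1} {0..1}"
    using assms homeomorphism_unit_interval_iff unfolding thompson_F_maps_def by blast
  have f01: "f x \<in> {0..1}" if "x \<in> {0..1}" for x using bij_betw_apply[OF bij that] .
  note sm = thompson_F_strict_mono[OF assms]
  define F where "F x = (if x \<in> {0..1} then f x else x)" for x
  have "is_pl2 F"
  proof (rule is_pl2I[where B = "insert 0 (insert 1 B)"])
    show "strict_mono F"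
    proof (rule strict_monoI)
      fix x y :: real assume "x < y"
      then show "F x < F y"
        using f01[of x] f01[of y] strict_mono_onD[OF sm, of x y]
        by (cases "x \<in> {0..1}"; cases "y \<in> {0..1}") (simp_all add: F_def, linarith+)
    qed
    show "surj F"
      unfolding surj_def
    proof
      fix y
      show "\<exists>x. y = F x"
      proof (cases "y \<in> {0..1}")
        case True
        then have "y \<in> f ` {0..1}" using bij_betw_imp_surj_on[OF bij] by simp
        then obtain x where x: "x \<in> {0..1}" "y = f x" by (rule imageE)
        show ?thesis by (rule exI[of _ x]) (simp only: F_def x if_True)
      next
        case False
        then show ?thesis by (intro exI[of _ y]) (simp only: F_def if_False)
      qed
    qed
    show "F x \<in> dyadic_rationals \<longleftrightarrow> x \<in> dyadic_rationals" for x
      using thompson_F_dyadic_iff[OF assms, of x] by (simp add: F_def)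
    show "finite (insert 0 (insert 1 B))" "insert 0 (insert 1 B) \<subseteq> dyadic_rationals" using B by auto
    fix a b :: real assume ab: "a < b" "{a<..<b} \<inter> insert 0 (insert 1 B) = {}"
    show "\<exists>(k::int) c. \<forall>x\<in>{a<..<b}. F x = 2 powi k * x + c"
    proof (cases "0 \<le> a \<and> b \<le> 1")
      case True
      then have "{a<..<b} \<subseteq> {0..1} - B" using ab(2) by auto
      then obtain k c where "\<forall>x\<in>{a<..<b}. f x = 2 powi (k::int) * x + c"
        using B(3) unfolding affine_pow2_off_def by blast
      then show ?thesis using True by (intro exI[of _ k] exI[of _ c]) (auto simp: F_def)
    next
      case False
      moreover have "0 \<notin> {a<..<b}" "1 \<notin> {a<..<b}" using ab(2) by blast+
      ultimately have "b \<le> 0 \<or> 1 \<le> a" using ab(1) by auto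
      then have "\<forall>x\<in>{a<..<b}. F x = 2 powi 0 * x + 0" by (auto simp: F_def)
      then show ?thesis by blast
    qed
  qed
  define h where "h = Abs_pl2 F"
  have h: "app h = F" unfolding h_def using \<open>is_pl2 F\<close> by (rule app_Abs)
  show thesis
  proof (rule that[of h])
    show "h \<in> PL 0 1"
      using thompson_F_endpoints[OF assms] by (auto simp: PL_def h F_def)
    show "on_unit h = f"
      using ext by (auto simp: on_unit_def h F_def extensional_def fun_eq_iff)
  qed
qed

lemma on_unit_inject:
  assumes "g \<in> PL 0 1" "h \<in> PL 0 1" "on_unit g = on_unit h"
  shows "g = h"
proof (rule pl2_eqI)
  fix x
  show "app g x = app h x"
  proof (cases "x \<in> {0..1}")
    case True
    then show ?thesis using fun_cong[OF assms(3), of x] by (simp add: on_unit_def)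
  next
    case False
    then show ?thesis using PL_D[OF assms(1), of x] PL_D[OF assms(2), of x] by auto
  qed
qed

lemma on_unit_mult:
  assumes "g \<in> PL 0 1" "h \<in> PL 0 1"
  shows "on_unit (g * h) = on_unit g \<otimes>\<^bsub>thompson_F\<^esub> on_unit h"
proof -
  have "on_unit g \<otimes>\<^bsub>thompson_F\<^esub> on_unit h = compose {0..1} (on_unit g) (on_unit h)"
    using on_unit_maps[OF assms(1)] on_unit_maps[OF assms(2)] thompson_F_maps_subset_Bij
    by (auto simp: thompson_F_def BijGroup_def)
  also have "\<dots> = on_unit (g * h)"
    using PL_app_bounds[OF assms(2)] by (auto simp: on_unit_def compose_def fun_eq_iff)
  finally show ?thesis by simp
qed

lemma carrier_thompson_F [simp]: "carrier thompson_F = thompson_F_maps"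
  by (simp add: thompson_F_def)

lemma on_unit_one: "on_unit 1 = \<one>\<^bsub>thompson_F\<^esub>"
proof -
  interpret F: group thompson_F by (rule group_thompson_F)
  have 1: "1 \<in> PL 0 1" using subgroup_one[OF is_subgroup_PL] .
  have "on_unit 1 \<otimes>\<^bsub>thompson_F\<^esub> on_unit 1 = on_unit 1" using on_unit_mult[OF 1 1] by simp
  then show ?thesis using on_unit_maps[OF 1] F.l_cancel_one' by (metis F.r_cancel_one' carrier_thompson_F)
qed

lemma on_unit_inverse:
  assumes "h \<in> PL 0 1"
  shows "on_unit (inverse h) = inv\<^bsub>thompson_F\<^esub> on_unit h"
proof -
  interpret F: group thompson_F by (rule group_thompson_F)
  have i: "inverse h \<in> PL 0 1" using subgroup_inverse[OF is_subgroup_PL assms] .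
  have "on_unit (inverse h) \<otimes>\<^bsub>thompson_F\<^esub> on_unit h = \<one>\<^bsub>thompson_F\<^esub>"
    using on_unit_mult[OF i assms] on_unit_one by simp
  then show ?thesis using on_unit_maps[OF i] on_unit_maps[OF assms] F.inv_equality by simp
qed

lemma on_unit_gen:
  assumes "S \<subseteq> PL 0 1"
  shows "on_unit ` gen S = generate thompson_F (on_unit ` S)"
proof
  have PL: "gen S \<subseteq> PL 0 1" using assms by (intro gen_least is_subgroup_PL)
  show "on_unit ` gen S \<subseteq> generate thompson_F (on_unit ` S)"
  proof
    fix y assume "y \<in> on_unit ` gen S"
    then obtain x where x: "x \<in> gen S" "y = on_unit x" by blast
    interpret F: group thompson_F by (rule group_thompson_F)
    have sub: "on_unit ` S \<subseteq> carrier thompson_F" using assms on_unit_maps by auto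
    from x(1) have "on_unit x \<in> generate thompson_F (on_unit ` S)"
    proof induction
      case gen_one
      then show ?case by (simp add: on_unit_one generate.one)
    next
      case (gen_base x)
      then show ?case by (intro generate.incl) auto
    next
      case (gen_mult x y)
      then have "x \<in> PL 0 1" "y \<in> PL 0 1" using PL by auto
      then show ?case using gen_mult by (simp add: on_unit_mult generate.eng)
    next
      case (gen_inverse x)
      then have "x \<in> PL 0 1" using PL by auto
      then show ?case using gen_inverse F.generate_m_inv_closed[OF sub] by (simp add: on_unit_inverse)
    qed
    then show "y \<in> generate thompson_F (on_unit ` S)" using x(2) by simp
  qed
  show "generate thompson_F (on_unit ` S) \<subseteq> on_unit ` gen S"
  proof
    fix y assume "y \<in> generate thompson_F (on_unit ` S)"
    then show "y \<in> on_unit ` gen S"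
    proof induction
      case one
      then show ?case by (intro image_eqI[of _ _ 1]) (simp_all add: on_unit_one gen_one)
    next
      case (incl h)
      then show ?case by (auto intro: gen_base)
    next
      case (inv h)
      then obtain x where x: "x \<in> S" "h = on_unit x" by blast
      then show ?case using assms
        by (intro image_eqI[of _ _ "inverse x"]) (auto simp: on_unit_inverse intro: gen_inverse gen_base)
    next
      case (eng h1 h2)
      then obtain x1 x2 where x: "x1 \<in> gen S" "h1 = on_unit x1" "x2 \<in> gen S" "h2 = on_unit x2" by blast
      then show ?case using PL
        by (intro image_eqI[of _ _ "x1 * x2"]) (auto simp: on_unit_mult subset_iff intro: gen_mult)
    qed
  qed
qed

theorem corollary3:
  fixes N :: "(real \<Rightarrow> real) set"
  assumes "N \<lhd> thompson_F"
    and "finitely_generated_subgroup N thompson_F"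
  shows "two_generated_subgroup N thompson_F"
proof -
  interpret F: group thompson_F by (rule group_thompson_F)
  interpret N: normal N thompson_F by (rule assms(1))
  obtain S where S: "finite S" "S \<subseteq> thompson_F_maps" "generate thompson_F S = N"
    using assms(2) unfolding finitely_generated_subgroup_def by auto
  have "\<exists>h. h \<in> PL 0 1 \<and> on_unit h = x" if "x \<in> S" for x
    using on_unit_surj[of x] S(2) that by blast
  then have "\<forall>x\<in>S. \<exists>h. h \<in> PL 0 1 \<and> on_unit h = x" by blast
  then obtain lift where lift: "\<forall>x\<in>S. lift x \<in> PL 0 1 \<and> on_unit (lift x) = x"
    by (rule bchoice[THEN exE])
  define T where "T = lift ` S"
  have T: "finite T" "T \<subseteq> PL 0 1" "on_unit ` T = S"
    unfolding T_def using lift S(1) by (auto simp: image_image)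
  have TN: "on_unit ` gen T = N" using on_unit_gen[OF T(2)] T(3) S(3) by simp
  have genT: "gen T \<subseteq> PL 0 1" using T(2) by (intro gen_least is_subgroup_PL)
  have "\<exists>g\<in>PL 0 1. \<exists>h\<in>PL 0 1. gen {g, h} = gen T"
  proof (rule two_generated_PL[OF is_subgroup_gen genT _ T(1) refl])
    fix x y assume x: "x \<in> PL 0 1" and y: "y \<in> gen T"
    have yP: "y \<in> PL 0 1" and ix: "inverse x \<in> PL 0 1"
      using y genT subgroup_inverse[OF is_subgroup_PL x] by auto
    have xy: "conj_by x y \<in> PL 0 1" using x y genT subgroup_conj_by[OF is_subgroup_PL] by blast
    have "on_unit (conj_by x y) = on_unit x \<otimes>\<^bsub>thompson_F\<^esub> on_unit y \<otimes>\<^bsub>thompson_F\<^esub> inv\<^bsub>thompson_F\<^esub> on_unit x"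
      by (simp only: conj_by_def on_unit_mult[OF subgroup_mult[OF is_subgroup_PL x yP] ix]
          on_unit_mult[OF x yP] on_unit_inverse[OF x])
    also have "\<dots> \<in> N"
      using N.inv_op_closed2[of "on_unit x" "on_unit y"] on_unit_maps[OF x] TN y by auto
    finally have "on_unit (conj_by x y) \<in> on_unit ` gen T" using TN by simp
    then obtain z where "z \<in> gen T" "on_unit (conj_by x y) = on_unit z" by blast
    then show "conj_by x y \<in> gen T" using on_unit_inject[OF xy] genT by blast
  qed
  then obtain g h where gh: "g \<in> PL 0 1" "h \<in> PL 0 1" "gen {g, h} = gen T" by blast
  have "generate thompson_F {on_unit g, on_unit h} = N"
    using on_unit_gen[of "{g, h}"] gh TN by simp
  moreover have "on_unit g \<in> carrier thompson_F" "on_unit h \<in> carrier thompson_F"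
    using gh on_unit_maps by auto
  ultimately show ?thesis
    unfolding two_generated_subgroup_def using N.subgroup_axioms by blast
qed

end
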